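(* Let $s_j=\sigma_j+it_j\in\mathbb{C}$ ($j=1,2,3$) with $\sigma_1\ge0$, $t_1\ge0$, $\sigma_3>0$, $t_3\ge2$, $\sigma_1+\sigma_3>\tfrac12$ and $\tfrac32<\sigma_1+\sigma_2+\sigma_3\le2$, with $s_1,s_2,\sigma_3$ fixed. Assume that as $t_3$ runs from $2$ to $T$ the point $(s_1,s_2,s_3)$ never lies on the hyperplanes $s_1+s_3=1$ or $s_1+s_2+s_3=2$. Then as $T\to\infty$, $$\int_2^T|\zeta_{AV,2}(s_1,s_2,s_3)|^2dt_3=\zeta_{AV,2}^{[2]}(s_1,s_2,2\sigma_3)T+\begin{cases}O(T^{2-2\sigma_1-2\sigma_3}\log T)&(\sigma_2\ge\tfrac12+\sigma_1+\sigma_3),\\ O(T^{5/2-\sigma_1-\sigma_2-\sigma_3})&(\sigma_2<\tfrac12+\sigma_1+\sigma_3,\ \tfrac32<\sigma_1+\sigma_2+\sigma_3<2),\\ O((T\log T)^{1/2})&(\sigma_2<\tfrac12+\sigma_1+\sigma_3,\ \sigma_1+\sigma_2+\sigma_3=2),\end{cases}$$ where the implied constants depend on $s_1,s_2$ and $\sigma_3$.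
   Context: Write $s_j=\sigma_j+it_j$ with $\sigma_j,t_j\in\mathbb{R}$; complex powers $n^{s}=e^{s\log n}$ use the real logarithm. The Apostol–Vu double zeta-function is $\zeta_{AV,2}(s_1,s_2,s_3)=\sum_{m=1}^\infty\sum_{n<m}m^{-s_1}n^{-s_2}(m+n)^{-s_3}$ (positive integers $n<m$), absolutely convergent for $\sigma_1+\sigma_3>1$, $\sigma_1+\sigma_2+\sigma_3>2$, and extended meromorphically to $\mathbb{C}^3$ (singularities only on $s_1+s_3=1-l$, $s_1+s_2+s_3=2-l$, $l\in\mathbb{Z}_{\ge0}$); $\zeta_{AV,2}$ denotes this continuation. Also $\zeta_{AV,2}^{[2]}(s_1,s_2,s_3)=\sum_{k=2}^\infty\left|\sum_{k/2<m\le k-1}m^{-s_1}(k-m)^{-s_2}\right|^2k^{-s_3}$. *)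

theory Defs
  imports "HOL-Analysis.Analysis" "HOL-Library.Landau_Symbols"
begin

text \<open>Apostol--Vu double zeta series (absolutely convergent region).
  Complex powers n^s = exp(s log n) with the real logarithm, i.e. powr on complex
  for positive real base.\<close>
definition AV2_series :: "complex \<Rightarrow> complex \<Rightarrow> complex \<Rightarrow> complex" where
  "AV2_series s1 s2 s3 =
     (\<Sum>\<^sub>\<infinity>(m, n) \<in> {(m::nat, n::nat). 0 < n \<and> n < m}.
        (of_nat m) powr (-s1) * (of_nat n) powr (-s2) * (of_nat (m + n)) powr (-s3))"

definition AV2_sing :: "complex \<Rightarrow> complex \<Rightarrow> complex set" where
  "AV2_sing s1 s2 = {s3. \<exists>l::nat. s1 + s3 = 1 - of_nat l \<or> s1 + s2 + s3 = 2 - of_nat l}"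

text \<open>The meromorphic continuation, restricted to the complex line with s1, s2 fixed:
  the (unique, by the identity theorem) function of s3 holomorphic off the singular set that
  agrees with the series on the region of absolute convergence.\<close>
definition zeta_AV2 :: "complex \<Rightarrow> complex \<Rightarrow> complex \<Rightarrow> complex" where
  "zeta_AV2 s1 s2 =
     (SOME f. f holomorphic_on (- AV2_sing s1 s2) \<and>
        (\<forall>s3. Re s1 + Re s3 > 1 \<and> Re s1 + Re s2 + Re s3 > 2 \<longrightarrow> f s3 = AV2_series s1 s2 s3))"

definition zeta_AV2_sq :: "complex \<Rightarrow> complex \<Rightarrow> real \<Rightarrow> real" where
  "zeta_AV2_sq s1 s2 s3 =
     (\<Sum>j. let k = j + 2 in
        (cmod (\<Sum>m \<in> {m::nat. real k / 2 < real m \<and> m \<le> k - 1}.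
            (of_nat m) powr (-s1) * (of_nat (k - m)) powr (-s2)))^2 * real k powr (-s3))"

end

(*
  The Dirichlet series of zeta_AV2 in s3 has coefficients a_k = sum of m^(-s1) n^(-s2) over n < m,
  m + n = k. Comparing the sum over m > N (n fixed) of phi(m) = m^(-s1) (m+n)^(-s3) with the integral
  by the Euler-Maclaurin formula of arbitrary order reduces everything to the Riemann zeta function and
  one integral, and gives the meromorphic continuation.

  For the mean square, let s3 = sigma3 + it with T <= t <= 2T and let X be of order T. Since
  phi'/phi is small and slowly varying beyond X, sum and integral of phi differ by O(N^(-alpha)),
  alpha = Re s1 + sigma3, for N >= X. Hence zeta_AV2 is its partial sum over m <= X up to O(T^(-gamma)),
  where a_k k^(-sigma3) = O(k^(-gamma)). The mean square of the partial sum is T times the sum of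
  |a_k|^2 k^(-2 sigma3) up to O(T^(2-2gamma) log T), the off-diagonal terms being bounded via
  |log (k/j)| >= |k-j| / max(j,k). Adding up dyadic intervals gives the error O(T^(2-2gamma) log T) for
  every admissible gamma in (1/2, 1), which contains all three cases.
*)
theory Submission
  imports Defs "HOL-Complex_Analysis.Complex_Analysis" "HOL-Real_Asymp.Real_Asymp"
begin

text \<open>\<open>zeta_AV2\<close> is picked by \<open>SOME\<close>, so nothing can be said about
  it before a function holomorphic off all of \<open>AV2_sing\<close> exists. That is why
  Euler-Maclaurin of every order occurs, although the mean square only needs the half-plane reached
  by order one.

  The obstacle in the approximation is the size of s3. The direct first-order estimate of sum minus
  integral, by the integral of |phi'|, is of order |s3| N^(-alpha) and loses a factor T when N has
  order T. The loss is avoided by freezing phi'/phi on each unit interval: for a pure exponential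
  the difference telescopes exactly, and the relative freezing error near m is O(|s3| / m^2), whose
  sum over m \<ge> N is bounded for N of order |s3|. The corresponding loss in the integral is
  recovered from the denominator s1 + s3 - 1.

  Sums of n^(-Re s2) over n \<le> X grow like a power, like a logarithm or not at all. A single
  parameter p > 1 with p \<ge> Re s2 and the bound X^(p - Re s2) replaces these cases; it makes
  gamma = Re s1 + Re s2 + sigma3 - p.\<close>

section \<open>Euler--Maclaurin summation on unit intervals\<close>

text \<open>The function \<open>bern k\<close> is the \<open>k\<close>-th Bernoulli polynomial divided by \<open>k!\<close>.\<close>
primrec bern :: "nat \<Rightarrow> real \<Rightarrow> real" where
  "bern 0 = (\<lambda>x. 1)"
| "bern (Suc k) = (\<lambda>x. integral {0..x} (bern k) - integral {0..1} (\<lambda>y. integral {0..y} (bern k)))"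

lemma continuous_on_bern: "continuous_on {0..1} (bern k)"
proof (induction k)
  case (Suc k)
  have "(bern k) integrable_on {0..1}" using Suc by (rule integrable_continuous_real)
  then show ?case by (auto intro!: continuous_intros indefinite_integral_continuous_1)
qed simp

lemma bern_has_derivative:
  assumes "x \<in> {0..1}"
  shows "(bern (Suc k) has_real_derivative bern k x) (at x within {0..1})"
  using integral_has_real_derivative[OF continuous_on_bern assms]
  by (auto intro!: derivative_eq_intros)

lemma integral_bern_Suc: "integral {0..1} (bern (Suc k)) = 0"
proof -
  have "(bern k) integrable_on {0..1}" by (rule integrable_continuous_real[OF continuous_on_bern])
  then have "(\<lambda>y. integral {0..y} (bern k)) integrable_on {0..1}"
    by (rule integrable_continuous_real[OF indefinite_integral_continuous_1])
  from integral_diff[OF this integrable_const_ivl[of "integral {0..1} (\<lambda>y. integral {0..y} (bern k))" 0 1]]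
  show ?thesis by simp
qed

text \<open>The jump at \<open>k = 0\<close> produces the summand \<open>f 0 (m+1)\<close> in the
  formula below. For larger \<open>k\<close> the equal end values turn the boundary terms into
  differences \<open>f k (m+1) - f k m\<close>, which telescope over \<open>m\<close>.\<close>

lemma bern_1_minus_0: "bern (Suc k) 1 - bern (Suc k) 0 = (if k = 0 then 1 else 0)"
proof -
  have "bern (Suc k) 1 - bern (Suc k) 0 = integral {0..1} (bern k)" by simp
  also have "\<dots> = (if k = 0 then 1 else 0)"
    using integral_bern_Suc[of "k - 1"] by (cases k) auto
  finally show ?thesis .
qed

text \<open>These are the numbers B_(j+1) / (j+1)! in the convention B_1 = +1/2: the sign only
  affects odd indices j + 1, and there only B_1 is nonzero.\<close>

definition em_coeff :: "nat \<Rightarrow> real" where "em_coeff j = (-1) ^ Suc j * bern (Suc j) 0"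

definition em_int :: "(nat \<Rightarrow> real \<Rightarrow> complex) \<Rightarrow> real \<Rightarrow> nat \<Rightarrow> complex" where
  "em_int f m k = integral {m..m+1} (\<lambda>x. bern k (x - m) *\<^sub>R f k x)"

lemma em_bern_continuous_on: "continuous_on {m..m+(1::real)} (\<lambda>x. bern k (x - m))"
  by (rule continuous_on_compose2[OF continuous_on_bern]) (auto intro!: continuous_intros)

context
  fixes f :: "nat \<Rightarrow> real \<Rightarrow> complex" and m :: real
  assumes f: "\<And>k x. x \<in> {m..m+1} \<Longrightarrow> (f k has_vector_derivative f (Suc k) x) (at x within {m..m+1})"
begin

lemma em_continuous_on: "continuous_on {m..m+1} (f k)"
  using f continuous_on_vector_derivative by blast

lemma em_integrand_integrable: "(\<lambda>x. bern k (x - m) *\<^sub>R f k x) integrable_on {m..m+1}"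
  by (intro integrable_continuous_real continuous_intros em_bern_continuous_on em_continuous_on)

lemma em_int_step:
  "em_int f m k = bern (Suc k) 1 *\<^sub>R f k (m+1) - bern (Suc k) 0 *\<^sub>R f k m - em_int f m (Suc k)"
proof -
  have "((\<lambda>x. bern k (x - m) *\<^sub>R f k x) has_integral
      (bern (Suc k) 1 *\<^sub>R f k (m+1) - bern (Suc k) 0 *\<^sub>R f k m - em_int f m (Suc k))) {m..m+1}"
  proof (rule integration_by_parts_interior[where prod = scaleR])
    show "((\<lambda>x. bern (Suc k) (x - m) *\<^sub>R f (Suc k) x) has_integral
        (bern (Suc k) (m + 1 - m) *\<^sub>R f k (m+1) - bern (Suc k) (m - m) *\<^sub>R f k m
          - (bern (Suc k) 1 *\<^sub>R f k (m+1) - bern (Suc k) 0 *\<^sub>R f k m - em_int f m (Suc k)))) {m..m+1}"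
      using em_integrand_integrable[of "Suc k"] by (simp add: em_int_def has_integral_integral del: bern.simps)
    fix x assume x: "x \<in> {m<..<m+1}"
    have "(bern (Suc k) has_real_derivative bern k (x - m)) (at (x - m))"
      using bern_has_derivative[of "x - m" k] x by (simp add: at_within_Icc_at del: bern.simps)
    then have "((\<lambda>x. bern (Suc k) (x - m)) has_real_derivative bern k (x - m) * 1) (at x)"
      by (rule DERIV_chain2) (auto intro!: derivative_eq_intros)
    then show "((\<lambda>x. bern (Suc k) (x - m)) has_vector_derivative bern k (x - m)) (at x)"
      by (simp add: has_real_derivative_iff_has_vector_derivative del: bern.simps)
    show "(f k has_vector_derivative f (Suc k) x) (at x)"
      using f[of x k] x by (simp add: at_within_Icc_at)
  qed (use em_continuous_on em_bern_continuous_on bounded_bilinear_scaleR in \<open>auto simp del: bern.simps\<close>)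
  then show ?thesis by (simp add: em_int_def integral_unique del: bern.simps)
qed

lemma euler_maclaurin_unit:
  "f 0 (m+1) - integral {m..m+1} (f 0) - (\<Sum>j<Suc K. em_coeff j *\<^sub>R (f j (m+1) - f j m))
     = (-1) ^ K * em_int f m (Suc K)"
proof (induction K)
  case 0
  have "bern 1 1 = 1 + bern 1 0" using bern_1_minus_0[of 0] by (simp del: bern.simps)
  moreover have "em_int f m 0 = integral {m..m+1} (f 0)" by (simp add: em_int_def)
  ultimately show ?case using em_int_step[of 0]
    by (simp add: em_coeff_def algebra_simps scaleR_conv_of_real del: bern.simps)
next
  case (Suc K)
  have "bern (Suc (Suc K)) 1 = bern (Suc (Suc K)) 0"
    using bern_1_minus_0[of "Suc K"] by (simp del: bern.simps)
  with em_int_step[of "Suc K"]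
  have "em_int f m (Suc K) = bern (Suc (Suc K)) 0 *\<^sub>R (f (Suc K) (m+1) - f (Suc K) m) - em_int f m (Suc (Suc K))"
    by (simp add: scaleR_diff_right del: bern.simps)
  with Suc show ?case
    by (simp add: em_coeff_def algebra_simps scaleR_conv_of_real del: bern.simps)
qed

end

lemma bern_bounded: "\<exists>C>0. \<forall>x\<in>{0..1}. \<bar>bern k x\<bar> \<le> C"
proof -
  have "compact (bern k ` {0..1})" by (intro compact_continuous_image continuous_on_bern) auto
  then obtain C where "\<forall>y\<in>bern k ` {0..1}. norm y \<le> C" by (meson bounded_iff compact_imp_bounded)
  then show ?thesis by (intro exI[of _ "max C 1"]) (auto simp: le_max_iff_disj)
qed

text \<open>The constant is obtained before \<open>f\<close> and \<open>m\<close> and depends on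
  \<open>K\<close> alone. This uniformity makes the later errors summable over m and locally uniform
  in s.\<close>

lemma euler_maclaurin_bound:
  assumes "K > 0"
  obtains C where "C > 0"
    "\<And>f :: nat \<Rightarrow> real \<Rightarrow> complex. \<And>m B.
      (\<And>k x. x \<in> {m..m+1} \<Longrightarrow> (f k has_vector_derivative f (Suc k) x) (at x within {m..m+1})) \<Longrightarrow>
      (\<And>x. x \<in> {m..m+1} \<Longrightarrow> norm (f K x) \<le> B) \<Longrightarrow>
      norm (f 0 (m+1) - integral {m..m+1} (f 0) - (\<Sum>j<K. em_coeff j *\<^sub>R (f j (m+1) - f j m))) \<le> C * B"
proof -
  obtain K' where K: "K = Suc K'" using assms gr0_implies_Suc by auto
  obtain C where C: "C > 0" "\<forall>x\<in>{0..1}. \<bar>bern K x\<bar> \<le> C" using bern_bounded by blast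
  show ?thesis
  proof (rule that[of C])
    fix f :: "nat \<Rightarrow> real \<Rightarrow> complex" and m B
    assume f: "\<And>k x. x \<in> {m..m+1} \<Longrightarrow> (f k has_vector_derivative f (Suc k) x) (at x within {m..m+1})"
      and B: "\<And>x. x \<in> {m..m+1} \<Longrightarrow> norm (f K x) \<le> B"
    have "f 0 (m+1) - integral {m..m+1} (f 0) - (\<Sum>j<K. em_coeff j *\<^sub>R (f j (m+1) - f j m))
       = (-1) ^ K' * em_int f m K" unfolding K by (rule euler_maclaurin_unit[where f = f and m = m]) (rule f)
    moreover have "em_int f m K = integral {m..m+1} (\<lambda>x. bern K (x - m) *\<^sub>R f K x)"
      by (rule em_int_def)
    ultimately have "norm (f 0 (m+1) - integral {m..m+1} (f 0) - (\<Sum>j<K. em_coeff j *\<^sub>R (f j (m+1) - f j m)))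
       = norm (integral {m..m+1} (\<lambda>x. bern K (x - m) *\<^sub>R f K x))"
      by (simp add: norm_mult norm_power del: bern.simps)
    also have "\<dots> \<le> C * B * (m + 1 - m)"
    proof (rule integral_bound)
      show "continuous_on {m..m+1} (\<lambda>x. bern K (x - m) *\<^sub>R f K x)"
        by (intro continuous_intros em_bern_continuous_on em_continuous_on[where f = f and m = m] f)
      fix t assume t: "t \<in> {m..m+1}"
      show "norm (bern K (t - m) *\<^sub>R f K t) \<le> C * B"
        using C t B[OF t] by (auto intro!: mult_mono)
    qed auto
    finally show "norm (f 0 (m+1) - integral {m..m+1} (f 0) - (\<Sum>j<K. em_coeff j *\<^sub>R (f j (m+1) - f j m))) \<le> C * B"
      by simp
  qed (use C in auto)
qed

text \<open>The summand of the double series without the weight n^(-s2): \<open>a\<close> plays the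
  role of s1, \<open>s\<close> that of s3, and the larger index m has become the real variable
  \<open>x\<close>.\<close>

definition phi :: "complex \<Rightarrow> complex \<Rightarrow> real \<Rightarrow> real \<Rightarrow> complex" where
  "phi a s n x = of_real x powr (-a) * of_real (x + n) powr (-s)"

text \<open>Differentiation in \<open>x\<close> raises one of the two exponents by one, so all
  derivatives are combinations of \<open>phi\<close> with shifted parameters and the recursion can
  run over \<open>a\<close> and \<open>s\<close>.\<close>

primrec dphi :: "nat \<Rightarrow> complex \<Rightarrow> complex \<Rightarrow> real \<Rightarrow> real \<Rightarrow> complex" where
  "dphi 0 a s n x = phi a s n x"
| "dphi (Suc k) a s n x = - a * dphi k (a + 1) s n x - s * dphi k a (s + 1) n x"

lemma norm_phi:
  assumes "x > 0" "n \<ge> 0"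
  shows "norm (phi a s n x) = x powr (- Re a) * (x + n) powr (- Re s)"
  using assms by (simp add: phi_def norm_mult norm_powr_real_powr)

lemma phi_has_vector_derivative:
  assumes "x > 0" "n \<ge> 0"
  shows "(phi a s n has_vector_derivative (- a * phi (a + 1) s n x - s * phi a (s + 1) n x)) (at x within S)"
proof -
  have nz: "complex_of_real x \<notin> \<real>\<^sub>\<le>\<^sub>0" "complex_of_real (x + n) \<notin> \<real>\<^sub>\<le>\<^sub>0"
    using assms by (auto simp: complex_nonpos_Reals_iff)
  have "((\<lambda>z. z powr (-a) * (z + of_real n) powr (-s)) has_field_derivative
      (- a * of_real x powr (-a - 1)) * of_real (x + n) powr (-s)
       + (- s * of_real (x + n) powr (-s - 1)) * of_real x powr (-a)) (at (complex_of_real x))"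
    using nz by (auto intro!: derivative_eq_intros)
  also have "(- a * of_real x powr (-a - 1)) * of_real (x + n) powr (-s)
       + (- s * of_real (x + n) powr (-s - 1)) * of_real x powr (-a)
      = - a * phi (a + 1) s n x - s * phi a (s + 1) n x"
    by (simp add: phi_def)
  finally have "((\<lambda>z. z powr (-a) * (z + of_real n) powr (-s)) has_field_derivative
      (- a * phi (a + 1) s n x - s * phi a (s + 1) n x)) (at (complex_of_real x))" .
  then have "((\<lambda>x. of_real x powr (-a) * (of_real x + of_real n) powr (-s)) has_vector_derivative
      (- a * phi (a + 1) s n x - s * phi a (s + 1) n x)) (at x within S)"
    by (rule has_vector_derivative_real_field)
  then show ?thesis by (simp add: phi_def[abs_def])
qed

lemma dphi_has_vector_derivative:
  assumes "x > 0" "n \<ge> 0"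
  shows "(dphi k a s n has_vector_derivative dphi (Suc k) a s n x) (at x within S)"
proof (induction k arbitrary: a s)
  case 0
  have "dphi 0 a s n = phi a s n" by auto
  then show ?case using phi_has_vector_derivative[OF assms] by simp
next
  case (Suc k)
  have "dphi (Suc k) a s n = (\<lambda>x. - a * dphi k (a + 1) s n x - s * dphi k a (s + 1) n x)" by auto
  moreover have "dphi (Suc (Suc k)) a s n x = - a * dphi (Suc k) (a + 1) s n x - s * dphi (Suc k) a (s + 1) n x"
    by simp
  ultimately show ?case
    by (simp only:) (intro has_vector_derivative_diff has_vector_derivative_mult_right Suc)
qed

text \<open>For n \<le> x the quotient (x + n) / x lies between 1 and 2, so x + n may be replaced by
  x at the cost of 2^B, also for negative real parts. The induction passes from \<open>B\<close> to
  \<open>B + 1\<close> because the recursion shifts \<open>a\<close> or \<open>s\<close> by 1. The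
  condition n \<le> x is the reason why every cutoff N below is at least n.\<close>

lemma norm_dphi_le:
  assumes "B \<ge> 0"
  shows "\<exists>C>0. \<forall>a s n x. norm a \<le> B \<longrightarrow> norm s \<le> B \<longrightarrow> 0 \<le> n \<longrightarrow> n \<le> x \<longrightarrow> 1 \<le> x \<longrightarrow>
           norm (dphi k a s n x) \<le> C * x powr (- Re a - Re s - k)"
  using assms
proof (induction k arbitrary: B)
  case 0
  show ?case
  proof (intro exI[of _ "2 powr B"] conjI allI impI)
    fix a s :: complex and n x :: real
    assume *: "norm a \<le> B" "norm s \<le> B" "0 \<le> n" "n \<le> x" "1 \<le> x"
    have "(x + n) powr (- Re s) = x powr (- Re s) * ((x + n) / x) powr (- Re s)"
      using * by (simp add: powr_divide)
    also have "((x + n) / x) powr (- Re s) \<le> ((x + n) / x) powr B"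
      using * abs_Re_le_cmod[of s] by (intro powr_mono) (auto simp: field_simps)
    also have "\<dots> \<le> 2 powr B"
      using * \<open>0 \<le> B\<close> by (intro powr_mono2) (auto simp: field_simps)
    finally have "x powr - Re a * (x + n) powr (- Re s) \<le> x powr - Re a * (x powr - Re s * 2 powr B)"
      using * by (intro mult_left_mono) auto
    also have "\<dots> = 2 powr B * x powr (- Re a - Re s)"
      by (simp add: powr_add[symmetric] powr_diff powr_minus field_simps)
    finally show "norm (dphi 0 a s n x) \<le> 2 powr B * x powr (- Re a - Re s - real 0)"
      using * by (simp add: norm_phi)
  qed auto
next
  case (Suc k)
  from Suc.IH[of "B + 1"] Suc.prems obtain C where C: "C > 0"
    "\<And>a s n x. norm a \<le> B + 1 \<Longrightarrow> norm s \<le> B + 1 \<Longrightarrow> 0 \<le> n \<Longrightarrow> n \<le> x \<Longrightarrow> 1 \<le> x \<Longrightarrow>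
           norm (dphi k a s n x) \<le> C * x powr (- Re a - Re s - k)" by auto
  show ?case
  proof (intro exI[of _ "2 * (B + 1) * C"] conjI allI impI)
    show "0 < 2 * (B + 1) * C" using C Suc.prems by simp
    fix a s :: complex and n x :: real
    assume *: "norm a \<le> B" "norm s \<le> B" "0 \<le> n" "n \<le> x" "1 \<le> x"
    have 1: "norm (a + 1) \<le> B + 1" "norm (s + 1) \<le> B + 1"
      using * norm_triangle_ineq[of a 1] norm_triangle_ineq[of s 1] by auto
    have eqs: "- Re (a + 1) - Re s - real k = - Re a - Re s - real (Suc k)"
      "- Re a - Re (s + 1) - real k = - Re a - Re s - real (Suc k)" by auto
    have 2: "norm (dphi k (a + 1) s n x) \<le> C * x powr (- Re a - Re s - real (Suc k))"
      "norm (dphi k a (s + 1) n x) \<le> C * x powr (- Re a - Re s - real (Suc k))"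
      using C(2)[of "a + 1" s n x] C(2)[of a "s + 1" n x] * 1 unfolding eqs by auto
    have "norm (dphi (Suc k) a s n x) \<le> norm a * norm (dphi k (a + 1) s n x) + norm s * norm (dphi k a (s + 1) n x)"
      using norm_triangle_ineq4[of "- a * dphi k (a + 1) s n x" "s * dphi k a (s + 1) n x"] by (simp add: norm_mult)
    also have "\<dots> \<le> (B + 1) * (C * x powr (- Re a - Re s - real (Suc k))) + (B + 1) * (C * x powr (- Re a - Re s - real (Suc k)))"
      using * 2 Suc.prems by (intro add_mono mult_mono) auto
    finally show "norm (dphi (Suc k) a s n x) \<le> 2 * (B + 1) * C * x powr (- Re a - Re s - real (Suc k))"
      by (simp add: algebra_simps)
  qed
qed

lemma dphi_holomorphic:
  assumes "x > 0" "n \<ge> 0"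
  shows "(\<lambda>s. dphi k a s n x) holomorphic_on A"
proof -
  have nz: "complex_of_real (x + n) \<noteq> 0" using assms by (simp only: of_real_eq_0_iff)
  have "(\<lambda>s. dphi k a s n x) holomorphic_on UNIV"
  proof (induction k arbitrary: a)
    case 0
    from nz show ?case by (auto simp: phi_def intro!: holomorphic_intros)
  next
    case (Suc k)
    have "(\<lambda>s. s + 1 :: complex) holomorphic_on UNIV" by (intro holomorphic_intros)
    then have "(\<lambda>s. dphi k a (s + 1) n x) holomorphic_on UNIV"
      using holomorphic_on_compose_gen[of "\<lambda>s. s + 1" UNIV "\<lambda>s. dphi k a s n x" UNIV] Suc
      by (auto simp: o_def)
    then show ?case using Suc by (auto intro!: holomorphic_intros)
  qed
  then show ?thesis by (rule holomorphic_on_subset) auto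
qed

definition unit_int :: "complex \<Rightarrow> complex \<Rightarrow> real \<Rightarrow> real \<Rightarrow> complex" where
  "unit_int a s n m = integral {m..m+1} (phi a s n)"

lemma phi_continuous_on: "n \<ge> 0 \<Longrightarrow> S \<subseteq> {0<..} \<Longrightarrow> continuous_on S (phi a s n)"
  by (rule continuous_on_vector_derivative[OF phi_has_vector_derivative]) auto

lemma phi_integrable: "m > 0 \<Longrightarrow> n \<ge> 0 \<Longrightarrow> phi a s n integrable_on {m..m'}"
  by (intro integrable_continuous_real phi_continuous_on) auto

lemma unit_int_holomorphic:
  assumes "m > 0" "n \<ge> 0"
  shows "(\<lambda>s. unit_int a s n m) holomorphic_on A"
proof -
  have "(\<lambda>s. integral (cbox m (m+1)) (phi a s n)) holomorphic_on UNIV"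
  proof (rule leibniz_rule_holomorphic)
    fix s t assume t: "t \<in> cbox m (m+1)"
    then have nz: "complex_of_real (t + n) \<noteq> 0" using assms by (simp only: of_real_eq_0_iff) auto
    define W where "W = complex_of_real (t + n)"
    have "((\<lambda>s. of_real t powr (-a) * W powr (-s)) has_field_derivative
        of_real t powr (-a) * (Ln W * W powr (-s) * (-1))) (at s)"
      using nz unfolding W_def[symmetric]
      by (intro DERIV_cmult DERIV_chain2[OF has_field_derivative_powr_right]) (auto intro!: derivative_eq_intros)
    moreover have "Ln W = of_real (ln (t + n))"
      unfolding W_def using t assms by (intro Ln_of_real) auto
    ultimately show "((\<lambda>s. phi a s n t) has_field_derivative - (phi a s n t * of_real (ln (t + n)))) (at s within UNIV)"
      by (simp add: phi_def W_def mult_ac)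
  next
    \<comment> \<open>Written with \<open>exp\<close> of a real logarithm, the derivative of the
      integrand is visibly continuous in both variables jointly; the congruence then returns to
      complex powers.\<close>
    have "continuous_on ((UNIV :: complex set) \<times> cbox m (m+1))
      (\<lambda>x. - (of_real (snd x) powr (-a) * exp (- fst x * of_real (ln (snd x + n))) * complex_of_real (ln (snd x + n))))"
      using assms by (auto intro!: continuous_intros simp: complex_nonpos_Reals_iff)
    also have "?this \<longleftrightarrow> continuous_on ((UNIV :: complex set) \<times> cbox m (m+1)) (\<lambda>(s,t). - (phi a s n t * of_real (ln (t + n))))"
    proof (rule continuous_on_cong[OF refl], clarify)
      fix s and t assume t: "t \<in> cbox m (m+1)"
      then have pos: "t + n > 0" using assms by auto
      then have nz: "complex_of_real (t + n) \<noteq> 0" by (simp only: of_real_eq_0_iff)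
      have "complex_of_real (t + n) powr (-s) = exp (- s * of_real (ln (t + n)))"
        using nz by (simp only: powr_def Ln_of_real[OF pos] if_False)
      then show "- (of_real (snd (s,t)) powr (-a) * exp (- fst (s,t) * of_real (ln (snd (s,t) + n))) * complex_of_real (ln (snd (s,t) + n)))
         = - (phi a s n t * of_real (ln (t + n)))"
        by (simp add: phi_def)
    qed
    finally show "continuous_on (UNIV \<times> cbox m (m+1)) (\<lambda>(s,t). - (phi a s n t * of_real (ln (t + n))))" .
  qed (use phi_integrable assms in auto)
  then show ?thesis by (auto simp: unit_int_def intro: holomorphic_on_subset)
qed

definition em_err :: "nat \<Rightarrow> complex \<Rightarrow> complex \<Rightarrow> real \<Rightarrow> real \<Rightarrow> complex" where
  "em_err K a s n m = phi a s n (m+1) - unit_int a s n m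
     - (\<Sum>j<K. em_coeff j *\<^sub>R (dphi j a s n (m+1) - dphi j a s n m))"

lemma em_err_holomorphic: "m > 0 \<Longrightarrow> n \<ge> 0 \<Longrightarrow> (\<lambda>s. em_err K a s n m) holomorphic_on A"
  unfolding em_err_def scaleR_conv_of_real using dphi_holomorphic[of "m+1" n 0 a A]
  by (auto intro!: holomorphic_intros dphi_holomorphic unit_int_holomorphic)

text \<open>Phrased with a common lower bound \<rho> for the exponents instead of the exact
  exponent, so that it can serve as a Weierstrass majorant on a whole disc of
  \<open>s\<close>.\<close>

lemma em_err_le:
  assumes "K > 0" "\<rho> \<ge> 0"
  shows "\<exists>C>0. \<forall>s n m. norm s \<le> B \<longrightarrow> \<rho> \<le> Re a + Re s + K \<longrightarrow> 0 \<le> n \<longrightarrow> n \<le> m \<longrightarrow> 1 \<le> m \<longrightarrow>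
           norm (em_err K a s n m) \<le> C * m powr (-\<rho>)"
proof -
  define B' where "B' = max B (norm a)"
  have B': "B \<le> B'" "norm a \<le> B'" by (auto simp: B'_def)
  have "B' \<ge> 0" using B'(2) norm_ge_zero order_trans by blast
  from norm_dphi_le[OF this, of K] obtain C where C0: "C > 0" and
    C1: "\<forall>a s n x. norm a \<le> B' \<longrightarrow> norm s \<le> B' \<longrightarrow> 0 \<le> n \<longrightarrow> n \<le> x \<longrightarrow> 1 \<le> x \<longrightarrow>
           norm (dphi K a s n x) \<le> C * x powr (- Re a - Re s - K)" by blast
  have C: "C > 0" "\<And>s n x. norm s \<le> B' \<Longrightarrow> 0 \<le> n \<Longrightarrow> n \<le> x \<Longrightarrow> 1 \<le> x \<Longrightarrow>
           norm (dphi K a s n x) \<le> C * x powr (- Re a - Re s - K)"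
    using C0 C1 B'(2) by auto
  from euler_maclaurin_bound[OF \<open>K > 0\<close>] obtain D where D: "D > 0"
    "\<And>f :: nat \<Rightarrow> real \<Rightarrow> complex. \<And>m B.
      (\<And>k x. x \<in> {m..m+1} \<Longrightarrow> (f k has_vector_derivative f (Suc k) x) (at x within {m..m+1})) \<Longrightarrow>
      (\<And>x. x \<in> {m..m+1} \<Longrightarrow> norm (f K x) \<le> B) \<Longrightarrow>
      norm (f 0 (m+1) - integral {m..m+1} (f 0) - (\<Sum>j<K. em_coeff j *\<^sub>R (f j (m+1) - f j m))) \<le> D * B"
    by blast
  show ?thesis
  proof (intro exI[of _ "D * C"] conjI allI impI)
    fix s :: complex and n m :: real
    assume *: "norm s \<le> B" "\<rho> \<le> Re a + Re s + K" "0 \<le> n" "n \<le> m" "1 \<le> m"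
    have eq: "dphi 0 a s n = phi a s n" by auto
    have "norm (dphi 0 a s n (m+1) - integral {m..m+1} (dphi 0 a s n)
        - (\<Sum>j<K. em_coeff j *\<^sub>R (dphi j a s n (m+1) - dphi j a s n m))) \<le> D * (C * m powr (-\<rho>))"
    proof (rule D(2))
      fix x assume x: "x \<in> {m..m+1}"
      show "(dphi k a s n has_vector_derivative dphi (Suc k) a s n x) (at x within {m..m+1})" for k
        using x * by (intro dphi_has_vector_derivative) auto
      have "norm (dphi K a s n x) \<le> C * x powr (- Re a - Re s - K)"
        using C(2)[of s n x] x * B'(1) by auto
      also have "\<dots> \<le> C * x powr (-\<rho>)" using C x * by (intro mult_left_mono powr_mono) auto
      also have "\<dots> \<le> C * m powr (-\<rho>)" using C x * assms by (intro mult_left_mono powr_mono2') auto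
      finally show "norm (dphi K a s n x) \<le> C * m powr (-\<rho>)" .
    qed
    then show "norm (em_err K a s n m) \<le> D * C * m powr (-\<rho>)"
      unfolding em_err_def unit_int_def eq by (simp add: mult.assoc)
  qed (use C D in auto)
qed

section \<open>Sums and integrals over half-lines\<close>

lemma powr_diff_ge:
  assumes "m \<ge> (1::real)" "r > 1"
  shows "(r - 1) * (m+1) powr (-r) \<le> m powr (1-r) - (m+1) powr (1-r)"
proof -
  have "\<exists>z>m. z < m+1 \<and> (m+1) powr (1-r) - m powr (1-r) = (m+1-m) * ((1-r) * z powr (1-r-1))"
    by (rule MVT2) (use assms in \<open>auto intro!: derivative_eq_intros\<close>)
  then obtain z where z: "z > m" "z < m+1" "(m+1) powr (1-r) - m powr (1-r) = (1-r) * z powr (-r)"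
    by auto
  have "(m+1) powr (-r) \<le> z powr (-r)" using z assms by (intro powr_mono2') auto
  then have "(r-1) * (m+1) powr (-r) \<le> (r-1) * z powr (-r)" using assms by (intro mult_left_mono) auto
  then show ?thesis using z(3) by (simp add: algebra_simps)
qed

lemma summable_powr_shift: "r > 1 \<Longrightarrow> summable (\<lambda>i. real (N+i) powr (-r))"
  using summable_iff_shift[of "\<lambda>n. real n powr (-r)" N] summable_real_powr_iff[of "-r"]
  by (simp add: add.commute)

text \<open>The terms after the first telescope through \<open>powr_diff_ge\<close> and give N^(1-r)
  / (r-1). The first term is absorbed by N^(-r) \<le> N^(1-r), whence the constant 1 + 1/(r-1) =
  r/(r-1).\<close>

lemma suminf_powr_le:
  assumes "N \<ge> 1" "r > 1"
  shows "(\<Sum>i. real (N+i) powr (-r)) \<le> r / (r-1) * real N powr (1-r)"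
proof (rule suminf_le_const[OF summable_powr_shift[OF assms(2)]])
  fix M
  have 1: "(\<Sum>i<M. (r-1) * real (N+i+1) powr (-r)) \<le> real N powr (1-r) - real (N+M) powr (1-r)" for M
  proof (induction M)
    case (Suc M)
    then show ?case using powr_diff_ge[of "real (N+M)" r] assms by (simp add: add_ac)
  qed simp
  have N: "real N powr (-r) \<le> real N powr (1-r)" using assms by (intro powr_mono) auto
  have "(\<Sum>i<M. real (N+i) powr (-r)) \<le> (\<Sum>i<Suc M. real (N+i) powr (-r))" by simp
  also have "\<dots> = real N powr (-r) + (\<Sum>i<M. real (N+i+1) powr (-r))"
    by (subst sum.lessThan_Suc_shift) simp
  also have "(\<Sum>i<M. real (N+i+1) powr (-r)) = (\<Sum>i<M. (r-1) * real (N+i+1) powr (-r)) / (r-1)"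
    using assms by (simp add: sum_distrib_left[symmetric])
  also have "\<dots> \<le> real N powr (1-r) / (r-1)"
    using 1[of M] powr_ge_zero[of "real (N+M)" "1-r"] assms by (intro divide_right_mono) linarith+
  also have "real N powr (-r) + real N powr (1-r) / (r-1) \<le> real N powr (1-r) + real N powr (1-r) / (r-1)"
    using N by simp
  also have "\<dots> = r / (r-1) * real N powr (1-r)" using assms by (simp add: field_simps)
  finally show "(\<Sum>i<M. real (N+i) powr (-r)) \<le> r / (r-1) * real N powr (1-r)" by simp
qed

lemma sum_powr_le:
  assumes "0 \<le> q" "q < 1"
  shows "(\<Sum>k=1..Q. real k powr (-q)) \<le> real Q powr (1-q) / (1-q)"
proof (induction Q)
  case (Suc Q)
  have "real (Suc Q) powr (-q) \<le> (real (Suc Q) powr (1-q) - real Q powr (1-q)) / (1-q)"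
  proof (cases "Q = 0")
    case True then show ?thesis using assms by (simp add: field_simps)
  next
    case False
    have "\<exists>z>real Q. z < real Q+1 \<and> (real Q+1) powr (1-q) - real Q powr (1-q) = (real Q+1-real Q) * ((1-q) * z powr (1-q-1))"
      by (rule MVT2) (use False in \<open>auto intro!: derivative_eq_intros\<close>)
    then obtain z where z: "z > real Q" "z < real Q+1" "(real Q+1) powr (1-q) - real Q powr (1-q) = (1-q) * z powr (-q)"
      by auto
    have "(real Q+1) powr (-q) \<le> z powr (-q)" using z assms by (intro powr_mono2') auto
    then have "(1-q) * (real Q+1) powr (-q) \<le> (1-q) * z powr (-q)" using assms by (intro mult_left_mono) auto
    then show ?thesis using z(3) assms by (simp add: pos_le_divide_eq mult.commute add.commute)
  qed
  then show ?case using Suc by (simp add: diff_divide_distrib)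
qed simp

lemma holomorphic_suminf:
  fixes h :: "nat \<Rightarrow> complex \<Rightarrow> complex"
  assumes "open U" "\<And>m. h m holomorphic_on U"
    "\<And>z. z \<in> U \<Longrightarrow> \<exists>d>0. \<exists>M. cball z d \<subseteq> U \<and> summable M \<and> (\<forall>m. \<forall>s\<in>cball z d. norm (h m s) \<le> M m)"
  shows "(\<lambda>s. \<Sum>m. h m s) holomorphic_on U"
proof (rule holomorphic_uniform_sequence[OF assms(1)])
  show "(\<lambda>s. \<Sum>m<n. h m s) holomorphic_on U" for n using assms(2) by (intro holomorphic_intros) auto
  fix z assume "z \<in> U"
  from assms(3)[OF this] obtain d M where "d > 0" "cball z d \<subseteq> U" "summable M"
    "\<forall>m. \<forall>s\<in>cball z d. norm (h m s) \<le> M m" by blast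
  then show "\<exists>d>0. cball z d \<subseteq> U \<and> uniform_limit (cball z d) (\<lambda>n s. \<Sum>m<n. h m s) (\<lambda>s. \<Sum>m. h m s) sequentially"
    by (intro exI[of _ d] conjI Weierstrass_m_test) auto
qed

definition em_sum :: "nat \<Rightarrow> complex \<Rightarrow> complex \<Rightarrow> real \<Rightarrow> nat \<Rightarrow> complex" where
  "em_sum K a s n N = (\<Sum>i. em_err K a s n (real (N+i)))"

lemma summable_norm_em_err:
  assumes "K > 0" "Re a + Re s + real K > 1" "0 \<le> n" "n \<le> real N" "1 \<le> N"
  shows "summable (\<lambda>i. norm (em_err K a s n (real (N+i))))"
proof -
  have "Re a + Re s + real K \<ge> 0" using assms by simp
  from em_err_le[OF assms(1) this, of "norm s" a] obtain C where C: "C > 0"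
    "\<And>s' n m. norm s' \<le> norm s \<Longrightarrow> Re a + Re s + real K \<le> Re a + Re s' + real K \<Longrightarrow> 0 \<le> n \<Longrightarrow> n \<le> m \<Longrightarrow> 1 \<le> m \<Longrightarrow>
           norm (em_err K a s' n m) \<le> C * m powr (-(Re a + Re s + real K))" by blast
  show ?thesis
    by (rule summable_comparison_test'[OF summable_mult[OF summable_powr_shift[OF assms(2)], of C N]])
       (use C(2)[of s n "real (N+_)"] assms in auto)
qed

lemma em_sum_le:
  assumes "K > 0" "\<rho> > 1"
  shows "\<exists>C>0. \<forall>s n N. norm s \<le> B \<longrightarrow> \<rho> \<le> Re a + Re s + K \<longrightarrow> 0 \<le> n \<longrightarrow> n \<le> real N \<longrightarrow> 1 \<le> N \<longrightarrow>
       norm (em_sum K a s n N) \<le> C * real N powr (1-\<rho>)"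
proof -
  have "\<rho> \<ge> 0" using assms by simp
  from em_err_le[OF assms(1) this, of B a] obtain C where C: "C > 0"
    "\<And>s n m. norm s \<le> B \<Longrightarrow> \<rho> \<le> Re a + Re s + K \<Longrightarrow> 0 \<le> n \<Longrightarrow> n \<le> m \<Longrightarrow> 1 \<le> m \<Longrightarrow>
           norm (em_err K a s n m) \<le> C * m powr (-\<rho>)" by blast
  show ?thesis
  proof (intro exI[of _ "C * (\<rho> / (\<rho> - 1))"] conjI allI impI)
    show "C * (\<rho> / (\<rho> - 1)) > 0" using C assms by simp
    fix s :: complex and n :: real and N :: nat
    assume *: "norm s \<le> B" "\<rho> \<le> Re a + Re s + K" "0 \<le> n" "n \<le> real N" "1 \<le> N"
    have le: "norm (em_err K a s n (real (N+i))) \<le> C * real (N+i) powr (-\<rho>)" for i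
      by (rule C(2)) (use * in auto)
    have sm: "summable (\<lambda>i. C * real (N+i) powr (-\<rho>))"
      by (intro summable_mult summable_powr_shift assms)
    have sm2: "summable (\<lambda>i. norm (em_err K a s n (real (N+i))))"
      by (rule summable_norm_em_err) (use * assms in auto)
    have "norm (em_sum K a s n N) \<le> (\<Sum>i. norm (em_err K a s n (real (N+i))))"
      unfolding em_sum_def by (rule summable_norm[OF sm2])
    also have "\<dots> \<le> (\<Sum>i. C * real (N+i) powr (-\<rho>))" by (rule suminf_le[OF le sm2 sm])
    also have "\<dots> = C * (\<Sum>i. real (N+i) powr (-\<rho>))" by (intro suminf_mult summable_powr_shift assms)
    also have "\<dots> \<le> C * (\<rho> / (\<rho>-1) * real N powr (1-\<rho>))"
      using C by (intro mult_left_mono suminf_powr_le) (use * assms in auto)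
    finally show "norm (em_sum K a s n N) \<le> C * (\<rho> / (\<rho> - 1)) * real N powr (1-\<rho>)" by (simp add: mult_ac)
  qed
qed

text \<open>Supplies discs on which the two quantities that govern the majorants, a lower bound for
  the real part and an upper bound for the modulus, are constant.\<close>

lemma Re_halfspace_cball:
  fixes z :: complex
  assumes "Re z > c"
  shows "\<exists>d>0. \<exists>\<rho>>c. \<forall>s\<in>cball z d. Re s \<ge> \<rho> \<and> norm s \<le> norm z + d"
proof -
  define d where "d = (Re z - c) / 2"
  have d: "d > 0" using assms by (simp add: d_def)
  show ?thesis
  proof (rule exI[of _ d], rule conjI, use d in simp, rule exI[of _ "c + d"], intro conjI ballI)
    fix s assume "s \<in> cball z d"
    then have "norm (z - s) \<le> d" by (simp add: dist_norm)
    then show "c + d \<le> Re s" "norm s \<le> norm z + d"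
      using abs_Re_le_cmod[of "z - s"] norm_triangle_ineq4[of z "z - s"] by (auto simp: d_def field_simps)
  qed (use d in auto)
qed

lemma open_halfspace_Re: "open {s. Re s > c}"
  using open_halfspace_Re_gt[of c] by simp

text \<open>Each further order of Euler-Maclaurin gains one power of m in the error and so moves the
  half-plane one unit to the left.\<close>

lemma em_sum_holomorphic:
  assumes "K > 0" "0 \<le> n" "n \<le> real N" "1 \<le> N"
  shows "(\<lambda>s. em_sum K a s n N) holomorphic_on {s. Re s > 1 - real K - Re a}"
  unfolding em_sum_def
proof (rule holomorphic_suminf)
  fix z assume "z \<in> {s. Re s > 1 - real K - Re a}"
  then obtain d \<rho> where d: "d > 0" "\<rho> > 1 - real K - Re a" "\<And>s. s\<in>cball z d \<Longrightarrow> Re s \<ge> \<rho> \<and> norm s \<le> norm z + d"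
    using Re_halfspace_cball[of "1 - real K - Re a" z] by auto
  have "\<rho> + real K + Re a \<ge> 0" using d by simp
  from em_err_le[OF assms(1) this, of "norm z + d" a] obtain C where C: "C > 0"
    "\<And>s n m. norm s \<le> norm z + d \<Longrightarrow> \<rho> + real K + Re a \<le> Re a + Re s + real K \<Longrightarrow> 0 \<le> n \<Longrightarrow> n \<le> m \<Longrightarrow> 1 \<le> m \<Longrightarrow>
           norm (em_err K a s n m) \<le> C * m powr (-(\<rho> + real K + Re a))" by blast
  show "\<exists>d>0. \<exists>M. cball z d \<subseteq> {s. Re s > 1 - real K - Re a} \<and> summable M
       \<and> (\<forall>m. \<forall>s\<in>cball z d. norm (em_err K a s n (real (N+m))) \<le> M m)"
  proof (rule exI[of _ d], intro conjI exI[of _ "\<lambda>m. C * real (N+m) powr (-(\<rho> + real K + Re a))"] allI ballI)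
    show "cball z d \<subseteq> {s. Re s > 1 - real K - Re a}" using d by force
    show "summable (\<lambda>m. C * real (N+m) powr (-(\<rho> + real K + Re a)))"
      using d by (intro summable_mult summable_powr_shift) auto
    fix m s assume "s \<in> cball z d"
    from d(3)[OF this] show "norm (em_err K a s n (real (N+m))) \<le> C * real (N+m) powr (-(\<rho> + real K + Re a))"
      using assms by (intro C(2)) auto
  qed (use d in auto)
qed (use assms open_halfspace_Re in \<open>auto intro!: em_err_holomorphic\<close>)

lemma phi_le:
  assumes "0 \<le> B"
  shows "\<exists>C>0. \<forall>s n x. norm s \<le> B \<longrightarrow> 0 \<le> n \<longrightarrow> n \<le> x \<longrightarrow> 1 \<le> x \<longrightarrow>
    norm (phi a s n x) \<le> C * x powr (- Re a - Re s)"
proof -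
  define B' where "B' = max B (norm a)"
  have B': "B \<le> B'" "norm a \<le> B'" "0 \<le> B'" using assms by (auto simp: B'_def)
  from norm_dphi_le[OF B'(3), of 0] obtain C where "C > 0" and
    "\<forall>a s n x. norm a \<le> B' \<longrightarrow> norm s \<le> B' \<longrightarrow> 0 \<le> n \<longrightarrow> n \<le> x \<longrightarrow> 1 \<le> x \<longrightarrow>
           norm (dphi 0 a s n x) \<le> C * x powr (- Re a - Re s - real 0)" by blast
  then show ?thesis using B' by (intro exI[of _ C]) auto
qed

lemma unit_int_le:
  assumes "\<And>x. x \<in> {m..m+1} \<Longrightarrow> norm (phi a s n x) \<le> C" "m > 0" "n \<ge> 0"
  shows "norm (unit_int a s n m) \<le> C"
proof -
  have "norm (integral {m..m+1} (phi a s n)) \<le> C * (m + 1 - m)"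
    using assms by (intro integral_bound phi_continuous_on) auto
  then show ?thesis by (simp add: unit_int_def)
qed

text \<open>The integral of \<open>phi\<close> from N to infinity, encoded as a series of unit
  integrals so that the Weierstrass argument used for \<open>em_sum\<close> applies to it as
  well.\<close>

definition tail_int :: "complex \<Rightarrow> complex \<Rightarrow> real \<Rightarrow> nat \<Rightarrow> complex" where
  "tail_int a s n N = (\<Sum>i. unit_int a s n (real (N+i)))"

lemma unit_int_le':
  assumes "0 \<le> B" "\<rho> \<ge> 0"
  shows "\<exists>C>0. \<forall>s n m. norm s \<le> B \<longrightarrow> \<rho> \<le> Re a + Re s \<longrightarrow> 0 \<le> n \<longrightarrow> n \<le> m \<longrightarrow> 1 \<le> m \<longrightarrow>
       norm (unit_int a s n m) \<le> C * m powr (-\<rho>)"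
proof -
  obtain C where C: "C > 0" "\<And>s n x. norm s \<le> B \<Longrightarrow> 0 \<le> n \<Longrightarrow> n \<le> x \<Longrightarrow> 1 \<le> x \<Longrightarrow>
    norm (phi a s n x) \<le> C * x powr (- Re a - Re s)" using phi_le[OF assms(1)] by blast
  show ?thesis
  proof (intro exI[of _ C] conjI allI impI)
    fix s :: complex and n m :: real
    assume *: "norm s \<le> B" "\<rho> \<le> Re a + Re s" "0 \<le> n" "n \<le> m" "1 \<le> m"
    show "norm (unit_int a s n m) \<le> C * m powr (-\<rho>)"
    proof (rule unit_int_le)
      fix x assume x: "x \<in> {m..m+1}"
      have "norm (phi a s n x) \<le> C * x powr (- Re a - Re s)" using * x by (intro C(2)) auto
      also have "\<dots> \<le> C * x powr (-\<rho>)" using C x * by (intro mult_left_mono powr_mono) auto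
      also have "\<dots> \<le> C * m powr (-\<rho>)" using C x * assms by (intro mult_left_mono powr_mono2') auto
      finally show "norm (phi a s n x) \<le> C * m powr (-\<rho>)" .
    qed (use * in auto)
  qed (use C in auto)
qed

lemma summable_norm_unit_int:
  assumes "Re a + Re s > 1" "0 \<le> n" "n \<le> real N" "1 \<le> N"
  shows "summable (\<lambda>i. norm (unit_int a s n (real (N+i))))"
proof -
  have "Re a + Re s \<ge> 0" using assms by simp
  from unit_int_le'[OF norm_ge_zero[of s] this, of a] obtain C where C: "C > 0"
    "\<And>s' n m. norm s' \<le> norm s \<Longrightarrow> Re a + Re s \<le> Re a + Re s' \<Longrightarrow> 0 \<le> n \<Longrightarrow> n \<le> m \<Longrightarrow> 1 \<le> m \<Longrightarrow>
       norm (unit_int a s' n m) \<le> C * m powr (-(Re a + Re s))" by blast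
  show ?thesis
    by (rule summable_comparison_test'[OF summable_mult[OF summable_powr_shift[OF assms(1)], of C N]])
       (use C(2)[of s n "real (N+_)"] assms in auto)
qed

lemma tail_int_holomorphic:
  assumes "0 \<le> n" "n \<le> real N" "1 \<le> N"
  shows "(\<lambda>s. tail_int a s n N) holomorphic_on {s. Re s > 1 - Re a}"
  unfolding tail_int_def
proof (rule holomorphic_suminf)
  fix z assume "z \<in> {s. Re s > 1 - Re a}"
  then obtain d \<rho> where d: "d > 0" "\<rho> > 1 - Re a" "\<And>s. s\<in>cball z d \<Longrightarrow> Re s \<ge> \<rho> \<and> norm s \<le> norm z + d"
    using Re_halfspace_cball[of "1 - Re a" z] by auto
  have "norm z + d \<ge> 0" "\<rho> + Re a \<ge> 0" using d by simp_all
  from unit_int_le'[OF this, of a] obtain C where C: "C > 0"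
    "\<And>s n m. norm s \<le> norm z + d \<Longrightarrow> \<rho> + Re a \<le> Re a + Re s \<Longrightarrow> 0 \<le> n \<Longrightarrow> n \<le> m \<Longrightarrow> 1 \<le> m \<Longrightarrow>
           norm (unit_int a s n m) \<le> C * m powr (-(\<rho> + Re a))" by blast
  show "\<exists>d>0. \<exists>M. cball z d \<subseteq> {s. Re s > 1 - Re a} \<and> summable M
       \<and> (\<forall>m. \<forall>s\<in>cball z d. norm (unit_int a s n (real (N+m))) \<le> M m)"
  proof (intro exI[of _ d] exI[of _ "\<lambda>m. C * real (N+m) powr (-(\<rho> + Re a))"] conjI allI ballI)
    show "cball z d \<subseteq> {s. Re s > 1 - Re a}" using d by force
    show "summable (\<lambda>m. C * real (N+m) powr (-(\<rho> + Re a)))"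
      using d by (intro summable_mult summable_powr_shift) auto
    fix m s assume "s \<in> cball z d"
    from d(3)[OF this] show "norm (unit_int a s n (real (N+m))) \<le> C * real (N+m) powr (-(\<rho> + Re a))"
      using assms by (intro C(2)) auto
  qed (use d in auto)
qed (use assms open_halfspace_Re in \<open>auto intro!: unit_int_holomorphic\<close>)

lemma dphi_tendsto_0:
  assumes "Re a + Re s + k > 0" "0 \<le> n"
  shows "(\<lambda>i. dphi k a s n (real (N+i))) \<longlonglongrightarrow> 0"
proof -
  have "max (norm a) (norm s) \<ge> 0" using norm_ge_zero[of a] by linarith
  from norm_dphi_le[OF this, of k] obtain C where C: "C > 0" and
    C1: "\<forall>a' s' n x. norm a' \<le> max (norm a) (norm s) \<longrightarrow> norm s' \<le> max (norm a) (norm s) \<longrightarrow> 0 \<le> n \<longrightarrow> n \<le> x \<longrightarrow> 1 \<le> x \<longrightarrow>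
           norm (dphi k a' s' n x) \<le> C * x powr (- Re a' - Re s' - k)" by blast
  show ?thesis
  proof (rule Lim_null_comparison)
    show "\<forall>\<^sub>F i in sequentially. norm (dphi k a s n (real (N+i))) \<le> C * real (N+i) powr (-(Re a + Re s + k))"
      using eventually_ge_at_top[of "nat \<lceil>n\<rceil> + 1"]
    proof eventually_elim
      case (elim i)
      have "norm (dphi k a s n (real (N+i))) \<le> C * real (N+i) powr (- Re a - Re s - k)"
        using C1[rule_format, of a s n "real (N+i)"] assms elim by (auto simp: le_max_iff_disj) linarith
      then show ?case by (simp add: algebra_simps)
    qed
    have "(\<lambda>i. real i powr (-(Re a + Re s + k))) \<longlonglongrightarrow> 0"
      using assms by (intro tendsto_neg_powr filterlim_real_sequentially) auto
    from LIMSEQ_ignore_initial_segment[OF this, of N]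
    show "(\<lambda>i. C * real (N+i) powr (-(Re a + Re s + k))) \<longlonglongrightarrow> 0"
      by (intro tendsto_mult_right_zero) (simp add: add.commute)
  qed
qed

lemma phi_tendsto_0: "Re a + Re s > 0 \<Longrightarrow> 0 \<le> n \<Longrightarrow> (\<lambda>i. phi a s n (real (N+i))) \<longlonglongrightarrow> 0"
  using dphi_tendsto_0[of a s 0 n N] by simp

lemma euler_maclaurin_sums:
  assumes "Re a + Re s > 1" "K > 0" "0 \<le> n" "n \<le> real N" "1 \<le> N"
  shows "(\<lambda>i. phi a s n (real (N+i) + 1)) sums
     (tail_int a s n N + em_sum K a s n N - (\<Sum>j<K. em_coeff j *\<^sub>R dphi j a s n (real N)))"
proof -
  have 1: "(\<lambda>i. em_err K a s n (real (N+i))) sums em_sum K a s n N"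
    unfolding em_sum_def by (rule summable_sums[OF summable_norm_cancel[OF summable_norm_em_err]]) (use assms in auto)
  have 2: "(\<lambda>i. unit_int a s n (real (N+i))) sums tail_int a s n N"
    unfolding tail_int_def by (rule summable_sums[OF summable_norm_cancel[OF summable_norm_unit_int]]) (use assms in auto)
  have 3: "(\<lambda>i. dphi j a s n (real (N+i) + 1) - dphi j a s n (real (N+i))) sums (0 - dphi j a s n (real N))" for j
    using telescope_sums[OF dphi_tendsto_0[of a s j n N]] assms by (simp add: add_ac)
  have "(\<lambda>i. em_err K a s n (real (N+i)) + unit_int a s n (real (N+i))
     + (\<Sum>j<K. em_coeff j *\<^sub>R (dphi j a s n (real (N+i) + 1) - dphi j a s n (real (N+i))))) sums
     (em_sum K a s n N + tail_int a s n N + (\<Sum>j<K. em_coeff j *\<^sub>R (0 - dphi j a s n (real N))))"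
    by (intro sums_add 1 2 sums_sum sums_scaleR_right 3)
  then show ?thesis by (simp add: em_err_def sum_negf algebra_simps)
qed

text \<open>The sum of \<open>phi\<close> over m > N minus its integral from N on. In this
  first-order form it is holomorphic for Re a + Re s > 0, where sum and integral need not converge
  separately.\<close>

definition dsum :: "complex \<Rightarrow> complex \<Rightarrow> real \<Rightarrow> nat \<Rightarrow> complex" where
  "dsum a s n N = em_sum 1 a s n N - em_coeff 0 *\<^sub>R phi a s n (real N)"

lemma sums_tail_int_dsum:
  assumes "Re a + Re s > 1" "0 \<le> n" "n \<le> real N" "1 \<le> N"
  shows "(\<lambda>i. phi a s n (real (N+i) + 1)) sums (tail_int a s n N + dsum a s n N)"
  using euler_maclaurin_sums[of a s 1 n N] assms by (simp add: dsum_def add_diff_eq)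

lemma dsum_sums:
  assumes "Re a + Re s > 0" "0 \<le> n" "n \<le> real N" "1 \<le> N"
  shows "(\<lambda>i. phi a s n (real (N+i) + 1) - unit_int a s n (real (N+i))) sums dsum a s n N"
proof -
  have 1: "(\<lambda>i. em_err 1 a s n (real (N+i))) sums em_sum 1 a s n N"
    unfolding em_sum_def by (rule summable_sums[OF summable_norm_cancel[OF summable_norm_em_err]]) (use assms in auto)
  have 3: "(\<lambda>i. phi a s n (real (N+i) + 1) - phi a s n (real (N+i))) sums (0 - phi a s n (real N))"
    using telescope_sums[OF phi_tendsto_0[of a s n N]] assms by (simp add: add_ac)
  show ?thesis
    using sums_add[OF 1 sums_scaleR_right[OF 3, of "em_coeff 0"]] by (simp add: em_err_def dsum_def)
qed

lemma dsum_holomorphic: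
  assumes "0 \<le> n" "n \<le> real N" "1 \<le> N"
  shows "(\<lambda>s. dsum a s n N) holomorphic_on {s. Re s > - Re a}"
  unfolding dsum_def scaleR_conv_of_real
  using em_sum_holomorphic[of 1 n N a] dphi_holomorphic[of "real N" n 0] assms
  by (auto intro!: holomorphic_intros)

text \<open>\<open>phi\<close> is homogeneous of degree -(a + s) in \<open>x\<close> and
  \<open>n\<close> jointly, and each derivative lowers the degree by one. With the cutoff N = n the
  boundary terms of Euler-Maclaurin therefore become pure powers of n, and their sums over n are
  zeta values.\<close>

lemma dphi_diagonal:
  assumes "m > 0"
  shows "dphi j a s m m = of_real m powr (-(a + s + of_nat j)) * dphi j a s 1 1"
proof (induction j arbitrary: a s)
  case 0
  have "complex_of_real (m + m) powr (-s) = of_real m powr (-s) * of_real (1+1) powr (-s)"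
    using assms powr_times_real_left[of "complex_of_real m" "of_real (1+1)" "-s"] by (simp add: mult_ac)
  then show ?case using assms by (simp add: phi_def powr_add[symmetric] algebra_simps)
next
  case (Suc j)
  have 1: "a + 1 + s + of_nat j = a + s + of_nat (Suc j)" "a + (s + 1) + of_nat j = a + s + of_nat (Suc j)" by auto
  show ?case using Suc[of "a+1" s] Suc[of a "s+1"] unfolding 1 by (simp add: algebra_simps)
qed

section \<open>Recurrence and scaling of the tail integral\<close>

lemma phi_shift:
  assumes "x > 0" "n \<ge> 0"
  shows "phi a (s - 1) n x = phi a s n x * of_real (x + n)" "phi (a + 1) s n x * of_real x = phi a s n x"
proof -
  have nz: "complex_of_real (x + n) \<noteq> 0" "complex_of_real x \<noteq> 0"
    using assms by (simp_all only: of_real_eq_0_iff)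
  have "complex_of_real (x + n) powr (-(s - 1)) = of_real (x + n) powr (-s + 1)" by simp
  also have "\<dots> = of_real (x + n) powr (-s) * of_real (x + n)" using nz(1) by (simp only: powr_add powr_to_1 if_False)
  finally show "phi a (s - 1) n x = phi a s n x * of_real (x + n)" by (simp add: phi_def mult_ac)
  have "complex_of_real x powr (-a) = of_real x powr (-(a + 1) + 1)" by simp
  also have "\<dots> = of_real x powr (-(a + 1)) * of_real x" using nz(2) by (simp only: powr_add powr_to_1 if_False)
  finally show "phi (a + 1) s n x * of_real x = phi a s n x" by (simp add: phi_def mult_ac)
qed

text \<open>Differentiate x^(-a) (x+n)^(1-s) and split the factor x + n in the term with x^(-a-1):
  the part with x returns to \<open>a\<close>, the part with n leads to
  \<open>a + 1\<close>.\<close>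

lemma unit_int_rec:
  assumes "m > 0" "n \<ge> 0"
  shows "(1 - a - s) * unit_int a s n m - a * of_real n * unit_int (a + 1) s n m = phi a (s - 1) n (m+1) - phi a (s - 1) n m"
proof -
  have "((\<lambda>x. (1 - a - s) * phi a s n x - a * of_real n * phi (a + 1) s n x) has_integral
      (phi a (s - 1) n (m+1) - phi a (s - 1) n m)) {m..m+1}"
  proof (rule fundamental_theorem_of_calculus)
    fix x assume x: "x \<in> {m..m+1}"
    have "- a * phi (a + 1) (s - 1) n x - (s - 1) * phi a (s - 1 + 1) n x =
        (1 - a - s) * phi a s n x - a * of_real n * phi (a + 1) s n x"
      using phi_shift[of x n "a+1" s] phi_shift[of x n a s] x assms
      by (simp add: algebra_simps)
    then show "(phi a (s - 1) n has_vector_derivative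
       ((1 - a - s) * phi a s n x - a * of_real n * phi (a + 1) s n x)) (at x within {m..m+1})"
      using phi_has_vector_derivative[of x n a "s - 1" "{m..m+1}"] x assms by simp
  qed auto
  moreover have "((\<lambda>x. (1 - a - s) * phi a s n x - a * of_real n * phi (a + 1) s n x) has_integral
     ((1 - a - s) * unit_int a s n m - a * of_real n * unit_int (a + 1) s n m)) {m..m+1}"
    unfolding unit_int_def using assms
    by (intro has_integral_diff has_integral_mult_right integrable_integral phi_integrable)
  ultimately show ?thesis by (rule has_integral_unique[symmetric])
qed

text \<open>Serves two purposes: the right-hand side converges one unit further to the left, which
  continues the integral, and division by a + s - 1 saves a factor of the size of Im (a + s) in the
  approximation.\<close>

lemma tail_int_rec:
  assumes "Re a + Re s > 1" "0 \<le> n" "n \<le> real N" "1 \<le> N"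
  shows "(a + s - 1) * tail_int a s n N = phi a (s - 1) n (real N) - a * of_real n * tail_int (a + 1) s n N"
proof -
  have 1: "(\<lambda>i. unit_int a s n (real (N+i))) sums tail_int a s n N"
    unfolding tail_int_def by (rule summable_sums[OF summable_norm_cancel[OF summable_norm_unit_int]]) (use assms in auto)
  have 2: "(\<lambda>i. unit_int (a + 1) s n (real (N+i))) sums tail_int (a + 1) s n N"
    unfolding tail_int_def by (rule summable_sums[OF summable_norm_cancel[OF summable_norm_unit_int]]) (use assms in auto)
  have 3: "(\<lambda>i. phi a (s - 1) n (real (N+i) + 1) - phi a (s - 1) n (real (N+i))) sums (0 - phi a (s - 1) n (real N))"
    using telescope_sums[OF phi_tendsto_0[of a "s - 1" n N]] assms by (simp add: add_ac)
  have "(\<lambda>i. (1 - a - s) * unit_int a s n (real (N+i)) - a * of_real n * unit_int (a + 1) s n (real (N+i))) sums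
     ((1 - a - s) * tail_int a s n N - a * of_real n * tail_int (a + 1) s n N)"
    by (intro sums_diff sums_mult 1 2)
  also have "(\<lambda>i. (1 - a - s) * unit_int a s n (real (N+i)) - a * of_real n * unit_int (a + 1) s n (real (N+i)))
    = (\<lambda>i. phi a (s - 1) n (real (N+i) + 1) - phi a (s - 1) n (real (N+i)))"
    using assms by (intro ext unit_int_rec) auto
  finally have "(1 - a - s) * tail_int a s n N - a * of_real n * tail_int (a + 1) s n N = 0 - phi a (s - 1) n (real N)"
    using 3 sums_unique2 by blast
  then show ?thesis by (simp add: algebra_simps)
qed

lemma sum_unit_int:
  assumes "N \<ge> 1" "n \<ge> 0"
  shows "(\<Sum>i<M. unit_int a s n (real (N+i))) = integral {real N..real (N+M)} (phi a s n)"
proof (induction M)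
  case (Suc M)
  have "integral {real N..real (N+M)} (phi a s n) + integral {real (N+M)..real (N+M)+1} (phi a s n)
      = integral {real N..real (N+M)+1} (phi a s n)"
    using assms by (intro Henstock_Kurzweil_Integration.integral_combine phi_integrable) auto
  then show ?case using Suc by (simp add: unit_int_def add_ac)
qed (simp add: integral_empty)

text \<open>Substitution x = n y. With the cutoff N = n the integral depends on n only through a
  power, so summation over n yields a zeta function times one fixed integral.\<close>

lemma tail_int_scale:
  assumes "Re a + Re s > 1" "1 \<le> n"
  shows "tail_int a s (real n) n = of_nat n powr (1 - a - s) * tail_int a s 1 1"
proof -
  have "(\<lambda>i. unit_int a s (real n) (real (n+i))) sums tail_int a s (real n) n"
    unfolding tail_int_def by (rule summable_sums[OF summable_norm_cancel[OF summable_norm_unit_int]]) (use assms in auto)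
  then have "(\<lambda>M. integral {real n..real (n+M)} (phi a s (real n))) \<longlonglongrightarrow> tail_int a s (real n) n"
    using assms by (simp add: sums_def sum_unit_int del: of_nat_add)
  \<comment> \<open>Only the upper limits n + n M are considered, because scaling by n maps the
    interval from 1 to 1 + M onto the one from n to n + n M.\<close>
  moreover have "filterlim (\<lambda>M. n * M) at_top sequentially"
    using assms by (intro filterlim_subseq) (auto simp: strict_mono_def)
  ultimately have 1: "(\<lambda>M. integral {real n..real (n + n * M)} (phi a s (real n))) \<longlonglongrightarrow> tail_int a s (real n) n"
    by (rule filterlim_compose)
  have "(\<lambda>i. unit_int a s 1 (real (1+i))) sums tail_int a s 1 1"
    unfolding tail_int_def by (rule summable_sums[OF summable_norm_cancel[OF summable_norm_unit_int]]) (use assms in auto)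
  then have "(\<lambda>M. integral {real 1..real (1+M)} (phi a s 1)) \<longlonglongrightarrow> tail_int a s 1 1"
    using sum_unit_int[of 1 1 a s] by (simp add: sums_def)
  then have 2: "(\<lambda>M. of_nat n powr (1 - a - s) * integral {real 1..real (1+M)} (phi a s 1))
      \<longlonglongrightarrow> of_nat n powr (1 - a - s) * tail_int a s 1 1" by (intro tendsto_intros)
  have "integral {real n..real (n + n * M)} (phi a s (real n)) =
      of_nat n powr (1 - a - s) * integral {real 1..real (1+M)} (phi a s 1)" for M
  proof -
    have "(phi a s 1 has_integral integral {real 1..real (1+M)} (phi a s 1)) (cbox 1 (1 + real M))"
      using phi_integrable[of 1 1 a s "1 + real M"] by (simp add: integrable_integral)
    from has_integral_affinity[OF this, of "1 / real n" 0]
    have "((\<lambda>x. phi a s 1 (x / real n)) has_integral (real n *\<^sub>R integral {real 1..real (1+M)} (phi a s 1)))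
       ((\<lambda>x. real n * x) ` {1..1 + real M})" using assms by simp
    also have "(\<lambda>x. real n * x) ` {1..1 + real M} = {real n..real (n + n * M)}"
      using assms by (simp add: image_mult_atLeastAtMost distrib_left)
    finally have "((\<lambda>x. of_nat n powr (-a - s) * phi a s 1 (x / real n)) has_integral
        of_nat n powr (-a - s) * (real n *\<^sub>R integral {real 1..real (1+M)} (phi a s 1))) {real n..real (n + n * M)}"
      by (rule has_integral_mult_right)
    then have "(phi a s (real n) has_integral
        of_nat n powr (-a - s) * (real n *\<^sub>R integral {real 1..real (1+M)} (phi a s 1))) {real n..real (n + n * M)}"
    proof (rule has_integral_eq[rotated])
      fix x assume x: "x \<in> {real n..real (n + n * M)}"
      then have x0: "x > 0" using assms by auto
      define y where "y = x / real n"
      have y: "y > 0" "x = real n * y" using x0 assms by (auto simp: y_def)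
      have "complex_of_real (real n * y) powr (-a) = of_nat n powr (-a) * of_real y powr (-a)"
        using y assms powr_times_real_left[of "of_nat n" "complex_of_real y" "-a"] by simp
      moreover have "complex_of_real (real n * (y + 1)) powr (-s) = of_nat n powr (-s) * of_real (y + 1) powr (-s)"
        using y assms powr_times_real_left[of "of_nat n" "complex_of_real (y + 1)" "-s"] by (simp del: of_real_add)
      moreover have "complex_of_nat n powr (-a - s) = of_nat n powr (-a) * of_nat n powr (-s)"
        using assms by (simp add: powr_add[symmetric])
      moreover have "real n * y / real n = y" using assms by simp
      moreover have "real n * y + real n = real n * (y + 1)" by (simp add: algebra_simps)
      ultimately show "of_nat n powr (-a - s) * phi a s 1 (x / real n) = phi a s (real n) x"
        unfolding phi_def y(2) by (simp only: mult_ac)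
    qed
    moreover have "complex_of_nat n powr (1 - a - s) = of_nat n powr (-a - s) * of_nat n"
      using assms powr_add[of "complex_of_nat n" "-a - s" 1] by (simp add: algebra_simps)
    ultimately show ?thesis by (simp add: integral_unique scaleR_conv_of_real mult_ac)
  qed
  with 1 2 show ?thesis using LIMSEQ_unique by simp
qed

section \<open>Meromorphic continuation\<close>

text \<open>Each use of \<open>tail_int_rec\<close> trades \<open>a\<close> for
  \<open>a + 1\<close>, gains one unit and adds the pole a + s = 1. The poles belonging to
  \<open>a + 1\<close> are those of \<open>a\<close> with l \<ge> 1.\<close>

lemma tail_int_continuation:
  "\<exists>J. J holomorphic_on ({s. Re s > 1 - Re a - real L} - {s. \<exists>l::nat. a + s = 1 - of_nat l}) \<and>
       (\<forall>s. Re s > 1 - Re a \<longrightarrow> J s = tail_int a s 1 1)"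
proof (induction L arbitrary: a)
  case 0
  show ?case using tail_int_holomorphic[of 1 1 a]
    by (intro exI[of _ "\<lambda>s. tail_int a s 1 1"]) (auto intro: holomorphic_on_subset)
next
  case (Suc L)
  from Suc[of "a + 1"] obtain J where J:
    "J holomorphic_on ({s. Re s > 1 - Re (a+1) - real L} - {s. \<exists>l::nat. (a+1) + s = 1 - of_nat l})"
    "\<And>s. Re s > 1 - Re (a+1) \<Longrightarrow> J s = tail_int (a+1) s 1 1" by auto
  show ?case
  proof (intro exI[of _ "\<lambda>s. (phi a (s - 1) 1 1 - a * J s) / (a + s - 1)"] conjI allI impI)
    have "J holomorphic_on ({s. Re s > 1 - Re a - real (Suc L)} - {s. \<exists>l::nat. a + s = 1 - of_nat l})"
    proof (rule holomorphic_on_subset[OF J(1)], safe)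
      fix s l assume *: "\<nexists>l::nat. a + s = 1 - of_nat l" "a + 1 + s = 1 - of_nat l"
      have "a + s = (a + 1 + s) - 1" by simp
      also have "\<dots> = 1 - of_nat (Suc l)" unfolding *(2) by simp
      finally have "a + s = 1 - of_nat (Suc l)" .
      with *(1) show False by blast
    qed auto
    moreover have "(\<lambda>s. phi a (s - 1) 1 1) holomorphic_on A" for A
      unfolding phi_def by (intro holomorphic_intros) auto
    moreover have "a + s - 1 \<noteq> 0" if "\<nexists>l::nat. a + s = 1 - of_nat l" for s
      using that[simplified, rule_format, of 0] by auto
    ultimately show "(\<lambda>s. (phi a (s - 1) 1 1 - a * J s) / (a + s - 1)) holomorphic_on
       ({s. Re s > 1 - Re a - real (Suc L)} - {s. \<exists>l::nat. a + s = 1 - of_nat l})"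
      by (intro holomorphic_intros) auto
    fix s assume s: "Re s > 1 - Re a"
    then have "a + s - 1 \<noteq> 0" by (auto simp: complex_eq_iff)
    moreover have "J s = tail_int (a+1) s 1 1" using s by (intro J(2)) simp
    ultimately show "(phi a (s - 1) 1 1 - a * J s) / (a + s - 1) = tail_int a s 1 1"
      using tail_int_rec[of a s 1 1] s by (simp add: field_simps)
  qed
qed

section \<open>The Riemann zeta function as the case a = 0, n = 0\<close>

definition zeta_series :: "complex \<Rightarrow> complex" where "zeta_series z = (\<Sum>j. of_nat (Suc j) powr (-z))"

lemma phi_0_0: "x > 0 \<Longrightarrow> phi 0 z 0 x = of_real x powr (-z)"
  by (simp add: phi_def)

lemma summable_norm_zeta_series: "Re z > 1 \<Longrightarrow> summable (\<lambda>j. norm (complex_of_nat (Suc j) powr (-z)))"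
  using summable_powr_shift[of "Re z" 1] by (simp add: norm_powr_real_powr)

lemma zeta_series_sums: "Re z > 1 \<Longrightarrow> (\<lambda>j. of_nat (Suc j) powr (-z)) sums zeta_series z"
  unfolding zeta_series_def by (rule summable_sums[OF summable_norm_cancel[OF summable_norm_zeta_series]])

lemma tail_int_0_0:
  assumes "Re z > 1" "1 \<le> N"
  shows "tail_int 0 z 0 N = of_nat N powr (1 - z) / (z - 1)"
proof -
  have "z - 1 \<noteq> 0" using assms by (auto simp: complex_eq_iff)
  moreover have "phi 0 (z - 1) 0 (real N) = of_nat N powr (1 - z)" using assms by (subst phi_0_0) auto
  ultimately show ?thesis using tail_int_rec[of 0 z 0 N] assms by (simp add: field_simps)
qed

lemma zeta_series_continuation:
  assumes "L > 0"
  shows "\<exists>Z. Z holomorphic_on ({z. Re z > 1 - real L} - {1}) \<and> (\<forall>z. Re z > 1 \<longrightarrow> Z z = zeta_series z)"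
\<comment> \<open>Euler-Maclaurin with N = 1: the leading 1 is the term of index 1, and 1 / (z - 1)
  is the integral from 1 to infinity.\<close>
proof (intro exI[of _ "\<lambda>z. 1 + 1 / (z - 1) + em_sum L 0 z 0 1 - (\<Sum>j<L. em_coeff j *\<^sub>R dphi j 0 z 0 1)"] conjI allI impI)
  show "(\<lambda>z. 1 + 1 / (z - 1) + em_sum L 0 z 0 1 - (\<Sum>j<L. em_coeff j *\<^sub>R dphi j 0 z 0 1)) holomorphic_on ({z. Re z > 1 - real L} - {1})"
    unfolding scaleR_conv_of_real using assms
    by (intro holomorphic_intros dphi_holomorphic holomorphic_on_subset[OF em_sum_holomorphic]) auto
  fix z :: complex assume z: "Re z > 1"
  have "(\<lambda>i. phi 0 z 0 (real (1 + i) + 1)) sums (1 / (z - 1) + em_sum L 0 z 0 1 - (\<Sum>j<L. em_coeff j *\<^sub>R dphi j 0 z 0 1))"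
    using euler_maclaurin_sums[of 0 z L 0 1] tail_int_0_0[of z 1] z assms by simp
  also have "(\<lambda>i. phi 0 z 0 (real (1 + i) + 1)) = (\<lambda>i. of_nat (Suc (Suc i)) powr (-z))"
    by (subst phi_0_0) (auto simp: add_ac)
  finally have "(\<lambda>i. of_nat (Suc i) powr (-z)) sums (1 / (z - 1) + em_sum L 0 z 0 1 - (\<Sum>j<L. em_coeff j *\<^sub>R dphi j 0 z 0 1) + of_nat (Suc 0) powr (-z))"
    by (rule sums_Suc)
  then show "1 + 1 / (z - 1) + em_sum L 0 z 0 1 - (\<Sum>j<L. em_coeff j *\<^sub>R dphi j 0 z 0 1) = zeta_series z"
    using zeta_series_sums[OF z] sums_unique2 by (fastforce simp: algebra_simps)
qed

text \<open>Common form of the remainder series over n = j + 1. The bound n^(c' - Re s) against the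
  weight n^(-s2) leaves the exponent c' - Re s - Re s2; it is below -1 throughout the open
  half-plane as soon as it is at most -1 at Re s = c.\<close>

lemma weighted_series:
  fixes h :: "nat \<Rightarrow> complex \<Rightarrow> complex" and s2 :: complex and c c' :: real
  assumes hol: "\<And>j. h j holomorphic_on {s. Re s > c}"
    and bound: "\<And>\<rho> B. \<rho> > c \<Longrightarrow> B \<ge> 0 \<Longrightarrow>
       \<exists>C. \<forall>s j. norm s \<le> B \<longrightarrow> \<rho> \<le> Re s \<longrightarrow> norm (h j s) \<le> C * real (Suc j) powr (c' - \<rho>)"
    and c: "c' - c - Re s2 \<le> -1"
  shows "(\<lambda>s. \<Sum>j. of_nat (Suc j) powr (-s2) * h j s) holomorphic_on {s. Re s > c}" (is ?A)
    and "Re s > c \<Longrightarrow> summable (\<lambda>j. norm (of_nat (Suc j) powr (-s2) * h j s))"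
proof -
  have sm: "summable (\<lambda>j. C * real (1 + j) powr (- (Re s2 - c' + \<rho>)))" if "\<rho> > c" for C \<rho>
    using that c by (intro summable_mult summable_powr_shift) simp
  have le: "norm (complex_of_nat (Suc j) powr (-s2) * w) \<le> C * real (1 + j) powr (- (Re s2 - c' + \<rho>))"
    if "norm w \<le> C * real (Suc j) powr (c' - \<rho>)" for j w C \<rho>
  proof -
    have "norm (complex_of_nat (Suc j) powr (-s2) * w) = real (Suc j) powr (- Re s2) * norm w"
      by (simp add: norm_mult norm_powr_real_powr)
    also have "\<dots> \<le> real (Suc j) powr (- Re s2) * (C * real (Suc j) powr (c' - \<rho>))"
      using that by (intro mult_left_mono) auto
    also have "\<dots> = C * real (Suc j) powr (- Re s2 + (c' - \<rho>))" by (simp only: powr_add mult_ac)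
    also have "- Re s2 + (c' - \<rho>) = - (Re s2 - c' + \<rho>)" by simp
    finally show ?thesis by simp
  qed
  show ?A
  proof (rule holomorphic_suminf)
    fix z assume "z \<in> {s. Re s > c}"
    then obtain d \<rho> where d: "d > 0" "\<rho> > c" "\<And>s. s\<in>cball z d \<Longrightarrow> Re s \<ge> \<rho> \<and> norm s \<le> norm z + d"
      using Re_halfspace_cball[of c z] by auto
    from bound[OF d(2), of "norm z + d"] d(1) obtain C where C:
      "\<And>s j. norm s \<le> norm z + d \<Longrightarrow> \<rho> \<le> Re s \<Longrightarrow> norm (h j s) \<le> C * real (Suc j) powr (c' - \<rho>)"
      by force
    show "\<exists>d>0. \<exists>M. cball z d \<subseteq> {s. Re s > c} \<and> summable M
         \<and> (\<forall>m. \<forall>s\<in>cball z d. norm (of_nat (Suc m) powr (-s2) * h m s) \<le> M m)"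
    proof (rule exI[of _ d], intro conjI exI[of _ "\<lambda>j. C * real (1 + j) powr (- (Re s2 - c' + \<rho>))"] allI ballI)
      show "cball z d \<subseteq> {s. Re s > c}" using d by force
      show "summable (\<lambda>j. C * real (1 + j) powr (- (Re s2 - c' + \<rho>)))" by (rule sm[OF d(2)])
      fix m s assume "s \<in> cball z d"
      then show "norm (of_nat (Suc m) powr (-s2) * h m s) \<le> C * real (1 + m) powr (- (Re s2 - c' + \<rho>))"
        using d by (intro le C) auto
    qed (use d in auto)
  qed (use hol open_halfspace_Re in \<open>auto intro!: holomorphic_intros\<close>)
  show "summable (\<lambda>j. norm (of_nat (Suc j) powr (-s2) * h j s))" if s: "Re s > c"
  proof -
    from bound[OF s, of "norm s"] obtain C where C:
      "\<And>j. norm (h j s) \<le> C * real (Suc j) powr (c' - Re s)" by force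
    show ?thesis by (rule summable_comparison_test'[OF sm[OF s, of C]]) (use le[OF C] in auto)
  qed
qed

text \<open>The first entry of \<open>c\<close> is what the error series over m requires, the second
  what the resulting series over n requires. Any cutoff \<open>M j\<close> not below n = j + 1 will
  do, since the bound decreases in the cutoff.\<close>

lemma em_sum_series:
  fixes M :: "nat \<Rightarrow> nat" and a s2 :: complex and K :: nat
  assumes "K > 0" "\<And>j. M j \<ge> Suc j"
  defines "c \<equiv> max (1 - real K - Re a) (2 - real K - Re a - Re s2)"
  shows "(\<lambda>s. \<Sum>j. of_nat (Suc j) powr (-s2) * em_sum K a s (real (Suc j)) (M j)) holomorphic_on {s. Re s > c}" (is ?A)
    and "Re s > c \<Longrightarrow> summable (\<lambda>j. norm (of_nat (Suc j) powr (-s2) * em_sum K a s (real (Suc j)) (M j)))" (is "_ \<Longrightarrow> ?B")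
proof -
  have 1: "(\<lambda>s. em_sum K a s (real (Suc j)) (M j)) holomorphic_on {s. Re s > c}" for j
    using assms(2)[of j] assms(1)
    by (intro holomorphic_on_subset[OF em_sum_holomorphic]) (auto simp: c_def)
  have 2: "\<exists>C. \<forall>s j. norm s \<le> B \<longrightarrow> \<rho> \<le> Re s \<longrightarrow>
     norm (em_sum K a s (real (Suc j)) (M j)) \<le> C * real (Suc j) powr ((1 - real K - Re a) - \<rho>)"
    if \<rho>: "\<rho> > c" for \<rho> B
  proof -
    have "\<rho> + real K + Re a > 1" using \<rho> by (simp add: c_def)
    from em_sum_le[OF assms(1) this, of B a] obtain C where C: "C > 0"
       "\<And>s n N. norm s \<le> B \<Longrightarrow> \<rho> + real K + Re a \<le> Re a + Re s + real K \<Longrightarrow> 0 \<le> n \<Longrightarrow> n \<le> real N \<Longrightarrow> 1 \<le> N \<Longrightarrow>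
       norm (em_sum K a s n N) \<le> C * real N powr (1-(\<rho> + real K + Re a))" by blast
    show ?thesis
    proof (intro exI[of _ C] allI impI)
      fix s :: complex and j assume s: "norm s \<le> B" "\<rho> \<le> Re s"
      have "norm (em_sum K a s (real (Suc j)) (M j)) \<le> C * real (M j) powr (1-(\<rho> + real K + Re a))"
        using s assms(2)[of j] by (intro C(2)) auto
      also have "\<dots> \<le> C * real (Suc j) powr (1-(\<rho> + real K + Re a))"
        using C(1) \<rho> assms(2)[of j] by (intro mult_left_mono powr_mono2') (auto simp: c_def)
      finally show "norm (em_sum K a s (real (Suc j)) (M j)) \<le> C * real (Suc j) powr ((1 - real K - Re a) - \<rho>)"
        by (simp add: algebra_simps)
    qed
  qed
  have 3: "(1 - real K - Re a) - c - Re s2 \<le> -1" by (auto simp: c_def max_def)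
  show ?A by (rule weighted_series(1)[OF 1 2 3])
  show ?B if "Re s > c" by (rule weighted_series(2)[OF 1 2 3 that])
qed

text \<open>Absolute convergence allows summation over the larger index first: n = j + 1 is the
  smaller index and m = j + i + 2 the larger. The first hypothesis makes the sum over m converge,
  the second the remaining sum over n.\<close>

lemma AV2_series_sums:
  assumes "Re s1 + Re s > 1" "Re s1 + Re s2 + Re s > 2"
  shows "(\<lambda>j. of_nat (Suc j) powr (-s2) * (\<Sum>i. phi s1 s (real (Suc j)) (real (Suc j + i) + 1))) sums AV2_series s1 s2 s"
proof -
  define \<rho> where "\<rho> = Re s1 + Re s"
  define F where "F = (\<lambda>(j::nat, i::nat). of_nat (Suc j) powr (-s2) * phi s1 s (real (Suc j)) (real (Suc j + i) + 1))"
  have \<rho>: "\<rho> > 1" "Re s2 + \<rho> - 1 > 1" using assms by (auto simp: \<rho>_def)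
  obtain C where C: "C > 0" "\<And>n x. 0 \<le> n \<Longrightarrow> n \<le> x \<Longrightarrow> 1 \<le> x \<Longrightarrow>
    norm (phi s1 s n x) \<le> C * x powr (- Re s1 - Re s)" using phi_le[OF norm_ge_zero[of s], of s1] by blast
  have le: "norm (F (j, i)) \<le> real (Suc j) powr (- Re s2) * (C * real (Suc j + i) powr (- \<rho>))" for j i
  proof -
    have "norm (phi s1 s (real (Suc j)) (real (Suc j + i) + 1)) \<le> C * (real (Suc j + i) + 1) powr (- \<rho>)"
      using C(2)[of "real (Suc j)" "real (Suc j + i) + 1"] by (simp add: \<rho>_def)
    also have "\<dots> \<le> C * real (Suc j + i) powr (- \<rho>)"
      using C \<rho> by (intro mult_left_mono powr_mono2') auto
    finally show ?thesis unfolding F_def by (auto simp: norm_mult norm_powr_real_powr intro!: mult_left_mono)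
  qed
  have sm: "summable (\<lambda>i. real (Suc j) powr (- Re s2) * (C * real (Suc j + i) powr (- \<rho>)))" for j
    using \<rho> by (intro summable_mult summable_powr_shift)
  have smF: "summable (\<lambda>i. norm (F (j, i)))" for j
    by (rule summable_comparison_test'[OF sm]) (use le in auto)
  have infF: "(\<Sum>\<^sub>\<infinity>i. norm (F (j, i))) = (\<Sum>i. norm (F (j, i)))" for j
    by (intro infsumI norm_summable_imp_has_sum) (use smF in auto)
  have infle: "(\<Sum>i. norm (F (j, i))) \<le> C * (\<rho> / (\<rho> - 1)) * real (1 + j) powr (- (Re s2 + \<rho> - 1))" for j
  proof -
    have "(\<Sum>i. norm (F (j, i))) \<le> (\<Sum>i. real (Suc j) powr (- Re s2) * (C * real (Suc j + i) powr (- \<rho>)))"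
      by (intro suminf_le le smF sm)
    also have "\<dots> = real (Suc j) powr (- Re s2) * (C * (\<Sum>i. real (Suc j + i) powr (- \<rho>)))"
      by (simp only: suminf_mult[OF summable_mult[OF summable_powr_shift[OF \<rho>(1)]]] suminf_mult[OF summable_powr_shift[OF \<rho>(1)]])
    also have "\<dots> \<le> real (Suc j) powr (- Re s2) * (C * (\<rho> / (\<rho> - 1) * real (Suc j) powr (1 - \<rho>)))"
      using C \<rho> by (intro mult_left_mono suminf_powr_le) auto
    also have "\<dots> = C * (\<rho> / (\<rho> - 1)) * (real (Suc j) powr (- Re s2) * real (Suc j) powr (1 - \<rho>))" by simp
    also have "real (Suc j) powr (- Re s2) * real (Suc j) powr (1 - \<rho>) = real (1 + j) powr (- (Re s2 + \<rho> - 1))"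
      by (simp add: powr_add[symmetric] algebra_simps)
    finally show ?thesis .
  qed
  have sm2: "summable (\<lambda>j. \<Sum>i. norm (F (j, i)))"
  proof (rule summable_comparison_test')
    show "summable (\<lambda>j. C * (\<rho> / (\<rho> - 1)) * real (1 + j) powr (- (Re s2 + \<rho> - 1)))"
      using \<rho> by (intro summable_mult summable_powr_shift)
    show "norm (\<Sum>i. norm (F (j, i))) \<le> C * (\<rho> / (\<rho> - 1)) * real (1 + j) powr (- (Re s2 + \<rho> - 1))" for j
      using infle[of j] suminf_nonneg[OF smF] by simp
  qed
  have "(\<lambda>x. norm (F x)) summable_on (SIGMA j:UNIV. UNIV)"
    unfolding Infinite_Sum.abs_summable_on_Sigma_iff
  proof (intro conjI ballI)
    show "(\<lambda>i. norm (F (j, i))) summable_on UNIV" for j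
      by (intro norm_summable_imp_summable_on) (use smF in auto)
    show "(\<lambda>j. norm (\<Sum>\<^sub>\<infinity>i. norm (F (j, i)))) summable_on UNIV"
      unfolding infF by (intro norm_summable_imp_summable_on) (use sm2 suminf_nonneg[OF smF] in auto)
  qed
  then have F_summable: "F summable_on (SIGMA j:UNIV. UNIV)" by (rule abs_summable_summable)
  have bij: "bij_betw (\<lambda>(j::nat, i::nat). (j + i + 2, j + 1)) UNIV {(m, n). 0 < n \<and> n < m}"
    by (rule bij_betw_byWitness[where f' = "\<lambda>(m, n). (n - 1, m - n - 1)"]) auto
  have "AV2_series s1 s2 s = infsum F UNIV"
    unfolding AV2_series_def infsum_reindex_bij_betw[OF bij, symmetric]
    by (rule infsum_cong) (auto simp: F_def phi_def mult_ac add_ac)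
  also have "\<dots> = (\<Sum>\<^sub>\<infinity>j. \<Sum>\<^sub>\<infinity>i. F (j, i))"
    using infsum_Sigma'_banach[of "\<lambda>j i. F (j, i)" UNIV "\<lambda>_. UNIV"] F_summable by simp
  finally have eq: "AV2_series s1 s2 s = (\<Sum>\<^sub>\<infinity>j. \<Sum>i. F (j, i))"
  proof -
    have "(\<Sum>\<^sub>\<infinity>i. F (j, i)) = (\<Sum>i. F (j, i))" for j
      by (intro infsumI norm_summable_imp_has_sum smF summable_sums summable_norm_cancel[OF smF])
    then show "AV2_series s1 s2 s = (\<Sum>\<^sub>\<infinity>j. \<Sum>\<^sub>\<infinity>i. F (j, i)) \<Longrightarrow> ?thesis" by simp
  qed
  have sm3: "summable (\<lambda>j. norm (\<Sum>i. F (j, i)))"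
    by (rule summable_comparison_test'[OF sm2]) (use summable_norm[OF smF] in auto)
  have "(\<lambda>j. \<Sum>i. F (j, i)) sums AV2_series s1 s2 s"
    unfolding eq
    using infsumI[OF norm_summable_imp_has_sum[OF sm3 summable_sums[OF summable_norm_cancel[OF sm3]]]]
      summable_sums[OF summable_norm_cancel[OF sm3]] by simp
  moreover have "(\<Sum>i. F (j, i)) = of_nat (Suc j) powr (-s2) * (\<Sum>i. phi s1 s (real (Suc j)) (real (Suc j + i) + 1))" for j
  proof -
    have "summable (\<lambda>i. of_nat (Suc j) powr (-s2) * phi s1 s (real (Suc j)) (real (Suc j + i) + 1))"
      using summable_norm_cancel[OF smF[of j]] by (simp add: F_def)
    then have "summable (\<lambda>i. phi s1 s (real (Suc j)) (real (Suc j + i) + 1))"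
      by (subst (asm) summable_cmult_iff) (use of_nat_neq_0[of j, where 'a = complex] in auto)
    then show ?thesis unfolding F_def by (simp add: suminf_mult)
  qed
  ultimately show ?thesis by simp
qed

section \<open>The singular set, uniqueness and gluing\<close>

lemma closed_AV2_sing: "closed (AV2_sing s1 s2)"
proof -
  have "AV2_sing s1 s2 = (\<lambda>s. 1 - s1 - s) -` \<nat> \<union> (\<lambda>s. 2 - s1 - s2 - s) -` \<nat>"
    by (force simp: AV2_sing_def Nats_def algebra_simps)
  also have "closed \<dots>" by (intro closed_Un closed_vimage continuous_intros) auto
  finally show ?thesis .
qed

lemma countable_AV2_sing: "countable (AV2_sing s1 s2)"
proof -
  have "AV2_sing s1 s2 \<subseteq> range (\<lambda>l::nat. 1 - of_nat l - s1) \<union> range (\<lambda>l::nat. 2 - of_nat l - s1 - s2)"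
  proof
    fix s assume "s \<in> AV2_sing s1 s2"
    then obtain l :: nat where "s1 + s = 1 - of_nat l \<or> s1 + s2 + s = 2 - of_nat l" by (auto simp: AV2_sing_def)
    then have "s = 1 - of_nat l - s1 \<or> s = 2 - of_nat l - s1 - s2" by (auto simp: algebra_simps)
    then show "s \<in> range (\<lambda>l::nat. 1 - of_nat l - s1) \<union> range (\<lambda>l::nat. 2 - of_nat l - s1 - s2)" by blast
  qed
  then show ?thesis by (rule countable_subset) auto
qed

text \<open>A half-plane minus a countable set is still connected, so agreement in the region of
  absolute convergence propagates to all of it.\<close>

lemma AV2_identity:
  assumes "f holomorphic_on {s. Re s > c} - AV2_sing s1 s2" "g holomorphic_on {s. Re s > c} - AV2_sing s1 s2"
    and eq: "\<And>s. Re s1 + Re s > 1 \<Longrightarrow> Re s1 + Re s2 + Re s > 2 \<Longrightarrow> f s = g s"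
    and s: "Re s > c" "s \<notin> AV2_sing s1 s2"
  shows "f s = g s"
proof -
  \<comment> \<open>To the right of \<open>d\<close> the series converges absolutely and there are
    no singular points.\<close>
  define d where "d = max c (max (1 - Re s1) (2 - Re s1 - Re s2))"
  show ?thesis
  proof (rule analytic_continuation_open[of "{s. Re s > d}" "{s. Re s > c} - AV2_sing s1 s2" f g])
    show "connected ({s. Re s > c} - AV2_sing s1 s2)"
      using open_halfspace_Re by (intro connected_open_diff_countable countable_AV2_sing convex_connected convex_halfspace_Re_gt) auto
    have "Complex (d + 1) 0 \<in> {s. Re s > d}" by simp
    then show "{s. Re s > d} \<noteq> {}" by blast
    show "{s. Re s > d} \<subseteq> {s. Re s > c} - AV2_sing s1 s2"
      by (auto simp: d_def AV2_sing_def complex_eq_iff)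
    show "open {s. Re s > d}" by (rule open_halfspace_Re)
    show "open ({s. Re s > c} - AV2_sing s1 s2)"
      using open_halfspace_Re closed_AV2_sing by (rule open_Diff)
  qed (use assms in \<open>auto simp: d_def\<close>)
qed

text \<open>Each inner sum is cut at N = n. By homogeneity its integral and its boundary terms are
  then powers of n, whose sums over n are zeta values at s1 + s2 + s - 1 and at s1 + s2 + s + l; the
  series of the errors converges in the half-plane.\<close>

lemma AV2_continuation_halfplane:
  fixes s1 s2 :: complex and K :: nat
  assumes "K > 0"
  defines "c \<equiv> max (1 - real K - Re s1) (2 - real K - Re s1 - Re s2)"
  shows "\<exists>f. f holomorphic_on {s. Re s > c} - AV2_sing s1 s2 \<and>
    (\<forall>s. Re s1 + Re s > 1 \<and> Re s1 + Re s2 + Re s > 2 \<longrightarrow> f s = AV2_series s1 s2 s)"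
proof -
  obtain J where J: "J holomorphic_on ({s. Re s > 1 - Re s1 - real K} - {s. \<exists>l::nat. s1 + s = 1 - of_nat l})"
    "\<And>s. Re s > 1 - Re s1 \<Longrightarrow> J s = tail_int s1 s 1 1" using tail_int_continuation[of s1 K] by auto
  obtain Z where Z: "Z holomorphic_on ({z. Re z > 1 - real K} - {1})" "\<And>z. Re z > 1 \<Longrightarrow> Z z = zeta_series z"
    using zeta_series_continuation[OF assms(1)] by auto
  define f where "f s = J s * Z (s1 + s2 + s - 1)
     - (\<Sum>l<K. of_real (em_coeff l) * dphi l s1 s 1 1 * Z (s1 + s2 + s + of_nat l))
     + (\<Sum>j. of_nat (Suc j) powr (-s2) * em_sum K s1 s (real (Suc j)) (Suc j))" for s
  show ?thesis
  proof (intro exI[of _ f] conjI allI impI)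
    have "(\<lambda>s. \<Sum>j. of_nat (Suc j) powr (-s2) * em_sum K s1 s (real (Suc j)) (Suc j)) holomorphic_on {s. Re s > c} - AV2_sing s1 s2"
      using em_sum_series(1)[of K Suc s2 s1, OF assms(1) order_refl]
      unfolding c_def by (rule holomorphic_on_subset) auto
    moreover have "J holomorphic_on {s. Re s > c} - AV2_sing s1 s2"
      by (rule holomorphic_on_subset[OF J(1)]) (auto simp: c_def AV2_sing_def)
    \<comment> \<open>The pole of \<open>Z\<close> at 1 is met where s1 + s2 + s = 2 - l:
      \<open>l = 0\<close> comes from the integral, larger \<open>l\<close> from the boundary
      terms.\<close>
    moreover have ZZ: "(\<lambda>s. Z (s1 + s2 + s + w)) holomorphic_on {s. Re s > c} - AV2_sing s1 s2"
      if "w = of_nat l - 1" for l :: nat and w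
    proof -
      have "Z \<circ> (\<lambda>s. s1 + s2 + s + w) holomorphic_on {s. Re s > c} - AV2_sing s1 s2"
      proof (rule holomorphic_on_compose_gen[OF _ Z(1)])
        show "(\<lambda>s. s1 + s2 + s + w) ` ({s. c < Re s} - AV2_sing s1 s2) \<subseteq> {z. 1 - real K < Re z} - {1}"
        proof safe
          fix s assume s: "c < Re s" "s \<notin> AV2_sing s1 s2"
          then show "1 - real K < Re (s1 + s2 + s + w)" by (auto simp: that c_def)
          assume "s1 + s2 + s + w = 1"
          then have "s1 + s2 + s = 2 - of_nat l" by (simp add: that algebra_simps)
          with s(2) show "False" by (auto simp: AV2_sing_def)
        qed
      qed (intro holomorphic_intros)
      then show ?thesis by (simp add: o_def)
    qed
    moreover have "(\<lambda>s. Z (s1 + s2 + s - 1)) holomorphic_on {s. Re s > c} - AV2_sing s1 s2"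
      using ZZ[of "-1" 0] by simp
    moreover have "(\<lambda>s. Z (s1 + s2 + s + of_nat l)) holomorphic_on {s. Re s > c} - AV2_sing s1 s2" for l
      using ZZ[of "of_nat l" "Suc l"] by simp
    ultimately show "f holomorphic_on {s. Re s > c} - AV2_sing s1 s2"
      unfolding f_def[abs_def] by (intro holomorphic_intros dphi_holomorphic) auto
  next
    fix s assume s: "Re s1 + Re s > 1 \<and> Re s1 + Re s2 + Re s > 2"
    define w where "w = s1 + s2 + s"
    have inner: "of_nat (Suc j) powr (-s2) * (\<Sum>i. phi s1 s (real (Suc j)) (real (Suc j + i) + 1))
      = J s * of_nat (Suc j) powr (-(w - 1))
       - (\<Sum>l<K. of_real (em_coeff l) * dphi l s1 s 1 1 * of_nat (Suc j) powr (-(w + of_nat l)))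
       + of_nat (Suc j) powr (-s2) * em_sum K s1 s (real (Suc j)) (Suc j)" for j
    proof -
      define n where "n = Suc j"
      have n: "n \<ge> 1" "complex_of_nat n \<noteq> 0"
        unfolding n_def by simp (rule of_nat_neq_0)
      have "(\<Sum>i. phi s1 s (real n) (real (n + i) + 1)) = tail_int s1 s (real n) n + em_sum K s1 s (real n) n
           - (\<Sum>l<K. em_coeff l *\<^sub>R dphi l s1 s (real n) (real n))"
        by (rule sums_unique[symmetric], rule euler_maclaurin_sums) (use s n assms in auto)
      also have "tail_int s1 s (real n) n = of_nat n powr (1 - s1 - s) * J s"
        using tail_int_scale[of s1 s n] n s by (subst J(2)) auto
      also have "(\<Sum>l<K. em_coeff l *\<^sub>R dphi l s1 s (real n) (real n))
          = (\<Sum>l<K. of_real (em_coeff l) * dphi l s1 s 1 1 * of_nat n powr (-(s1 + s + of_nat l)))"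
        using n by (intro sum.cong refl, subst dphi_diagonal) (auto simp: scaleR_conv_of_real mult_ac)
      finally have "of_nat n powr (-s2) * (\<Sum>i. phi s1 s (real n) (real (n + i) + 1)) =
          J s * (of_nat n powr (-s2) * of_nat n powr (1 - s1 - s)) 
          - (\<Sum>l<K. of_real (em_coeff l) * dphi l s1 s 1 1 * (of_nat n powr (-s2) * of_nat n powr (-(s1 + s + of_nat l))))
          + of_nat n powr (-s2) * em_sum K s1 s (real n) n"
        by (simp add: ring_distribs sum_distrib_left mult_ac)
      also have "of_nat n powr (-s2) * of_nat n powr (1 - s1 - s) = of_nat n powr (-(w - 1))"
        by (simp add: powr_add[symmetric] w_def algebra_simps)
      also have "(\<lambda>l. of_nat n powr (-s2) * of_nat n powr (-(s1 + s + of_nat l))) = (\<lambda>l. of_nat n powr (-(w + of_nat l)))"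
        by (simp add: powr_add[symmetric] w_def algebra_simps)
      finally show ?thesis unfolding n_def .
    qed
    have c: "Re s > c" using s assms(1) by (auto simp: c_def)
    have Zs: "(\<lambda>j. of_nat (Suc j) powr (-z)) sums Z z" if "Re z > 1" for z
      using zeta_series_sums[OF that] Z(2)[OF that] by simp
    have "(\<lambda>j. J s * of_nat (Suc j) powr (-(w - 1))
       - (\<Sum>l<K. of_real (em_coeff l) * dphi l s1 s 1 1 * of_nat (Suc j) powr (-(w + of_nat l)))
       + of_nat (Suc j) powr (-s2) * em_sum K s1 s (real (Suc j)) (Suc j)) sums
      (J s * Z (w - 1) - (\<Sum>l<K. of_real (em_coeff l) * dphi l s1 s 1 1 * Z (w + of_nat l))
        + (\<Sum>j. of_nat (Suc j) powr (-s2) * em_sum K s1 s (real (Suc j)) (Suc j)))"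
      using s em_sum_series(2)[of K Suc s1 s2 s, OF assms(1) order_refl] c
      by (intro sums_add sums_diff sums_mult sums_sum Zs summable_sums summable_norm_cancel[of "\<lambda>j. of_nat (Suc j) powr (-s2) * em_sum K s1 s (real (Suc j)) (Suc j)"])
         (auto simp: w_def c_def)
    then have "(\<lambda>j. of_nat (Suc j) powr (-s2) * (\<Sum>i. phi s1 s (real (Suc j)) (real (Suc j + i) + 1))) sums f s"
      unfolding inner f_def w_def .
    then show "f s = AV2_series s1 s2 s" using AV2_series_sums[of s1 s s2] s sums_unique2 by blast
  qed
qed

text \<open>The half-planes of order K exhaust the plane and the continuations agree on overlaps, so
  a value may be taken from any order that reaches the point.\<close>

lemma AV2_continuation:
  "\<exists>f. f holomorphic_on (- AV2_sing s1 s2) \<and>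
    (\<forall>s. Re s1 + Re s > 1 \<and> Re s1 + Re s2 + Re s > 2 \<longrightarrow> f s = AV2_series s1 s2 s)"
proof -
  define c where "c = (\<lambda>K. max (1 - real (Suc K) - Re s1) (2 - real (Suc K) - Re s1 - Re s2))"
  have "\<forall>K. \<exists>f. f holomorphic_on {s. Re s > c K} - AV2_sing s1 s2 \<and>
    (\<forall>s. Re s1 + Re s > 1 \<and> Re s1 + Re s2 + Re s > 2 \<longrightarrow> f s = AV2_series s1 s2 s)"
    unfolding c_def using AV2_continuation_halfplane[of "Suc _"] by blast
  then obtain F where F: "\<And>K. F K holomorphic_on {s. Re s > c K} - AV2_sing s1 s2"
    "\<And>K s. Re s1 + Re s > 1 \<Longrightarrow> Re s1 + Re s2 + Re s > 2 \<Longrightarrow> F K s = AV2_series s1 s2 s" by metis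
  have agree: "F K s = F L s" if "Re s > c K" "Re s > c L" "s \<notin> AV2_sing s1 s2" for K L s
    by (rule AV2_identity[of _ "max (c K) (c L)" s1 s2])
       (use that F(2) in \<open>auto intro!: holomorphic_on_subset[OF F(1)]\<close>)
  have ex: "\<exists>K. Re s > c K" for s
  proof -
    obtain K :: nat where "real K > \<bar>1 - Re s1 - Re s\<bar> + \<bar>2 - Re s1 - Re s2 - Re s\<bar>" using reals_Archimedean2 by blast
    then show ?thesis by (intro exI[of _ K]) (auto simp: c_def)
  qed
  define k where "k s = (SOME K. Re s > c K)" for s
  have k: "Re s > c (k s)" for s unfolding k_def by (rule someI_ex[OF ex])
  define f where "f s = F (k s) s" for s
  have f_eq: "f s = F K s" if "Re s > c K" "s \<notin> AV2_sing s1 s2" for s K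
    unfolding f_def using that k by (intro agree)
  show ?thesis
  proof (intro exI[of _ f] conjI allI impI)
    have "f field_differentiable at z" if z: "z \<notin> AV2_sing s1 s2" for z
    proof -
      define U where "U = {s. Re s > c (k z)} - AV2_sing s1 s2"
      have U: "open U" "z \<in> U" using k[of z] z open_halfspace_Re closed_AV2_sing by (auto simp: U_def)
      have "F (k z) holomorphic_on U" unfolding U_def by (rule F)
      then have "f holomorphic_on U" by (rule holomorphic_transform) (use f_eq in \<open>auto simp: U_def\<close>)
      then show ?thesis using U holomorphic_on_imp_differentiable_at by blast
    qed
    then show "f holomorphic_on - AV2_sing s1 s2"
      using closed_AV2_sing by (auto simp: holomorphic_on_open open_Compl field_differentiable_def)
  qed (use F(2) in \<open>auto simp: f_def\<close>)
qed

text \<open>Existence of a continuation turns the properties demanded by \<open>SOME\<close> into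
  facts; from here on these two are all that is used about \<open>zeta_AV2\<close>.\<close>

lemma zeta_AV2_holomorphic: "zeta_AV2 s1 s2 holomorphic_on (- AV2_sing s1 s2)"
  and zeta_AV2_eq_series: "Re s1 + Re s > 1 \<Longrightarrow> Re s1 + Re s2 + Re s > 2 \<Longrightarrow> zeta_AV2 s1 s2 s = AV2_series s1 s2 s"
  using someI_ex[OF AV2_continuation[of s1 s2]] by (auto simp: zeta_AV2_def)

section \<open>Comparison of sum and integral for slowly varying phase\<close>

lemma exp_ne_1:
  fixes z :: complex
  assumes "norm z < 2" "z \<noteq> 0"
  shows "exp z \<noteq> 1"
proof
  assume "exp z = 1"
  then obtain n :: int where n: "Re z = 0" "Im z = of_int (2 * n) * pi" by (auto simp: exp_eq_1)
  have "n = 0"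
  proof (rule ccontr)
    assume "n \<noteq> 0"
    then have "\<bar>n\<bar> \<ge> 1" by simp
    then have "\<bar>of_int n :: real\<bar> \<ge> 1" by linarith
    then have "\<bar>Im z\<bar> \<ge> 2 * pi" using n by (simp add: abs_mult)
    then show False using pi_gt3 abs_Im_le_cmod[of z] assms by simp
  qed
  with n assms show False by (auto simp: complex_eq_iff)
qed

text \<open>For an exponential summand \<open>exp (z x)\<close> the difference between sum and integral telescopes
  exactly with this kernel \<open>g z = exp z / (exp z - 1) - 1 / z\<close>.\<close>
lemma em_kernel:
  obtains g :: "complex \<Rightarrow> complex" and G :: real where "G > 0"
    "\<And>z. norm z \<le> 1 \<Longrightarrow> norm (g z) \<le> G"
    "\<And>z w. norm z \<le> 1 \<Longrightarrow> norm w \<le> 1 \<Longrightarrow> norm (g z - g w) \<le> G * norm (z - w)"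
    "\<And>z. norm z \<le> 1 \<Longrightarrow> z \<noteq> 0 \<Longrightarrow> g z * (exp z - 1) = exp z - (exp z - 1) / z"
proof -
  \<comment> \<open>Removable singularities are filled in twice: \<open>A\<close> is (exp z - 1) /
    z, then \<open>h\<close> is z exp z / (exp z - 1) with value 1 at 0, and \<open>g\<close> is (h
    z - 1) / z. The disc of radius 2 contains no zero of exp z - 1 other than 0.\<close>
  define A where "A = (\<lambda>z. if z = 0 then deriv exp 0 else (exp z - exp 0) / (z - 0 :: complex))"
  have A: "A holomorphic_on UNIV" unfolding A_def by (rule pole_lemma) (auto intro: holomorphic_intros)
  have A0: "A 0 = 1" using DERIV_imp_deriv[OF DERIV_exp[of "0::complex"]] by (simp add: A_def)
  have Anz: "A z \<noteq> 0" if "norm z < 2" for z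
    using exp_ne_1[OF that] A0 by (cases "z = 0") (auto simp: A_def)
  define h where "h = (\<lambda>z. exp z / A z)"
  have h: "h holomorphic_on ball 0 2" unfolding h_def using Anz
    by (intro holomorphic_intros holomorphic_on_subset[OF A]) auto
  define g where "g = (\<lambda>z. if z = 0 then deriv h 0 else (h z - h 0) / (z - 0))"
  have g: "g holomorphic_on ball 0 2" unfolding g_def by (rule pole_lemma) (use h in auto)
  have sub: "cball 0 1 \<subseteq> ball (0::complex) 2" by auto
  have "compact (g ` cball 0 1)"
    using holomorphic_on_imp_continuous_on[OF holomorphic_on_subset[OF g sub]] by (intro compact_continuous_image) auto
  then obtain G1 where G1: "\<forall>y\<in>g ` cball 0 1. norm y \<le> G1" by (meson bounded_iff compact_imp_bounded)
  have dg: "deriv g holomorphic_on ball 0 2" by (intro holomorphic_deriv g) auto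
  have "compact (deriv g ` cball 0 1)"
    using holomorphic_on_imp_continuous_on[OF holomorphic_on_subset[OF dg sub]] by (intro compact_continuous_image) auto
  then obtain G2 where G2: "\<forall>y\<in>deriv g ` cball 0 1. norm y \<le> G2" by (meson bounded_iff compact_imp_bounded)
  show ?thesis
  proof (rule that[of "max 1 (max G1 G2)" g])
    fix z w :: complex assume zw: "norm z \<le> 1" "norm w \<le> 1"
    have "norm (g z - g w) \<le> G2 * norm (z - w)"
    proof (rule field_differentiable_bound)
      show "(g has_field_derivative deriv g x) (at x within cball 0 1)" if "x \<in> cball 0 1" for x
        using that sub g holomorphic_derivI[OF g open_ball] by (meson has_field_derivative_at_within subsetD)
    qed (use zw G2 in auto)
    also have "\<dots> \<le> max 1 (max G1 G2) * norm (z - w)" by (intro mult_right_mono) auto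
    finally show "norm (g z - g w) \<le> max 1 (max G1 G2) * norm (z - w)" .
  next
    fix z :: complex assume z: "norm z \<le> 1" "z \<noteq> 0"
    then have "exp z - 1 \<noteq> 0" using exp_ne_1[of z] by auto
    then show "g z * (exp z - 1) = exp z - (exp z - 1) / z"
      using z A0 by (simp add: g_def h_def A_def field_simps)
  qed (use G1 in \<open>auto simp: le_max_iff_disj\<close>)
qed

lemma integral_exp_unit:
  fixes l :: complex and m :: real
  shows "l \<noteq> 0 \<Longrightarrow> integral {m..m+1} (\<lambda>x. exp (l * of_real (x - m))) = (exp l - 1) / l"
    and "l = 0 \<Longrightarrow> integral {m..m+1} (\<lambda>x. exp (l * of_real (x - m))) = 1"
proof -
  assume l: "l \<noteq> 0"
  have "((\<lambda>x. exp (l * of_real (x - m))) has_integral (exp (l * of_real (m + 1 - m)) / l - exp (l * of_real (m - m)) / l)) {m..m+1}"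
  proof (rule fundamental_theorem_of_calculus)
    fix x
    have "((\<lambda>z. exp (l * (z - of_real m)) / l) has_field_derivative exp (l * of_real (x - m))) (at (of_real x))"
      using l by (auto intro!: derivative_eq_intros)
    then have "((\<lambda>x. exp (l * (of_real x - of_real m)) / l) has_vector_derivative exp (l * of_real (x - m))) (at x within {m..m+1})"
      by (rule has_vector_derivative_real_field)
    then show "((\<lambda>x. exp (l * of_real (x - m)) / l) has_vector_derivative exp (l * of_real (x - m))) (at x within {m..m+1})"
      by simp
  qed simp
  then show "integral {m..m+1} (\<lambda>x. exp (l * of_real (x - m))) = (exp l - 1) / l"
    using l by (simp add: integral_unique diff_divide_distrib)
qed simp

text \<open>The logarithmic derivative of \<open>phi\<close> in \<open>x\<close>.\<close>

definition phi_rate :: "complex \<Rightarrow> complex \<Rightarrow> real \<Rightarrow> real \<Rightarrow> complex" where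
  "phi_rate a s n x = - (a / of_real x + s / of_real (x + n))"

lemma phi_has_vector_derivative_rate:
  assumes "x > 0" "n \<ge> 0"
  shows "(phi a s n has_vector_derivative phi_rate a s n x * phi a s n x) (at x within S)"
proof -
  have nz: "complex_of_real (x + n) \<noteq> 0" "complex_of_real x \<noteq> 0"
    using assms by (simp_all only: of_real_eq_0_iff)
  have eq: "phi (a + 1) s n x = phi a s n x / of_real x" "phi a (s + 1) n x = phi a s n x / of_real (x + n)"
    using phi_shift[OF assms, of a "s + 1"] phi_shift[OF assms, of a s] nz by (simp_all add: field_simps)
  have "- a * (p / u) - s * (p / v) = - (a / u + s / v) * p" for p u v by (simp add: algebra_simps)
  then have "- a * phi (a + 1) s n x - s * phi a (s + 1) n x = phi_rate a s n x * phi a s n x"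
    unfolding eq phi_rate_def .
  then show ?thesis using phi_has_vector_derivative[OF assms, of a s S] by simp
qed

lemma norm_phi_rate_le:
  assumes "x > 0" "n \<ge> 0"
  shows "norm (phi_rate a s n x) \<le> (norm a + norm s) / x"
proof -
  have "norm (phi_rate a s n x) \<le> norm (a / of_real x) + norm (s / of_real (x + n))"
    unfolding phi_rate_def norm_minus_cancel by (rule norm_triangle_ineq)
  also have "\<dots> = norm a / x + norm s / (x + n)" using assms by (simp add: norm_divide del: of_real_add)
  also have "\<dots> \<le> norm a / x + norm s / x" using assms by (intro add_mono divide_left_mono) auto
  finally show ?thesis by (simp add: add_divide_distrib)
qed

lemma phi_rate_diff_le:
  assumes "m > 0" "n \<ge> 0" "m \<le> x" "x \<le> m + 1"
  shows "norm (phi_rate a s n x - phi_rate a s n m) \<le> (norm a + norm s) / m ^ 2"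
proof -
  have *: "norm (c / of_real (x + k) - c / of_real (m + k)) \<le> norm c / m ^ 2" if "k \<ge> 0" for c :: complex and k
  proof -
    have nz: "complex_of_real (x + k) \<noteq> 0" "complex_of_real (m + k) \<noteq> 0"
      using assms that by (simp_all only: of_real_eq_0_iff)
    have "c / of_real (x + k) - c / of_real (m + k) = c * of_real (m - x) / (of_real (x + k) * of_real (m + k))"
      using nz by (simp add: divide_simps) (simp add: algebra_simps)
    then have "norm (c / of_real (x + k) - c / of_real (m + k)) = norm c * \<bar>m - x\<bar> / ((x + k) * (m + k))"
      using assms that by (simp add: norm_divide norm_mult del: of_real_add of_real_diff)
    also have "\<dots> \<le> norm c * 1 / (m * m)"
      using assms that by (intro frac_le mult_mono mult_nonneg_nonneg) auto
    finally show ?thesis by (simp add: power2_eq_square)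
  qed
  have "phi_rate a s n x - phi_rate a s n m =
     - ((a / of_real (x + 0) - a / of_real (m + 0)) + (s / of_real (x + n) - s / of_real (m + n)))"
    by (simp add: phi_rate_def)
  also have "norm \<dots> \<le> norm (a / of_real (x + 0) - a / of_real (m + 0)) + norm (s / of_real (x + n) - s / of_real (m + n))"
    unfolding norm_minus_cancel by (rule norm_triangle_ineq)
  also have "\<dots> \<le> norm a / m ^ 2 + norm s / m ^ 2" using assms by (intro add_mono *) auto
  finally show ?thesis by (simp add: add_divide_distrib)
qed

lemma norm_phi_antimono:
  assumes "m > 0" "n \<ge> 0" "m \<le> x" "Re a \<ge> 0" "Re s \<ge> 0"
  shows "norm (phi a s n x) \<le> norm (phi a s n m)"
  using assms by (simp add: norm_phi) (intro mult_mono powr_mono2'; simp)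

lemma norm_phi_le_powr:
  assumes "x > 0" "n \<ge> 0" "Re s \<ge> 0"
  shows "norm (phi a s n x) \<le> x powr (- (Re a + Re s))"
proof -
  have "norm (phi a s n x) \<le> x powr (- Re a) * x powr (- Re s)"
    unfolding norm_phi[OF assms(1,2)] using assms by (intro mult_left_mono powr_mono2') auto
  then show ?thesis by (simp add: powr_add[symmetric])
qed

text \<open>Dividing \<open>phi\<close> by the exponential with frozen rate leaves a function \<psi>
  whose derivative contains only the change of the rate since \<open>m\<close>, which is at most
  (|a| + |s|) / m^2. The hypothesis |a| + |s| \<le> m bounds the rate by 1, so dividing by the
  exponential and multiplying it back cost a factor exp 1 each.\<close>

lemma phi_near_exp:
  assumes "m > 0" "n \<ge> 0" "Re a \<ge> 0" "Re s \<ge> 0" "norm a + norm s \<le> m" "m \<le> x" "x \<le> m + 1"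
  shows "norm (phi a s n x - phi a s n m * exp (phi_rate a s n m * of_real (x - m)))
     \<le> exp 2 * ((norm a + norm s) / m ^ 2) * norm (phi a s n m)"
proof -
  define l where "l = phi_rate a s n m"
  define \<delta> where "\<delta> = (norm a + norm s) / m ^ 2"
  have \<delta>: "\<delta> \<ge> 0" by (simp add: \<delta>_def)
  have l: "norm l \<le> 1"
    unfolding l_def
    by (rule order_trans[OF norm_phi_rate_le[OF assms(1,2)]]) (use assms(1,5) in \<open>simp add: pos_divide_le_eq\<close>)
  have expl: "norm (exp (l * of_real y)) \<le> exp 1" if "\<bar>y\<bar> \<le> 1" for y :: real
  proof -
    have "norm (l * of_real y) \<le> 1" using l that by (simp add: norm_mult mult_le_one)
    then show ?thesis using norm_exp[of "l * of_real y"] by (meson exp_le_cancel_iff order_trans)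
  qed
  define \<psi> where "\<psi> = (\<lambda>x. phi a s n x * exp (- l * of_real (x - m)))"
  define \<psi>' where "\<psi>' = (\<lambda>x. (phi_rate a s n x - l) * phi a s n x * exp (- l * of_real (x - m)))"
  have "(\<psi>' has_integral (\<psi> x - \<psi> m)) {m..x}"
  proof (rule fundamental_theorem_of_calculus)
    fix y assume y: "y \<in> {m..x}"
    have "((\<lambda>z. exp (- l * (z - of_real m))) has_field_derivative (- l * exp (- l * of_real (y - m)))) (at (of_real y))"
      by (auto intro!: derivative_eq_intros)
    then have "((\<lambda>x. exp (- l * (of_real x - of_real m))) has_vector_derivative (- l * exp (- l * of_real (y - m)))) (at y within {m..x})"
      by (rule has_vector_derivative_real_field)
    then have e: "((\<lambda>x. exp (- l * of_real (x - m))) has_vector_derivative (- l * exp (- l * of_real (y - m)))) (at y within {m..x})"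
      by simp
    have "y > 0" using y assms by auto
    from has_vector_derivative_mult[OF phi_has_vector_derivative_rate[OF this assms(2)] e]
    have "(\<psi> has_vector_derivative (phi a s n y * (- l * exp (- l * of_real (y - m))) +
         phi_rate a s n y * phi a s n y * exp (- l * of_real (y - m)))) (at y within {m..x})"
      unfolding \<psi>_def .
    then show "(\<psi> has_vector_derivative \<psi>' y) (at y within {m..x})"
      by (simp add: \<psi>'_def algebra_simps)
  qed (use assms in auto)
  then have "norm (\<psi> x - \<psi> m) \<le> (\<delta> * norm (phi a s n m) * exp 1) * Sigma_Algebra.measure lborel {m..x}"
  proof (rule has_integral_bound_real[rotated 2])
    fix y assume "y \<in> {m..x} - {}"
    then have y: "m \<le> y" "y \<le> x" by auto
    have "norm (\<psi>' y) = norm (phi_rate a s n y - l) * norm (phi a s n y) * norm (exp (l * of_real (m - y)))"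
    proof -
      have "- l * of_real (y - m) = l * of_real (m - y)" by (simp add: algebra_simps)
      then show ?thesis unfolding \<psi>'_def by (simp only: norm_mult)
    qed
    also have "\<dots> \<le> \<delta> * norm (phi a s n m) * exp 1"
      unfolding l_def \<delta>_def using y assms expl[of "m - y", unfolded l_def]
      by (intro mult_mono mult_nonneg_nonneg phi_rate_diff_le norm_phi_antimono) auto
    finally show "norm (\<psi>' y) \<le> \<delta> * norm (phi a s n m) * exp 1" .
  qed (use assms \<delta> in auto)
  also have "\<dots> \<le> (\<delta> * norm (phi a s n m) * exp 1) * 1" using assms \<delta> by (intro mult_left_mono) auto
  finally have 1: "norm (\<psi> x - \<psi> m) \<le> \<delta> * norm (phi a s n m) * exp 1" by simp
  have "phi a s n x - phi a s n m * exp (l * of_real (x - m)) = (\<psi> x - \<psi> m) * exp (l * of_real (x - m))"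
    by (simp add: \<psi>_def algebra_simps exp_minus flip: exp_add)
  then have "norm (phi a s n x - phi a s n m * exp (l * of_real (x - m))) =
     norm (\<psi> x - \<psi> m) * norm (exp (l * of_real (x - m)))" by (simp add: norm_mult)
  also have "\<dots> \<le> (\<delta> * norm (phi a s n m) * exp 1) * exp 1"
    using 1 expl[of "x - m"] assms \<delta> by (intro mult_mono) auto
  also have "\<dots> = exp 2 * \<delta> * norm (phi a s n m)" by (simp add: exp_add[symmetric] mult_ac flip: exp_add)
  finally show ?thesis unfolding l_def \<delta>_def .
qed

text \<open>The increments of \<open>H\<close> carry the main part of sum minus integral and
  telescope to the boundary value at N. What is left decays like (|a| + |s|) m^(-\<alpha> - 2);
  summation costs one power, and |a| + |s| \<le> N restores N^(-\<alpha>). In contrast to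
  \<open>em_sum_le\<close>, the constant depends on \<alpha> only and not on a bound for
  \<open>s\<close>.\<close>

lemma dsum_le:
  assumes "\<alpha> > 0"
  shows "\<exists>C>0. \<forall>a s n N. Re a \<ge> 0 \<longrightarrow> Re s \<ge> 0 \<longrightarrow> Re a + Re s = \<alpha> \<longrightarrow> 0 \<le> n \<longrightarrow> n \<le> real N \<longrightarrow> 1 \<le> N \<longrightarrow>
     norm a + norm s \<le> real N \<longrightarrow> norm (dsum a s n N) \<le> C * real N powr (-\<alpha>)"
proof -
  obtain g :: "complex \<Rightarrow> complex" and G :: real where g: "G > 0"
    "\<And>z. norm z \<le> 1 \<Longrightarrow> norm (g z) \<le> G"
    "\<And>z w. norm z \<le> 1 \<Longrightarrow> norm w \<le> 1 \<Longrightarrow> norm (g z - g w) \<le> G * norm (z - w)"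
    "\<And>z. norm z \<le> 1 \<Longrightarrow> z \<noteq> 0 \<Longrightarrow> g z * (exp z - 1) = exp z - (exp z - 1) / z" by (rule em_kernel, rule that)
  \<comment> \<open>One exp 2 each for \<open>q\<close> at m + 1 and for the integral of
    \<open>q\<close>, G exp 2 for the kernel times \<open>q\<close>, and G for the change of the
    kernel from m to m + 1.\<close>
  define C where "C = 2 * exp 2 + G * exp 2 + G"
  have C: "C > 0" using g(1) by (auto simp: C_def intro!: add_pos_pos)
  show ?thesis
  proof (intro exI[of _ "G + C * ((\<alpha> + 2) / (\<alpha> + 1))"] conjI allI impI)
    show "G + C * ((\<alpha> + 2) / (\<alpha> + 1)) > 0" using g(1) C assms by (intro add_pos_pos) auto
    fix a s :: complex and n :: real and N :: nat
    assume *: "Re a \<ge> 0" "Re s \<ge> 0" "Re a + Re s = \<alpha>" "0 \<le> n" "n \<le> real N" "1 \<le> N" "norm a + norm s \<le> real N"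
    define l where "l = phi_rate a s n"
    define P where "P = phi a s n"
    define H where "H = (\<lambda>x. g (l x) * P x)"
    have l: "norm (l x) \<le> 1" if "x \<ge> real N" for x
    proof -
      have "norm (l x) \<le> (norm a + norm s) / x" unfolding l_def using * that by (intro norm_phi_rate_le) auto
      also have "\<dots> \<le> 1" using * that by (simp add: field_simps)
      finally show ?thesis .
    qed
    have P: "norm (P x) \<le> x powr (-\<alpha>)" if "x \<ge> real N" for x
      unfolding P_def using norm_phi_le_powr[of x n s a] * that by simp
    define E where "E = (\<lambda>i. P (real (N+i) + 1) - unit_int a s n (real (N+i)) - (H (real (N+i) + 1) - H (real (N+i))))"
    have E: "norm (E i) \<le> C * (norm a + norm s) * real (N+i) powr (-(\<alpha> + 2))" for i
    proof -
      define m where "m = real (N+i)"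
      have m: "m \<ge> real N" "m > 0" "norm a + norm s \<le> m" using * by (auto simp: m_def)
      define \<delta> where "\<delta> = (norm a + norm s) / m ^ 2"
      define q where "q = (\<lambda>x. P x - P m * exp (l m * of_real (x - m)))"
      have q: "norm (q x) \<le> exp 2 * \<delta> * norm (P m)" if "m \<le> x" "x \<le> m + 1" for x
        unfolding q_def P_def l_def \<delta>_def using * m that by (intro phi_near_exp) auto
      have cont: "continuous_on {m..m+1} P" unfolding P_def using * m by (intro phi_continuous_on) auto
      have qint: "integral {m..m+1} q = unit_int a s n m - P m * integral {m..m+1} (\<lambda>x. exp (l m * of_real (x - m)))"
        unfolding q_def unit_int_def P_def[symmetric]
        by (subst integral_diff)
           (auto intro!: integrable_continuous_real continuous_intros cont simp: integral_mult_right)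
      have nq: "norm (integral {m..m+1} q) \<le> exp 2 * \<delta> * norm (P m) * (m + 1 - m)"
        by (rule integral_bound) (use q cont in \<open>auto simp: q_def intro!: continuous_intros\<close>)
      have ker: "exp (l m) - integral {m..m+1} (\<lambda>x. exp (l m * of_real (x - m))) = g (l m) * (exp (l m) - 1)"
        using integral_exp_unit[of "l m" m] g(4)[OF l[OF m(1)]] by (cases "l m = 0") simp_all
      have "E i = q (m + 1) - integral {m..m+1} q + g (l m) * (P m * exp (l m) - P (m + 1))
          + (g (l m) - g (l (m + 1))) * P (m + 1)"
      proof -
        have "P m * exp (l m) - P m * integral {m..m+1} (\<lambda>x. exp (l m * of_real (x - m))) = P m * (g (l m) * (exp (l m) - 1))"
          unfolding ker[symmetric] by (simp add: algebra_simps)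
        then show ?thesis unfolding E_def H_def qint m_def[symmetric] by (simp add: q_def algebra_simps)
      qed
      also have "g (l m) * (P m * exp (l m) - P (m + 1)) = - g (l m) * q (m + 1)" by (simp add: q_def algebra_simps)
      finally have "norm (E i) \<le> norm (q (m + 1)) + norm (integral {m..m+1} q) + norm (g (l m)) * norm (q (m + 1))
          + norm (g (l m) - g (l (m + 1))) * norm (P (m + 1))"
        by (smt (verit) norm_triangle_ineq norm_triangle_ineq4 norm_mult norm_minus_cancel)
      also have "\<dots> \<le> exp 2 * \<delta> * norm (P m) + exp 2 * \<delta> * norm (P m) + G * (exp 2 * \<delta> * norm (P m)) + (G * \<delta>) * norm (P m)"
      proof (intro add_mono mult_mono)
        have "norm (g (l m) - g (l (m + 1))) \<le> G * norm (l m - l (m + 1))"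
          using m by (intro g(3) l) auto
        also have "norm (l m - l (m + 1)) \<le> \<delta>"
          unfolding l_def \<delta>_def using phi_rate_diff_le[of m n "m + 1" a s] m * by (simp add: norm_minus_commute)
        finally show "norm (g (l m) - g (l (m + 1))) \<le> G * \<delta>" using g(1) by simp
        show "norm (P (m + 1)) \<le> norm (P m)" unfolding P_def using m * by (intro norm_phi_antimono) auto
        show "norm (g (l m)) \<le> G" using m by (intro g(2) l) auto
      qed (use q[of "m + 1"] nq g(1) in \<open>auto simp: \<delta>_def\<close>)
      also have "\<dots> = C * \<delta> * norm (P m)" by (simp add: C_def algebra_simps)
      also have "\<dots> \<le> C * \<delta> * m powr (-\<alpha>)" using P[OF m(1)] C by (intro mult_left_mono) (auto simp: \<delta>_def)
      also have "\<dots> = C * (norm a + norm s) * (m powr (-\<alpha>) / m powr 2)" using m by (simp add: \<delta>_def)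
      also have "m powr (-\<alpha>) / m powr 2 = m powr (-(\<alpha> + 2))" by (simp add: powr_diff[symmetric])
      finally show ?thesis unfolding m_def .
    qed
    have smE: "summable (\<lambda>i. C * (norm a + norm s) * real (N+i) powr (-(\<alpha> + 2)))"
      using assms by (intro summable_mult summable_powr_shift) auto
    have smE2: "summable (\<lambda>i. norm (E i))" by (rule summable_comparison_test'[OF smE]) (use E in auto)
    have Hlim: "(\<lambda>i. H (real (N+i))) \<longlonglongrightarrow> 0"
    proof (rule Lim_null_comparison)
      show "\<forall>\<^sub>F i in sequentially. norm (H (real (N+i))) \<le> G * norm (P (real (N+i)))"
        using g(2) l by (intro always_eventually) (auto simp: H_def norm_mult intro!: mult_right_mono)
      show "(\<lambda>i. G * norm (P (real (N+i)))) \<longlonglongrightarrow> 0"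
        unfolding P_def using * assms by (intro tendsto_mult_right_zero tendsto_norm_zero phi_tendsto_0) auto
    qed
    have "(\<lambda>i. H (real (N+i) + 1) - H (real (N+i))) sums (0 - H (real N))"
      using telescope_sums[OF Hlim] by (simp add: add_ac)
    from sums_add[OF summable_sums[OF summable_norm_cancel[OF smE2]] this]
    have "(\<lambda>i. P (real (N+i) + 1) - unit_int a s n (real (N+i))) sums ((\<Sum>i. E i) - H (real N))"
      by (simp add: E_def)
    moreover have "(\<lambda>i. P (real (N+i) + 1) - unit_int a s n (real (N+i))) sums dsum a s n N"
      unfolding P_def using * assms by (intro dsum_sums) auto
    ultimately have "dsum a s n N = (\<Sum>i. E i) - H (real N)" using sums_unique2 by blast
    then have "norm (dsum a s n N) \<le> norm (H (real N)) + norm (\<Sum>i. E i)"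
      by (metis add.commute norm_triangle_ineq4)
    also have "norm (H (real N)) \<le> G * real N powr (-\<alpha>)"
      unfolding H_def norm_mult using g l P by (intro mult_mono) auto
    also have "norm (\<Sum>i. E i) \<le> (\<Sum>i. C * (norm a + norm s) * real (N+i) powr (-(\<alpha> + 2)))"
      by (rule order_trans[OF summable_norm[OF smE2] suminf_le[OF E smE2 smE]])
    also have "\<dots> = C * (norm a + norm s) * (\<Sum>i. real (N+i) powr (-(\<alpha> + 2)))"
      using assms by (intro suminf_mult summable_powr_shift) auto
    also have "\<dots> \<le> C * real N * ((\<alpha> + 2) / (\<alpha> + 1) * real N powr (1 - (\<alpha> + 2)))"
    proof (intro mult_mono)
      have "\<alpha> + 2 - 1 = \<alpha> + 1" by simp
      then show "(\<Sum>i. real (N+i) powr (-(\<alpha> + 2))) \<le> (\<alpha> + 2) / (\<alpha> + 1) * real N powr (1 - (\<alpha> + 2))"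
        using suminf_powr_le[of N "\<alpha> + 2"] * assms by argo
      show "0 \<le> (\<Sum>i. real (N+i) powr (-(\<alpha> + 2)))"
        using assms by (intro suminf_nonneg summable_powr_shift) auto
    qed (use * C assms in auto)
    also have "\<dots> = C * ((\<alpha> + 2) / (\<alpha> + 1)) * (real N powr 1 * real N powr (1 - (\<alpha> + 2)))"
      unfolding powr_one[OF of_nat_0_le_iff] by simp
    also have "real N powr 1 * real N powr (1 - (\<alpha> + 2)) = real N powr (-\<alpha>)"
      unfolding powr_add[symmetric] by simp
    finally show "norm (dsum a s n N) \<le> (G + C * ((\<alpha> + 2) / (\<alpha> + 1))) * real N powr (-\<alpha>)"
      by (simp add: algebra_simps)
  qed
qed

section \<open>Approximation by partial sums\<close>

text \<open>\<open>tail_int_rec\<close> solved for the integral; this makes sense for Re a + Re s >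
  0 off the pole a + s = 1.\<close>

definition tail_ext :: "complex \<Rightarrow> complex \<Rightarrow> real \<Rightarrow> nat \<Rightarrow> complex" where
  "tail_ext a s n N = (phi a (s - 1) n (real N) - a * of_real n * tail_int (a + 1) s n N) / (a + s - 1)"

lemma tail_ext_eq_tail_int:
  assumes "Re a + Re s > 1" "0 \<le> n" "n \<le> real N" "1 \<le> N"
  shows "tail_ext a s n N = tail_int a s n N"
proof -
  have "a + s - 1 \<noteq> 0" using assms by (auto simp: complex_eq_iff)
  then show ?thesis using tail_int_rec[OF assms] by (simp add: tail_ext_def field_simps)
qed

lemma tail_ext_holomorphic:
  assumes "0 \<le> n" "n \<le> real N" "1 \<le> N"
  shows "(\<lambda>s. tail_ext a s n N) holomorphic_on {s. Re s > - Re a} - {1 - a}"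
proof -
  have "complex_of_real (real N + n) \<noteq> 0" using assms by (simp only: of_real_eq_0_iff)
  then have "(\<lambda>s. phi a (s - 1) n (real N)) holomorphic_on A" for A
    unfolding phi_def by (intro holomorphic_intros)
  moreover have "(\<lambda>s. tail_int (a + 1) s n N) holomorphic_on {s. Re s > - Re a} - {1 - a}"
    by (rule holomorphic_on_subset[OF tail_int_holomorphic]) (use assms in auto)
  ultimately show ?thesis unfolding tail_ext_def by (auto intro!: holomorphic_intros simp: algebra_simps)
qed

text \<open>The continuation to Re z > 0 of the sum of n^(-z) over n > X.\<close>

definition zeta_tail :: "nat \<Rightarrow> complex \<Rightarrow> complex" where
  "zeta_tail X z = of_nat X powr (1 - z) / (z - 1) + dsum 0 z 0 X"

lemma zeta_tail_sums:
  assumes "Re z > 1" "1 \<le> X"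
  shows "(\<lambda>i. of_nat (Suc (X + i)) powr (-z)) sums zeta_tail X z"
proof -
  have "(\<lambda>i. phi 0 z 0 (real (X + i) + 1)) sums zeta_tail X z"
    unfolding zeta_tail_def using sums_tail_int_dsum[of 0 z 0 X] tail_int_0_0[of z X] assms by simp
  also have "(\<lambda>i. phi 0 z 0 (real (X + i) + 1)) = (\<lambda>i. of_nat (Suc (X + i)) powr (-z))"
    by (subst phi_0_0) (auto simp: add_ac)
  finally show ?thesis .
qed

lemma zeta_tail_holomorphic:
  assumes "1 \<le> X"
  shows "zeta_tail X holomorphic_on {z. Re z > 0} - {1}"
  unfolding zeta_tail_def[abs_def] using assms
  by (intro holomorphic_intros holomorphic_on_subset[OF dsum_holomorphic]) auto

lemma dsum_series:
  fixes M :: "nat \<Rightarrow> nat" and a s2 :: complex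
  assumes "\<And>j. M j \<ge> Suc j"
  defines "c \<equiv> max (- Re a) (1 - Re a - Re s2)"
  shows "(\<lambda>s. \<Sum>j. of_nat (Suc j) powr (-s2) * dsum a s (real (Suc j)) (M j)) holomorphic_on {s. Re s > c}" (is ?A)
    and "Re s > c \<Longrightarrow> summable (\<lambda>j. norm (of_nat (Suc j) powr (-s2) * dsum a s (real (Suc j)) (M j)))" (is "_ \<Longrightarrow> ?B")
proof -
  have 1: "(\<lambda>s. dsum a s (real (Suc j)) (M j)) holomorphic_on {s. Re s > c}" for j
    using assms(1)[of j]
    by (intro holomorphic_on_subset[OF dsum_holomorphic]) (auto simp: c_def)
  have 2: "\<exists>C. \<forall>s j. norm s \<le> B \<longrightarrow> \<rho> \<le> Re s \<longrightarrow>
     norm (dsum a s (real (Suc j)) (M j)) \<le> C * real (Suc j) powr (- Re a - \<rho>)"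
    if \<rho>: "\<rho> > c" and B: "B \<ge> 0" for \<rho> B
  proof -
    have "\<rho> + 1 + Re a > 1" using \<rho> by (simp add: c_def)
    from em_sum_le[OF zero_less_one this, of B a] obtain C where C: "C > 0"
       "\<And>s n N. norm s \<le> B \<Longrightarrow> \<rho> + 1 + Re a \<le> Re a + Re s + real 1 \<Longrightarrow> 0 \<le> n \<Longrightarrow> n \<le> real N \<Longrightarrow> 1 \<le> N \<Longrightarrow>
       norm (em_sum 1 a s n N) \<le> C * real N powr (1-(\<rho> + 1 + Re a))" by blast
    from phi_le[OF B, of a] obtain D where D: "D > 0" "\<And>s n x. norm s \<le> B \<Longrightarrow> 0 \<le> n \<Longrightarrow> n \<le> x \<Longrightarrow> 1 \<le> x \<Longrightarrow>
      norm (phi a s n x) \<le> D * x powr (- Re a - Re s)" by blast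
    show ?thesis
    proof (intro exI[of _ "C + \<bar>em_coeff 0\<bar> * D"] allI impI)
      fix s :: complex and j assume s: "norm s \<le> B" "\<rho> \<le> Re s"
      have M: "M j \<ge> 1" using assms(1)[of j] by simp
      have "norm (phi a s (real (Suc j)) (real (M j))) \<le> D * real (M j) powr (- Re a - Re s)"
        using s assms(1)[of j] by (intro D(2)) auto
      also have "\<dots> \<le> D * real (M j) powr (- Re a - \<rho>)"
        using s D(1) M by (intro mult_left_mono powr_mono) auto
      finally have *: "norm (phi a s (real (Suc j)) (real (M j))) \<le> D * real (M j) powr (- Re a - \<rho>)" .
      have "norm (em_sum 1 a s (real (Suc j)) (M j)) \<le> C * real (M j) powr (1-(\<rho> + 1 + Re a))"
        using s assms(1)[of j] M by (intro C(2)) auto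
      also have "1-(\<rho> + 1 + Re a) = - Re a - \<rho>" by simp
      finally have **: "norm (em_sum 1 a s (real (Suc j)) (M j)) \<le> C * real (M j) powr (- Re a - \<rho>)" .
      have "norm (dsum a s (real (Suc j)) (M j)) \<le> norm (em_sum 1 a s (real (Suc j)) (M j))
           + \<bar>em_coeff 0\<bar> * norm (phi a s (real (Suc j)) (real (M j)))"
        unfolding dsum_def by (rule order_trans[OF norm_triangle_ineq4]) simp
      also have "\<dots> \<le> C * real (M j) powr (- Re a - \<rho>) + \<bar>em_coeff 0\<bar> * (D * real (M j) powr (- Re a - \<rho>))"
        by (intro add_mono mult_left_mono * **) auto
      also have "\<dots> = (C + \<bar>em_coeff 0\<bar> * D) * real (M j) powr (- Re a - \<rho>)" by (simp add: algebra_simps)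
      also have "\<dots> \<le> (C + \<bar>em_coeff 0\<bar> * D) * real (Suc j) powr (- Re a - \<rho>)"
        using C(1) D(1) \<rho> assms(1)[of j] by (intro mult_left_mono powr_mono2') (auto simp: c_def)
      finally show "norm (dsum a s (real (Suc j)) (M j)) \<le> (C + \<bar>em_coeff 0\<bar> * D) * real (Suc j) powr (- Re a - \<rho>)" .
    qed
  qed
  have 3: "- Re a - c - Re s2 \<le> -1" by (auto simp: c_def max_def)
  show ?A by (rule weighted_series(1)[OF 1 2 3])
  show ?B if "Re s > c" by (rule weighted_series(2)[OF 1 2 3 that])
qed

definition AV2_main :: "complex \<Rightarrow> complex \<Rightarrow> nat \<Rightarrow> complex \<Rightarrow> complex" where
  "AV2_main s1 s2 X s = (\<Sum>j<X. of_nat (Suc j) powr (-s2) * (\<Sum>m\<in>{Suc j<..X}. phi s1 s (real (Suc j)) (real m)))"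

text \<open>The inner sum for n is cut at X if n \<le> X and at n otherwise. The integrals of the
  second kind all scale to the same one and add up to the product with \<open>zeta_tail\<close>;
  \<open>max X (Suc j)\<close> is the common form of both cutoffs.\<close>

definition AV2_rest :: "complex \<Rightarrow> complex \<Rightarrow> nat \<Rightarrow> complex \<Rightarrow> complex" where
  "AV2_rest s1 s2 X s = (\<Sum>j<X. of_nat (Suc j) powr (-s2) * tail_ext s1 s (real (Suc j)) X)
     + tail_ext s1 s 1 1 * zeta_tail X (s1 + s2 + s - 1)
     + (\<Sum>j. of_nat (Suc j) powr (-s2) * dsum s1 s (real (Suc j)) (max X (Suc j)))"

lemma AV2_series_eq_main_rest:
  assumes s: "Re s1 + Re s > 1" "Re s1 + Re s2 + Re s > 2" and X: "1 \<le> X"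
  shows "AV2_series s1 s2 s = AV2_main s1 s2 X s + AV2_rest s1 s2 X s"
proof -
  define M where "M j = max X (Suc j)" for j
  have M: "M j \<ge> Suc j" for j by (simp add: M_def)
  define A where "A j = of_nat (Suc j) powr (-s2) * (\<Sum>m\<in>{Suc j<..X}. phi s1 s (real (Suc j)) (real m))" for j
  define I where "I j = of_nat (Suc j) powr (-s2) * tail_int s1 s (real (Suc j)) (M j)" for j
  define D where "D j = of_nat (Suc j) powr (-s2) * dsum s1 s (real (Suc j)) (M j)" for j
  have inner: "(\<Sum>i. phi s1 s (real (Suc j)) (real (Suc j + i) + 1)) =
     (\<Sum>m\<in>{Suc j<..X}. phi s1 s (real (Suc j)) (real m)) + (tail_int s1 s (real (Suc j)) (M j) + dsum s1 s (real (Suc j)) (M j))" for j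
  proof -
    define f where "f = (\<lambda>m. phi s1 s (real (Suc j)) (real m))"
    \<comment> \<open>The number of terms split off from the series: X - n for n \<le> X, and none
      for larger n, where the set \<open>{Suc j<..X}\<close> is empty.\<close>
    define k where "k = M j - Suc j"
    have "(\<lambda>i. f (Suc (M j + i))) sums (tail_int s1 s (real (Suc j)) (M j) + dsum s1 s (real (Suc j)) (M j))"
      using sums_tail_int_dsum[of s1 s "real (Suc j)" "M j"] s M[of j] by (simp add: f_def add_ac)
    then have "(\<lambda>i. f (Suc (Suc j + (i + k)))) sums (tail_int s1 s (real (Suc j)) (M j) + dsum s1 s (real (Suc j)) (M j))"
      using M[of j] by (simp add: k_def add_ac)
    then have "(\<lambda>i. f (Suc (Suc j + i))) sums (tail_int s1 s (real (Suc j)) (M j) + dsum s1 s (real (Suc j)) (M j)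
         + (\<Sum>i<k. f (Suc (Suc j + i))))"
      by (subst (asm) sums_iff_shift[of "\<lambda>i. f (Suc (Suc j + i))" k])
    moreover have "(\<Sum>i<k. f (Suc (Suc j + i))) = (\<Sum>m\<in>{Suc j<..X}. f m)"
      by (rule sum.reindex_bij_witness[of _ "\<lambda>m. m - Suc (Suc j)" "\<lambda>i. Suc (Suc j + i)"]) (auto simp: k_def M_def max_def split: if_splits)
    ultimately show ?thesis by (simp add: sums_iff f_def add_ac)
  qed
  have c: "Re s > max (- Re s1) (1 - Re s1 - Re s2)" using s by auto
  have sD: "D sums (\<Sum>j. D j)"
    using dsum_series(2)[of M s1 s2 s, OF M c] unfolding D_def by (intro summable_sums) (rule summable_norm_cancel)
  have sA: "A sums (\<Sum>j<X. A j)" by (rule sums_finite) (auto simp: A_def)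
  have "(\<lambda>i. tail_int s1 s 1 1 * of_nat (Suc (X + i)) powr (-(s1 + s2 + s - 1))) sums (tail_int s1 s 1 1 * zeta_tail X (s1 + s2 + s - 1))"
    using s X by (intro sums_mult zeta_tail_sums) auto
  also have "(\<lambda>i. tail_int s1 s 1 1 * of_nat (Suc (X + i)) powr (-(s1 + s2 + s - 1))) = (\<lambda>i. I (i + X))"
  proof
    fix i
    define n where "n = Suc (X + i)"
    have n: "n \<ge> 1" by (simp add: n_def)
    have "I (i + X) = of_nat n powr (-s2) * tail_int s1 s (real n) n"
      unfolding I_def M_def n_def by (simp add: add_ac max_def)
    also have "\<dots> = tail_int s1 s 1 1 * (of_nat n powr (-s2) * of_nat n powr (1 - s1 - s))"
      using tail_int_scale[of s1 s n] s n by simp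
    also have "of_nat n powr (-s2) * of_nat n powr (1 - s1 - s) = of_nat n powr (-(s1 + s2 + s - 1))"
      by (simp add: powr_add[symmetric] algebra_simps)
    finally show "tail_int s1 s 1 1 * of_nat (Suc (X + i)) powr (-(s1 + s2 + s - 1)) = I (i + X)" by (simp add: n_def)
  qed
  finally have sI: "I sums (tail_int s1 s 1 1 * zeta_tail X (s1 + s2 + s - 1) + (\<Sum>j<X. I j))" by (subst (asm) sums_iff_shift)
  have "(\<lambda>j. A j + (I j + D j)) sums ((\<Sum>j<X. A j) + ((tail_int s1 s 1 1 * zeta_tail X (s1 + s2 + s - 1) + (\<Sum>j<X. I j)) + (\<Sum>j. D j)))"
    by (intro sums_add sA sI sD)
  also have "(\<lambda>j. A j + (I j + D j)) = (\<lambda>j. of_nat (Suc j) powr (-s2) * (\<Sum>i. phi s1 s (real (Suc j)) (real (Suc j + i) + 1)))"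
    unfolding inner A_def I_def D_def by (simp add: distrib_left)
  finally have "AV2_series s1 s2 s = (\<Sum>j<X. A j) + ((tail_int s1 s 1 1 * zeta_tail X (s1 + s2 + s - 1) + (\<Sum>j<X. I j)) + (\<Sum>j. D j))"
    using AV2_series_sums[OF s] sums_unique2 by blast
  moreover have "tail_ext s1 s 1 1 = tail_int s1 s 1 1" using tail_ext_eq_tail_int[of s1 s 1 1] s by simp
  moreover have "(\<Sum>j<X. I j) = (\<Sum>j<X. of_nat (Suc j) powr (-s2) * tail_ext s1 s (real (Suc j)) X)"
  proof (intro sum.cong refl)
    fix j assume "j \<in> {..<X}"
    then have "M j = X" "real (Suc j) \<le> real X" by (auto simp: M_def)
    then show "I j = of_nat (Suc j) powr (-s2) * tail_ext s1 s (real (Suc j)) X"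
      using tail_ext_eq_tail_int[of s1 s "real (Suc j)" X] s X unfolding I_def by simp
  qed
  ultimately show ?thesis by (simp add: AV2_main_def AV2_rest_def A_def D_def M_def)
qed

text \<open>Every part of \<open>AV2_rest\<close> has been given a form that is holomorphic in this
  half-plane off the singular set, so the identity extends from the region of absolute convergence.
  The half-plane contains the line Re s = sigma3 of the theorem.\<close>

lemma zeta_AV2_eq_main_rest:
  assumes "Re s > max (- Re s1) (1 - Re s1 - Re s2)" "s \<notin> AV2_sing s1 s2" "1 \<le> X"
  shows "zeta_AV2 s1 s2 s = AV2_main s1 s2 X s + AV2_rest s1 s2 X s"
proof -
  define c where "c = max (- Re s1) (1 - Re s1 - Re s2)"
  define U where "U = {s. Re s > c} - AV2_sing s1 s2"
  have U1: "1 - s1 \<notin> U" unfolding U_def AV2_sing_def by (auto intro: exI[of _ 0])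
  have U2: "s1 + s2 + s \<noteq> 2" if "s \<in> U" for s
    using that unfolding U_def AV2_sing_def by (auto dest!: spec[of _ 0])
  have Uic: "(\<lambda>s. tail_ext s1 s n N) holomorphic_on U" if "0 \<le> n" "n \<le> real N" "1 \<le> N" for n N
    by (rule holomorphic_on_subset[OF tail_ext_holomorphic[OF that]]) (use U1 in \<open>auto simp: U_def c_def\<close>)
  have "zeta_tail X \<circ> (\<lambda>s. s1 + s2 + s - 1) holomorphic_on U"
  proof (rule holomorphic_on_compose_gen[OF _ zeta_tail_holomorphic[OF assms(3)]])
    show "(\<lambda>s. s1 + s2 + s - 1) ` U \<subseteq> {z. 0 < Re z} - {1}"
    proof safe
      fix s assume s: "s \<in> U"
      then show "0 < Re (s1 + s2 + s - 1)" by (auto simp: U_def c_def)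
      assume "s1 + s2 + s - 1 = 1"
      then have "s1 + s2 + s = 2" by (simp only: diff_eq_eq) simp
      with U2[OF s] show False by contradiction
    qed
  qed (intro holomorphic_intros)
  then have Uzt: "(\<lambda>s. zeta_tail X (s1 + s2 + s - 1)) holomorphic_on U" by (simp add: o_def)
  have Ud: "(\<lambda>s. \<Sum>j. of_nat (Suc j) powr (-s2) * dsum s1 s (real (Suc j)) (max X (Suc j))) holomorphic_on U"
    by (rule holomorphic_on_subset[OF dsum_series(1)]) (auto simp: U_def c_def)
  have Um: "AV2_main s1 s2 X holomorphic_on U"
    unfolding AV2_main_def[abs_def] using dphi_holomorphic[where k = 0]
    by (intro holomorphic_intros) auto
  show ?thesis
  proof (rule AV2_identity[where f = "zeta_AV2 s1 s2" and g = "\<lambda>s. AV2_main s1 s2 X s + AV2_rest s1 s2 X s" and c = c and ?s1.0 = s1 and ?s2.0 = s2])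
    show "(\<lambda>s. AV2_main s1 s2 X s + AV2_rest s1 s2 X s) holomorphic_on {s. Re s > c} - AV2_sing s1 s2"
      unfolding AV2_rest_def U_def[symmetric] using assms(3)
      by (intro holomorphic_intros Um Uic Uzt Ud) auto
    show "zeta_AV2 s1 s2 holomorphic_on {s. Re s > c} - AV2_sing s1 s2"
      by (rule holomorphic_on_subset[OF zeta_AV2_holomorphic]) auto
  qed (use assms in \<open>auto simp: c_def zeta_AV2_eq_series AV2_series_eq_main_rest\<close>)
qed

text \<open>The numerator is estimated by absolute values with a constant independent of Im s; only
  the denominator sees Im (a + s), and this is the whole saving.\<close>

lemma norm_tail_ext_le:
  assumes "Re a \<ge> 0" "Re s \<ge> 0" "Re a + Re s > 0" "0 \<le> n" "n \<le> real N" "1 \<le> N" "Im (a + s) \<noteq> 0"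
  shows "norm (tail_ext a s n N) \<le> (2 + norm a * ((Re a + Re s + 1) / (Re a + Re s))) * real N powr (1 - (Re a + Re s)) / \<bar>Im (a + s)\<bar>"
proof -
  define \<alpha> where "\<alpha> = Re a + Re s"
  have \<alpha>: "\<alpha> > 0" using assms by (simp add: \<alpha>_def)
  have N: "real N powr (1 - \<alpha>) = real N * real N powr (-\<alpha>)"
    using assms powr_add[of "real N" 1 "-\<alpha>"] by simp
  have "norm (phi a (s - 1) n (real N)) = norm (phi a s n (real N)) * (real N + n)"
    using assms by (subst phi_shift(1)) (auto simp: norm_mult simp del: of_real_add)
  also have "\<dots> \<le> real N powr (-\<alpha>) * (2 * real N)"
    unfolding \<alpha>_def using assms by (intro mult_mono norm_phi_le_powr) auto
  finally have 1: "norm (phi a (s - 1) n (real N)) \<le> 2 * real N powr (1 - \<alpha>)" by (simp add: N mult_ac)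
  have le: "norm (unit_int (a + 1) s n (real (N+i))) \<le> real (N+i) powr (-(\<alpha> + 1))" for i
  proof (rule unit_int_le)
    fix x assume x: "x \<in> {real (N+i)..real (N+i) + 1}"
    then have x0: "x \<ge> real (N+i)" "x > 0" using assms by auto
    have "norm (phi (a + 1) s n x) \<le> x powr (- (Re (a + 1) + Re s))"
      using x0 assms by (intro norm_phi_le_powr) auto
    also have "\<dots> = x powr (-(\<alpha> + 1))" by (simp add: \<alpha>_def algebra_simps)
    also have "\<dots> \<le> real (N+i) powr (-(\<alpha> + 1))" using x0 assms \<alpha> by (intro powr_mono2') auto
    finally show "norm (phi (a + 1) s n x) \<le> real (N+i) powr (-(\<alpha> + 1))" .
  qed (use assms in auto)
  have sm: "summable (\<lambda>i. real (N+i) powr (-(\<alpha> + 1)))" using \<alpha> by (intro summable_powr_shift) auto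
  have sm2: "summable (\<lambda>i. norm (unit_int (a + 1) s n (real (N+i))))"
    by (rule summable_comparison_test'[OF sm]) (use le in auto)
  have "norm (tail_int (a + 1) s n N) \<le> (\<Sum>i. real (N+i) powr (-(\<alpha> + 1)))"
    unfolding tail_int_def by (rule order_trans[OF summable_norm[OF sm2] suminf_le[OF le sm2 sm]])
  also have "\<dots> \<le> (\<alpha> + 1) / (\<alpha> + 1 - 1) * real N powr (1 - (\<alpha> + 1))"
    using assms \<alpha> by (intro suminf_powr_le) auto
  finally have 2: "norm (tail_int (a + 1) s n N) \<le> (\<alpha> + 1) / \<alpha> * real N powr (-\<alpha>)" by simp
  have "norm (phi a (s - 1) n (real N) - a * of_real n * tail_int (a + 1) s n N)
     \<le> norm (phi a (s - 1) n (real N)) + norm a * n * norm (tail_int (a + 1) s n N)"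
    by (rule order_trans[OF norm_triangle_ineq4]) (use assms in \<open>simp add: norm_mult\<close>)
  also have "\<dots> \<le> 2 * real N powr (1 - \<alpha>) + norm a * real N * ((\<alpha> + 1) / \<alpha> * real N powr (-\<alpha>))"
    using assms 1 2 \<alpha> by (intro add_mono mult_mono mult_left_mono) auto
  also have "\<dots> = (2 + norm a * ((\<alpha> + 1) / \<alpha>)) * real N powr (1 - \<alpha>)"
    by (simp add: N algebra_simps)
  finally have 3: "norm (phi a (s - 1) n (real N) - a * of_real n * tail_int (a + 1) s n N) \<le> (2 + norm a * ((\<alpha> + 1) / \<alpha>)) * real N powr (1 - \<alpha>)" .
  have 4: "\<bar>Im (a + s)\<bar> \<le> norm (a + s - 1)" using abs_Im_le_cmod[of "a + s - 1"] by simp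
  show ?thesis unfolding tail_ext_def norm_divide \<alpha>_def[symmetric]
    by (rule frac_le[OF order_trans[OF norm_ge_zero 3] 3 _ 4]) (use assms in auto)
qed

text \<open>Write n^(-q) = n^(-p) n^(p-q) and bound the last factor by X^(p-q); what remains is a
  convergent series. An arbitrarily small excess of p over 1 thus takes the place of
  logarithms.\<close>

lemma sum_weight_le:
  fixes p q :: real
  assumes "p > 1" "p \<ge> q"
  shows "(\<Sum>j<X. real (Suc j) powr (-q)) \<le> p / (p - 1) * real X powr (p - q)"
proof -
  have "(\<Sum>j<X. real (Suc j) powr (-q)) \<le> (\<Sum>j<X. real (1 + j) powr (-p) * real X powr (p - q))"
  proof (intro sum_mono)
    fix j assume "j \<in> {..<X}"
    then have "real (Suc j) powr (p - q) \<le> real X powr (p - q)" using assms by (intro powr_mono2) auto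
    then have "real (Suc j) powr (-p) * real (Suc j) powr (p - q) \<le> real (1 + j) powr (-p) * real X powr (p - q)"
      by (intro mult_mono) auto
    then show "real (Suc j) powr (-q) \<le> real (1 + j) powr (-p) * real X powr (p - q)"
      unfolding powr_add[symmetric] by simp
  qed
  also have "\<dots> = (\<Sum>j<X. real (1 + j) powr (-p)) * real X powr (p - q)" by (simp add: sum_distrib_right)
  also have "\<dots> \<le> (p / (p - 1) * real 1 powr (1 - p)) * real X powr (p - q)"
    using assms by (intro mult_right_mono order_trans[OF sum_le_suminf suminf_powr_le] summable_powr_shift) auto
  finally show ?thesis by simp
qed

lemma norm_zeta_tail_le:
  assumes "\<alpha> > 0"
  shows "\<exists>C>0. \<forall>z X. Re z = \<alpha> \<longrightarrow> 1 \<le> X \<longrightarrow> norm z \<le> real X \<longrightarrow> 1 \<le> norm (z - 1) \<longrightarrow>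
     norm (zeta_tail X z) \<le> C * real X powr (1 - \<alpha>)"
proof -
  from dsum_le[OF assms] obtain C where C: "C > 0" "\<And>a s n N. Re a \<ge> 0 \<Longrightarrow> Re s \<ge> 0 \<Longrightarrow> Re a + Re s = \<alpha> \<Longrightarrow> 0 \<le> n \<Longrightarrow> n \<le> real N \<Longrightarrow> 1 \<le> N \<Longrightarrow>
     norm a + norm s \<le> real N \<Longrightarrow> norm (dsum a s n N) \<le> C * real N powr (-\<alpha>)" by blast
  show ?thesis
  proof (intro exI[of _ "1 + C"] conjI allI impI)
    fix z :: complex and X :: nat assume *: "Re z = \<alpha>" "1 \<le> X" "norm z \<le> real X" "1 \<le> norm (z - 1)"
    have "norm (zeta_tail X z) \<le> real X powr (1 - \<alpha>) / norm (z - 1) + norm (dsum 0 z 0 X)"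
      unfolding zeta_tail_def by (rule order_trans[OF norm_triangle_ineq]) (use * in \<open>simp add: norm_divide norm_powr_real_powr\<close>)
    also have "\<dots> \<le> real X powr (1 - \<alpha>) / 1 + C * real X powr (-\<alpha>)"
      using * assms by (intro add_mono divide_left_mono C(2)) auto
    also have "C * real X powr (-\<alpha>) \<le> C * real X powr (1 - \<alpha>)"
      using * C(1) by (intro mult_left_mono powr_mono) auto
    finally show "norm (zeta_tail X z) \<le> (1 + C) * real X powr (1 - \<alpha>)" by (simp add: algebra_simps)
  qed (use C in auto)
qed

text \<open>The two parts with \<open>tail_ext\<close> gain 1/T from its denominator, the third is
  governed by \<open>dsum_le\<close>. The latter asks for a cutoff above |s1| + |s|, and as |s| may
  come close to 2 T, this is the reason for 3 T \<le> X.\<close>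

lemma AV2_rest_bound:
  fixes s1 s2 :: complex and \<sigma>3 p \<gamma> :: real
  assumes "Re s1 \<ge> 0" "Im s1 \<ge> 0" "\<sigma>3 > 0" and p: "p > 1" "p \<ge> Re s2"
    and \<gamma>: "\<gamma> = Re s1 + Re s2 + \<sigma>3 - p" "\<gamma> > 0"
  shows "\<exists>C>0. \<exists>T0\<ge>1. \<forall>T\<ge>T0. \<forall>t\<in>{T..2*T}. \<forall>X. 3 * T \<le> real X \<longrightarrow> real X \<le> 4 * T \<longrightarrow>
     norm (AV2_rest s1 s2 X (Complex \<sigma>3 t)) \<le> C * T powr (-\<gamma>)"
proof -
  define \<alpha> where "\<alpha> = Re s1 + \<sigma>3"
  define \<beta> where "\<beta> = \<alpha> + Re s2"
  have \<alpha>: "\<alpha> > 0" using assms by (simp add: \<alpha>_def)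
  have \<gamma>': "\<gamma> = \<beta> - p" "\<gamma> = \<alpha> - (p - Re s2)" using \<gamma> by (auto simp: \<beta>_def \<alpha>_def)
  have \<beta>: "\<beta> > 1" "\<beta> - 1 > 0" "1 - \<beta> \<le> -\<gamma>" using \<gamma> \<gamma>' p by auto
  from dsum_le[OF \<alpha>] obtain C1 where C1: "C1 > 0" "\<And>a s n N. Re a \<ge> 0 \<Longrightarrow> Re s \<ge> 0 \<Longrightarrow> Re a + Re s = \<alpha> \<Longrightarrow> 0 \<le> n \<Longrightarrow> n \<le> real N \<Longrightarrow> 1 \<le> N \<Longrightarrow>
     norm a + norm s \<le> real N \<Longrightarrow> norm (dsum a s n N) \<le> C1 * real N powr (-\<alpha>)" by blast
  from norm_zeta_tail_le[OF \<beta>(2)] obtain C2 where C2: "C2 > 0" "\<And>z X. Re z = \<beta> - 1 \<Longrightarrow> 1 \<le> X \<Longrightarrow> norm z \<le> real X \<Longrightarrow> 1 \<le> norm (z - 1) \<Longrightarrow>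
     norm (zeta_tail X z) \<le> C2 * real X powr (1 - (\<beta> - 1))" by blast
  define C3 where "C3 = 2 + norm s1 * ((\<alpha> + 1) / \<alpha>)"
  have C3: "C3 > 0" using \<alpha> by (auto simp: C3_def intro!: add_pos_nonneg)
  define P where "P = p / (p - 1)"
  have P: "P > 0" using p by (simp add: P_def)
  define B where "B = \<beta> / (\<beta> - 1)"
  have B: "B > 0" using \<beta> by (simp add: B_def)
  \<comment> \<open>Summands in the order of the parts of \<open>AV2_rest\<close>. The factors 4
    come from X \<le> 4 T; C1 P belongs to n \<le> X and C1 B to n > X.\<close>
  define C where "C = 4 * C3 * P + 4 * C3 * C2 + (C1 * P + C1 * B)"
  \<comment> \<open>Large enough for |s1| + |s| and |s1 + s2 + s - 1| to stay below 3 T, and for Im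
    (s1 + s2 + s) to be at least 1, away from the pole of \<open>zeta_tail\<close>.\<close>
  define T0 where "T0 = 2 + norm s1 + norm s2 + \<sigma>3"
  show ?thesis
  proof (rule exI[of _ C], rule conjI, goal_cases)
    case 1 show ?case using C1 C2 C3 P B by (auto simp: C_def intro!: add_pos_pos)
  next
    case 2 show ?case
    proof (rule exI[of _ T0], intro conjI allI impI ballI)
      show "1 \<le> T0" using assms by (auto simp: T0_def)
      fix T t X assume T: "T0 \<le> T" and t: "t \<in> {T..2*T}" and X: "3 * T \<le> real X" "real X \<le> 4 * T"
      define s where "s = Complex \<sigma>3 t"
      have T1: "T \<ge> 1" using T assms norm_ge_zero[of s1] norm_ge_zero[of s2] unfolding T0_def by linarith
      have X1: "real X \<ge> 1" "1 \<le> X" using X T1 by linarith+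
      have XT: "real X powr (-\<gamma>) \<le> T powr (-\<gamma>)" using X T1 \<gamma> by (intro powr_mono2') auto
      have ns: "norm s \<le> \<sigma>3 + 2 * T" using cmod_le[of s] t T1 assms by (auto simp: s_def)
      have Im: "\<bar>Im (s1 + s)\<bar> \<ge> T" "Im (s1 + s) \<noteq> 0" using assms t T1 by (auto simp: s_def)
      have Re: "Re s1 + Re s = \<alpha>" "Re s \<ge> 0" using assms by (auto simp: s_def \<alpha>_def)
      have tail_ext: "norm (tail_ext s1 s n N) \<le> C3 * real N powr (1 - \<alpha>) / T" if "0 \<le> n" "n \<le> real N" "1 \<le> N" for n N
      proof -
        have "norm (tail_ext s1 s n N) \<le> C3 * real N powr (1 - \<alpha>) / \<bar>Im (s1 + s)\<bar>"
          using norm_tail_ext_le[OF assms(1) Re(2) _ that Im(2)] \<alpha> unfolding Re(1) C3_def by simp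
        also have "\<dots> \<le> C3 * real N powr (1 - \<alpha>) / T" using Im(1) T1 C3 by (intro divide_left_mono) auto
        finally show ?thesis .
      qed
      have X4: "real X * real X powr (-\<gamma>) / T \<le> 4 * T powr (-\<gamma>)"
      proof -
        have "real X * real X powr (-\<gamma>) \<le> 4 * T * T powr (-\<gamma>)" using X XT T1 by (intro mult_mono) auto
        then show ?thesis using T1 by (simp add: pos_divide_le_eq mult_ac)
      qed
      have wt: "norm (complex_of_nat (Suc j) powr (-s2)) = real (Suc j) powr (- Re s2)" for j
        by (simp add: norm_powr_real_powr)
      have 1: "norm (\<Sum>j<X. of_nat (Suc j) powr (-s2) * tail_ext s1 s (real (Suc j)) X) \<le> 4 * C3 * P * T powr (-\<gamma>)"
      proof -
        have "norm (\<Sum>j<X. of_nat (Suc j) powr (-s2) * tail_ext s1 s (real (Suc j)) X)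
           \<le> (\<Sum>j<X. real (Suc j) powr (- Re s2) * (C3 * real X powr (1 - \<alpha>) / T))"
        proof (intro sum_norm_le)
          fix j assume "j \<in> {..<X}"
          then have "norm (tail_ext s1 s (real (Suc j)) X) \<le> C3 * real X powr (1 - \<alpha>) / T" using X1 by (intro tail_ext) auto
          then show "norm (of_nat (Suc j) powr (-s2) * tail_ext s1 s (real (Suc j)) X)
              \<le> real (Suc j) powr (- Re s2) * (C3 * real X powr (1 - \<alpha>) / T)"
            unfolding norm_mult wt by (rule mult_left_mono) simp
        qed
        also have "\<dots> = (\<Sum>j<X. real (Suc j) powr (- Re s2)) * (C3 * real X powr (1 - \<alpha>) / T)"
          by (simp only: sum_distrib_right)
        also have "\<dots> \<le> (P * real X powr (p - Re s2)) * (C3 * real X powr (1 - \<alpha>) / T)"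
          unfolding P_def using C3 T1 p by (intro mult_right_mono sum_weight_le) auto
        also have "\<dots> = C3 * P * (real X powr (p - Re s2) * real X powr (1 - \<alpha>)) / T" by simp
        also have "real X powr (p - Re s2) * real X powr (1 - \<alpha>) = real X powr (1 + (-\<gamma>))"
          unfolding powr_add[symmetric] \<gamma>'(2) by (simp add: algebra_simps)
        also have "\<dots> = real X * real X powr (-\<gamma>)" using X1 by (simp only: powr_add powr_one)
        also have "C3 * P * (real X * real X powr (-\<gamma>)) / T = C3 * P * (real X * real X powr (-\<gamma>) / T)" by simp
        also have "\<dots> \<le> C3 * P * (4 * T powr (-\<gamma>))" using C3 P by (intro mult_left_mono X4) auto
        finally show ?thesis by simp
      qed
      have 2: "norm (tail_ext s1 s 1 1 * zeta_tail X (s1 + s2 + s - 1)) \<le> 4 * C3 * C2 * T powr (-\<gamma>)"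
      proof -
        have nz: "norm (s1 + s2 + s - 1) \<le> real X"
        proof -
          have "norm (s1 + s2 + s - 1) \<le> norm s1 + norm s2 + norm s + 1"
            using norm_triangle_ineq4[of "s1 + s2 + s" 1] norm_triangle_ineq[of "s1 + s2" s] norm_triangle_ineq[of s1 s2] by simp
          then show ?thesis using ns X T unfolding T0_def by linarith
        qed
        have "T \<le> t" using t by simp
        then have "Im s1 + Im s2 + t \<ge> 1"
          using abs_Im_le_cmod[of s2] norm_ge_zero[of s1] T assms(2,3) unfolding T0_def by linarith
        then have "Im (s1 + s2 + s - 1 - 1) \<ge> 1" by (simp add: s_def)
        then have "norm (s1 + s2 + s - 1 - 1) \<ge> 1" using abs_Im_le_cmod[of "s1 + s2 + s - 1 - 1"] by linarith
        then have "norm (zeta_tail X (s1 + s2 + s - 1)) \<le> C2 * real X powr (1 - (\<beta> - 1))"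
          using nz X1 Re by (intro C2(2)) (auto simp: \<beta>_def)
        then have "norm (tail_ext s1 s 1 1 * zeta_tail X (s1 + s2 + s - 1)) \<le> (C3 * real 1 powr (1 - \<alpha>) / T) * (C2 * real X powr (1 - (\<beta> - 1)))"
          unfolding norm_mult using tail_ext[of 1 1] C3 T1 by (intro mult_mono) auto
        also have "\<dots> = C3 * C2 * (real X powr (1 + (1 - \<beta>)) / T)" by simp
        also have "real X powr (1 + (1 - \<beta>)) = real X * real X powr (1 - \<beta>)" using X1 by (simp only: powr_add powr_one)
        also have "real X * real X powr (1 - \<beta>) / T \<le> real X * real X powr (-\<gamma>) / T"
          using X1 T1 \<beta> by (intro divide_right_mono mult_left_mono powr_mono) auto
        also note X4
        finally show ?thesis using C2 C3 by simp
      qed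
      have 3: "norm (\<Sum>j. of_nat (Suc j) powr (-s2) * dsum s1 s (real (Suc j)) (max X (Suc j))) \<le> (C1 * P + C1 * B) * T powr (-\<gamma>)"
      proof -
        define f where "f j = of_nat (Suc j) powr (-s2) * dsum s1 s (real (Suc j)) (max X (Suc j))" for j
        have f: "norm (f j) \<le> real (Suc j) powr (- Re s2) * (C1 * real (max X (Suc j)) powr (-\<alpha>))" for j
          unfolding f_def norm_mult wt
        proof (intro mult_left_mono C1(2))
          have "norm s1 + norm s \<le> real X" using ns X T norm_ge_zero[of s2] unfolding T0_def by linarith
          then show "norm s1 + norm s \<le> real (max X (Suc j))" by simp
        qed (use assms Re X1 in auto)
        \<comment> \<open>For n > X the cutoff is n itself, so weight and bound combine to
          n^(-\<beta>), which is summable because \<beta> > 1.\<close>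
        have tail: "norm (f (j + X)) \<le> C1 * real (Suc X + j) powr (-\<beta>)" for j
        proof -
          have "max X (Suc (j + X)) = Suc (j + X)" by simp
          then have "norm (f (j + X)) \<le> real (Suc (j + X)) powr (- Re s2) * (C1 * real (Suc (j + X)) powr (-\<alpha>))"
            using f[of "j + X"] by simp
          also have "\<dots> = C1 * (real (Suc (j + X)) powr (- Re s2) * real (Suc (j + X)) powr (-\<alpha>))" by simp
          also have "real (Suc (j + X)) powr (- Re s2) * real (Suc (j + X)) powr (-\<alpha>) = real (Suc X + j) powr (-\<beta>)"
            unfolding powr_add[symmetric] \<beta>_def by (simp add: algebra_simps)
          finally show ?thesis .
        qed
        have sm: "summable (\<lambda>j. C1 * real (Suc X + j) powr (-\<beta>))" using \<beta> by (intro summable_mult summable_powr_shift)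
        have sm2: "summable (\<lambda>j. norm (f (j + X)))" by (rule summable_comparison_test'[OF sm]) (use tail in auto)
        have "summable f" using summable_norm_cancel[OF sm2] by (simp only: summable_iff_shift)
        then have "(\<Sum>j. f j) = (\<Sum>j. f (j + X)) + (\<Sum>j<X. f j)" by (rule suminf_split_initial_segment)
        also have "norm \<dots> \<le> norm (\<Sum>j. f (j + X)) + norm (\<Sum>j<X. f j)" by (rule norm_triangle_ineq)
        also have "norm (\<Sum>j. f (j + X)) \<le> (\<Sum>j. C1 * real (Suc X + j) powr (-\<beta>))"
          by (rule order_trans[OF summable_norm[OF sm2] suminf_le[OF tail sm2 sm]])
        also have "\<dots> = C1 * (\<Sum>j. real (Suc X + j) powr (-\<beta>))" using \<beta> by (intro suminf_mult summable_powr_shift)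
        also have "\<dots> \<le> C1 * (B * real (Suc X) powr (1 - \<beta>))"
          unfolding B_def using C1 \<beta> by (intro mult_left_mono suminf_powr_le) auto
        also have "real (Suc X) powr (1 - \<beta>) \<le> real X powr (1 - \<beta>)" using X1 \<beta> by (intro powr_mono2') auto
        also have "\<dots> \<le> real X powr (-\<gamma>)" using X1 \<beta> by (intro powr_mono) auto
        also note XT
        also have "norm (\<Sum>j<X. f j) \<le> (\<Sum>j<X. real (Suc j) powr (- Re s2) * (C1 * real X powr (-\<alpha>)))"
        proof (intro sum_norm_le)
          fix j assume "j \<in> {..<X}"
          then have "max X (Suc j) = X" by auto
          then show "norm (f j) \<le> real (Suc j) powr (- Re s2) * (C1 * real X powr (-\<alpha>))" using f[of j] by simp
        qed
        also have "\<dots> = (\<Sum>j<X. real (Suc j) powr (- Re s2)) * (C1 * real X powr (-\<alpha>))" by (simp add: sum_distrib_right)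
        also have "\<dots> \<le> (P * real X powr (p - Re s2)) * (C1 * real X powr (-\<alpha>))"
          unfolding P_def using C1 p by (intro mult_right_mono sum_weight_le) auto
        also have "\<dots> = C1 * P * (real X powr (p - Re s2) * real X powr (-\<alpha>))" by simp
        also have "real X powr (p - Re s2) * real X powr (-\<alpha>) = real X powr (-\<gamma>)"
          unfolding powr_add[symmetric] \<gamma>'(2) by (simp add: algebra_simps)
        also note XT
        finally show ?thesis using C1 B P unfolding f_def by (simp add: algebra_simps)
      qed
      have "norm (AV2_rest s1 s2 X s) \<le> norm (\<Sum>j<X. of_nat (Suc j) powr (-s2) * tail_ext s1 s (real (Suc j)) X)
         + norm (tail_ext s1 s 1 1 * zeta_tail X (s1 + s2 + s - 1))
         + norm (\<Sum>j. of_nat (Suc j) powr (-s2) * dsum s1 s (real (Suc j)) (max X (Suc j)))"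
        unfolding AV2_rest_def by (intro order_trans[OF norm_triangle_ineq] add_right_mono norm_triangle_ineq)
      also have "\<dots> \<le> 4 * C3 * P * T powr (-\<gamma>) + 4 * C3 * C2 * T powr (-\<gamma>) + (C1 * P + C1 * B) * T powr (-\<gamma>)"
        by (intro add_mono 1 2 3)
      finally show "norm (AV2_rest s1 s2 X (Complex \<sigma>3 t)) \<le> C * T powr (-\<gamma>)"
        unfolding s_def[symmetric] C_def by (simp add: algebra_simps)
    qed
  qed
qed

section \<open>Mean squares of Dirichlet polynomials\<close>

lemma sum_inverse_le:
  assumes "Q \<ge> 1"
  shows "(\<Sum>d=1..Q. 1 / real d) \<le> 1 + ln (real Q)"
  using assms
proof (induction Q rule: dec_induct)
  case (step Q)
  have "ln (real Q / real (Suc Q)) \<le> real Q / real (Suc Q) - 1" using step by (intro ln_le_minus_one) auto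
  then have "1 / real (Suc Q) \<le> ln (real (Suc Q)) - ln (real Q)"
    using step by (simp add: ln_div field_simps)
  then show ?case using step by simp
qed simp

lemma sum_inverse_dist_le:
  assumes "j \<in> {1..Q}"
  shows "(\<Sum>k\<in>{1..Q} - {j}. 1 / \<bar>real k - real j\<bar>) \<le> 2 * (1 + ln (real Q))"
proof -
  have eq: "{1..Q} - {j} = {1..<j} \<union> {j<..Q}" using assms by auto
  have "(\<Sum>k\<in>{1..Q} - {j}. 1 / \<bar>real k - real j\<bar>)
     = (\<Sum>k\<in>{1..<j}. 1 / \<bar>real k - real j\<bar>) + (\<Sum>k\<in>{j<..Q}. 1 / \<bar>real k - real j\<bar>)"
    unfolding eq by (rule sum.union_disjoint) auto
  also have "(\<Sum>k\<in>{1..<j}. 1 / \<bar>real k - real j\<bar>) = (\<Sum>d\<in>{1..<j}. 1 / real d)"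
    by (rule sum.reindex_bij_witness[of _ "\<lambda>d. j - d" "\<lambda>k. j - k"]) (auto simp: of_nat_diff)
  also have "(\<Sum>k\<in>{j<..Q}. 1 / \<bar>real k - real j\<bar>) = (\<Sum>d\<in>{1..Q-j}. 1 / real d)"
    by (rule sum.reindex_bij_witness[of _ "\<lambda>d. j + d" "\<lambda>k. k - j"]) (auto simp: of_nat_diff)
  also have "(\<Sum>d\<in>{1..<j}. 1 / real d) \<le> (\<Sum>d=1..Q. 1 / real d)" using assms by (intro sum_mono2) auto
  also have "(\<Sum>d\<in>{1..Q-j}. 1 / real d) \<le> (\<Sum>d=1..Q. 1 / real d)" using assms by (intro sum_mono2) auto
  also have "(\<Sum>d=1..Q. 1 / real d) \<le> 1 + ln (real Q)" using assms by (intro sum_inverse_le) auto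
  finally show ?thesis by simp
qed

lemma ln_ratio_ge:
  assumes "0 < a" "a < (b::real)"
  shows "(b - a) / b \<le> ln b - ln a"
  using ln_le_minus_one[of "a / b"] assms by (simp add: ln_div field_simps)

text \<open>For the two indices u < v one has 1 / (ln v - ln u) \<le> v / (v - u) = 1 + u / (v - u).
  Since the smaller index multiplies the singular part, and 0 \<le> \<gamma> \<le> 1, that part has
  a majorant with a power of \<open>j\<close> alone, whichever index is larger.\<close>

lemma offdiag_term_le:
  fixes j k :: nat and \<gamma> :: real
  assumes "j \<ge> 1" "k \<ge> 1" "j \<noteq> k" "0 \<le> \<gamma>" "\<gamma> \<le> 1"
  shows "real j powr (-\<gamma>) * real k powr (-\<gamma>) / \<bar>ln (real k) - ln (real j)\<bar>
     \<le> real j powr (-\<gamma>) * real k powr (-\<gamma>) + real j powr (1 - 2 * \<gamma>) * (1 / \<bar>real k - real j\<bar>)"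
proof -
  define u where "u = real (min j k)"
  define v where "v = real (max j k)"
  have uv: "0 < u" "u < v" using assms by (auto simp: u_def v_def)
  have abs: "\<bar>ln (real k) - ln (real j)\<bar> = ln v - ln u" "\<bar>real k - real j\<bar> = v - u"
    using assms by (auto simp: u_def v_def min_def max_def)
  have "1 / (ln v - ln u) \<le> v / (v - u)"
    using frac_le[OF zero_le_one order_refl _ ln_ratio_ge[OF uv]] uv by simp
  also have "\<dots> = 1 + u * (1 / (v - u))" using uv by (simp add: field_simps)
  finally have 1: "1 / \<bar>ln (real k) - ln (real j)\<bar> \<le> 1 + u * (1 / \<bar>real k - real j\<bar>)" unfolding abs .
  have 2: "real j powr (-\<gamma>) * real k powr (-\<gamma>) * u \<le> real j powr (1 - 2 * \<gamma>)"
  proof (cases "j < k")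
    case True
    have "real j powr (-\<gamma>) * real k powr (-\<gamma>) * u \<le> real j powr (-\<gamma>) * real j powr (-\<gamma>) * real j"
      using True assms by (intro mult_mono powr_mono2') (auto simp: u_def)
    also have "\<dots> = real j powr (-\<gamma>) * real j powr (-\<gamma>) * real j powr 1" by simp
    also have "\<dots> = real j powr (1 - 2 * \<gamma>)" unfolding powr_add[symmetric] by (simp add: algebra_simps)
    finally show ?thesis .
  next
    case False
    then have "u = real k" by (simp add: u_def)
    then have "real j powr (-\<gamma>) * real k powr (-\<gamma>) * u = real j powr (-\<gamma>) * (real k powr (-\<gamma>) * real k powr 1)"
      using assms by simp
    also have "\<dots> = real j powr (-\<gamma>) * real k powr (1 - \<gamma>)" unfolding powr_add[symmetric] by (simp add: algebra_simps)
    also have "\<dots> \<le> real j powr (-\<gamma>) * real j powr (1 - \<gamma>)"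
      using False assms by (intro mult_left_mono powr_mono2) auto
    also have "\<dots> = real j powr (1 - 2 * \<gamma>)" unfolding powr_add[symmetric] by (simp add: algebra_simps)
    finally show ?thesis .
  qed
  have "real j powr (-\<gamma>) * real k powr (-\<gamma>) / \<bar>ln (real k) - ln (real j)\<bar>
     = real j powr (-\<gamma>) * real k powr (-\<gamma>) * (1 / \<bar>ln (real k) - ln (real j)\<bar>)" by simp
  also have "\<dots> \<le> real j powr (-\<gamma>) * real k powr (-\<gamma>) * (1 + u * (1 / \<bar>real k - real j\<bar>))"
    using 1 by (intro mult_left_mono) auto
  also have "\<dots> = real j powr (-\<gamma>) * real k powr (-\<gamma>) + (real j powr (-\<gamma>) * real k powr (-\<gamma>) * u) * (1 / \<bar>real k - real j\<bar>)"
    by (simp add: distrib_left)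
  also have "\<dots> \<le> real j powr (-\<gamma>) * real k powr (-\<gamma>) + real j powr (1 - 2 * \<gamma>) * (1 / \<bar>real k - real j\<bar>)"
    using 2 by (intro add_left_mono mult_right_mono) auto
  finally show ?thesis .
qed

text \<open>The regular part factors into two sums of k^(-\<gamma>). In the singular part the sum
  over k is harmonic, which is the source of the logarithm, and the sum over j has the exponent 2
  \<gamma> - 1, which lies between 0 and 1.\<close>

lemma offdiag_sum_le:
  fixes \<gamma> :: real
  assumes "1 / 2 < \<gamma>" "\<gamma> < 1" "Q \<ge> 1"
  shows "(\<Sum>j=1..Q. \<Sum>k\<in>{1..Q} - {j}. real j powr (-\<gamma>) * real k powr (-\<gamma>) / \<bar>ln (real k) - ln (real j)\<bar>)
    \<le> (1 / (1 - \<gamma>)\<^sup>2 + 1 / (1 - \<gamma>)) * real Q powr (2 - 2 * \<gamma>) * (1 + ln (real Q))"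
proof -
  have lnQ: "ln (real Q) \<ge> 0" using assms by simp
  have "(\<Sum>j=1..Q. \<Sum>k\<in>{1..Q} - {j}. real j powr (-\<gamma>) * real k powr (-\<gamma>) / \<bar>ln (real k) - ln (real j)\<bar>)
    \<le> (\<Sum>j=1..Q. \<Sum>k\<in>{1..Q} - {j}. real j powr (-\<gamma>) * real k powr (-\<gamma>) + real j powr (1 - 2 * \<gamma>) * (1 / \<bar>real k - real j\<bar>))"
    using assms by (intro sum_mono offdiag_term_le) auto
  also have "\<dots> = (\<Sum>j=1..Q. real j powr (-\<gamma>) * (\<Sum>k\<in>{1..Q} - {j}. real k powr (-\<gamma>)))
      + (\<Sum>j=1..Q. real j powr (1 - 2 * \<gamma>) * (\<Sum>k\<in>{1..Q} - {j}. 1 / \<bar>real k - real j\<bar>))"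
    by (simp only: sum.distrib sum_distrib_left)
  also have "(\<Sum>j=1..Q. real j powr (-\<gamma>) * (\<Sum>k\<in>{1..Q} - {j}. real k powr (-\<gamma>)))
      \<le> (\<Sum>j=1..Q. real j powr (-\<gamma>) * (real Q powr (1 - \<gamma>) / (1 - \<gamma>)))"
  proof (intro sum_mono mult_left_mono)
    fix j
    have "(\<Sum>k\<in>{1..Q} - {j}. real k powr (-\<gamma>)) \<le> (\<Sum>k=1..Q. real k powr (-\<gamma>))" by (intro sum_mono2) auto
    also have "\<dots> \<le> real Q powr (1 - \<gamma>) / (1 - \<gamma>)" using assms by (intro sum_powr_le) auto
    finally show "(\<Sum>k\<in>{1..Q} - {j}. real k powr (-\<gamma>)) \<le> real Q powr (1 - \<gamma>) / (1 - \<gamma>)" .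
  qed auto
  also have "\<dots> = (\<Sum>j=1..Q. real j powr (-\<gamma>)) * (real Q powr (1 - \<gamma>) / (1 - \<gamma>))" by (simp only: sum_distrib_right)
  also have "\<dots> \<le> real Q powr (1 - \<gamma>) / (1 - \<gamma>) * (real Q powr (1 - \<gamma>) / (1 - \<gamma>))"
    using assms by (intro mult_right_mono sum_powr_le) auto
  also have "\<dots> = (real Q powr (1 - \<gamma>) * real Q powr (1 - \<gamma>)) / (1 - \<gamma>)\<^sup>2" by (simp add: power2_eq_square)
  also have "real Q powr (1 - \<gamma>) * real Q powr (1 - \<gamma>) = real Q powr (2 - 2 * \<gamma>)"
    unfolding powr_add[symmetric] by (simp add: algebra_simps)
  also have "real Q powr (2 - 2 * \<gamma>) / (1 - \<gamma>)\<^sup>2 \<le> real Q powr (2 - 2 * \<gamma>) / (1 - \<gamma>)\<^sup>2 * (1 + ln (real Q))"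
    using lnQ mult_left_mono[of 1 "1 + ln (real Q)" "real Q powr (2 - 2 * \<gamma>) / (1 - \<gamma>)\<^sup>2"] by simp
  also have "(\<Sum>j=1..Q. real j powr (1 - 2 * \<gamma>) * (\<Sum>k\<in>{1..Q} - {j}. 1 / \<bar>real k - real j\<bar>))
      \<le> (\<Sum>j=1..Q. real j powr (-(2 * \<gamma> - 1)) * (2 * (1 + ln (real Q))))"
    by (intro sum_mono mult_mono sum_inverse_dist_le sum_nonneg) auto
  also have "\<dots> = (\<Sum>j=1..Q. real j powr (-(2 * \<gamma> - 1))) * (2 * (1 + ln (real Q)))" by (simp add: sum_distrib_right)
  also have "\<dots> \<le> (real Q powr (1 - (2 * \<gamma> - 1)) / (1 - (2 * \<gamma> - 1))) * (2 * (1 + ln (real Q)))"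
    using assms lnQ by (intro mult_right_mono sum_powr_le) auto
  also have "\<dots> = 1 / (1 - \<gamma>) * real Q powr (2 - 2 * \<gamma>) * (1 + ln (real Q))"
  proof -
    have "1 - (2 * \<gamma> - 1) = 2 * (1 - \<gamma>)" by simp
    then show ?thesis using assms by (simp only:) (simp add: field_simps)
  qed
  finally show ?thesis by (simp add: algebra_simps)
qed

text \<open>Diagonal products are constant in t and give the length of the interval; an oscillating
  product integrates to at most 2 divided by its frequency, whatever the length.\<close>

lemma dirichlet_poly_mean_square:
  fixes c :: "nat \<Rightarrow> complex" and T T' :: real and Q :: nat
  assumes "T \<le> T'"
  defines "D \<equiv> \<lambda>t. \<Sum>k=1..Q. c k * cis (- t * ln (real k))"
  shows "\<bar>integral {T..T'} (\<lambda>t. (norm (D t))\<^sup>2) - (T' - T) * (\<Sum>k=1..Q. (norm (c k))\<^sup>2)\<bar>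
     \<le> (\<Sum>j=1..Q. \<Sum>k\<in>{1..Q} - {j}. norm (c j) * norm (c k) * (2 / \<bar>ln (real k) - ln (real j)\<bar>))"
proof -
  define e where "e = (\<lambda>j k t. c j * cnj (c k) * cis (t * (ln (real k) - ln (real j))))"
  define I where "I = (\<lambda>j k. integral {T..T'} (e j k))"
  have eint: "e j k integrable_on {T..T'}" for j k
    unfolding e_def cis_conv_exp by (intro integrable_continuous_real continuous_intros)
  have sq: "complex_of_real ((norm (D t))\<^sup>2) = (\<Sum>j=1..Q. \<Sum>k=1..Q. e j k t)" for t
  proof -
    have "(c j * cis (- t * ln (real j))) * cnj (c k * cis (- t * ln (real k))) = e j k t" for j k
    proof -
      have "(c j * cis (- t * ln (real j))) * cnj (c k * cis (- t * ln (real k)))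
        = c j * cnj (c k) * (cis (- t * ln (real j)) * cis (t * ln (real k)))" by (simp add: cis_cnj)
      also have "cis (- t * ln (real j)) * cis (t * ln (real k)) = cis (t * (ln (real k) - ln (real j)))"
        unfolding cis_mult by (simp add: algebra_simps)
      finally show ?thesis by (simp add: e_def)
    qed
    then show ?thesis unfolding complex_norm_square D_def cnj_sum sum_product by simp
  qed
  have Iint: "integral {T..T'} (\<lambda>t. complex_of_real ((norm (D t))\<^sup>2)) = (\<Sum>j=1..Q. \<Sum>k=1..Q. I j k)"
    unfolding sq I_def using eint by (simp add: integral_sum integrable_sum)
  have "continuous_on {T..T'} D" unfolding D_def cis_conv_exp by (intro continuous_intros)
  then have Dint: "(\<lambda>t. (norm (D t))\<^sup>2) integrable_on {T..T'}" by (intro integrable_continuous_real continuous_intros)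
  have real: "integral {T..T'} (\<lambda>t. complex_of_real ((norm (D t))\<^sup>2)) = of_real (integral {T..T'} (\<lambda>t. (norm (D t))\<^sup>2))"
    using integral_linear[OF Dint, of "of_real :: real \<Rightarrow> complex"] bounded_linear_of_real by (simp add: o_def)
  have diag: "I j j = of_real ((T' - T) * (norm (c j))\<^sup>2)" for j
    using assms(1) by (simp add: I_def e_def complex_norm_square[symmetric] scaleR_conv_of_real del: of_real_power)
  have off: "norm (I j k) \<le> norm (c j) * norm (c k) * (2 / \<bar>ln (real k) - ln (real j)\<bar>)" if "j \<noteq> k" "j \<in> {1..Q}" "k \<in> {1..Q}" for j k
  proof -
    define \<theta> where "\<theta> = ln (real k) - ln (real j)"
    have \<theta>: "\<theta> \<noteq> 0" using that by (auto simp: \<theta>_def)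
    define F where "F = (\<lambda>t. c j * cnj (c k) * (cis (t * \<theta>) / (\<i> * of_real \<theta>)))"
    have "(e j k has_integral (F T' - F T)) {T..T'}"
    proof (rule fundamental_theorem_of_calculus[OF assms(1)])
      fix t
      define \<omega> where "\<omega> = \<i> * of_real \<theta>"
      have \<omega>: "\<omega> \<noteq> 0" using \<theta> by (simp add: \<omega>_def)
      have cis: "cis (t * \<theta>) = exp (of_real t * \<omega>)" for t by (simp add: cis_conv_exp \<omega>_def mult_ac)
      have "((\<lambda>z. c j * cnj (c k) * (exp (z * \<omega>) / \<omega>)) has_field_derivative
         c j * cnj (c k) * exp (of_real t * \<omega>)) (at (of_real t))"
        using \<omega> by (auto intro!: derivative_eq_intros)
      then have "((\<lambda>t. c j * cnj (c k) * (exp (of_real t * \<omega>) / \<omega>)) has_vector_derivative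
         c j * cnj (c k) * exp (of_real t * \<omega>)) (at t within {T..T'})"
        by (rule has_vector_derivative_real_field)
      then show "(F has_vector_derivative e j k t) (at t within {T..T'})"
        by (simp add: F_def e_def \<theta>_def[symmetric] cis \<omega>_def[symmetric])
    qed
    then have "I j k = F T' - F T" by (simp add: I_def integral_unique)
    also have "norm \<dots> \<le> norm (F T') + norm (F T)" by (rule norm_triangle_ineq4)
    also have "\<dots> = norm (c j) * norm (c k) * (2 / \<bar>\<theta>\<bar>)" by (simp add: F_def norm_mult norm_divide)
    finally show ?thesis unfolding \<theta>_def .
  qed
  have "(\<Sum>j=1..Q. \<Sum>k=1..Q. I j k) = (\<Sum>j=1..Q. I j j + (\<Sum>k\<in>{1..Q} - {j}. I j k))"
    by (intro sum.cong refl sum.remove) auto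
  also have "\<dots> = of_real ((T' - T) * (\<Sum>k=1..Q. (norm (c k))\<^sup>2)) + (\<Sum>j=1..Q. \<Sum>k\<in>{1..Q} - {j}. I j k)"
    by (simp add: sum.distrib diag sum_distrib_left)
  finally have fin: "(\<Sum>j=1..Q. \<Sum>k=1..Q. I j k) = of_real ((T' - T) * (\<Sum>k=1..Q. (norm (c k))\<^sup>2)) + (\<Sum>j=1..Q. \<Sum>k\<in>{1..Q} - {j}. I j k)" .
  have eq: "of_real (integral {T..T'} (\<lambda>t. (norm (D t))\<^sup>2)) - of_real ((T' - T) * (\<Sum>k=1..Q. (norm (c k))\<^sup>2))
     = (\<Sum>j=1..Q. \<Sum>k\<in>{1..Q} - {j}. I j k)" unfolding real[symmetric] Iint fin by simp
  have "\<bar>integral {T..T'} (\<lambda>t. (norm (D t))\<^sup>2) - (T' - T) * (\<Sum>k=1..Q. (norm (c k))\<^sup>2)\<bar>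
     = norm (complex_of_real (integral {T..T'} (\<lambda>t. (norm (D t))\<^sup>2) - (T' - T) * (\<Sum>k=1..Q. (norm (c k))\<^sup>2)))"
    by (simp only: norm_of_real)
  also have "\<dots> = norm (\<Sum>j=1..Q. \<Sum>k\<in>{1..Q} - {j}. I j k)" unfolding of_real_diff eq ..
  also have "\<dots> \<le> (\<Sum>j=1..Q. \<Sum>k\<in>{1..Q} - {j}. norm (c j) * norm (c k) * (2 / \<bar>ln (real k) - ln (real j)\<bar>))"
    by (intro sum_norm_le off) auto
  finally show ?thesis .
qed

lemma dirichlet_poly_mean_square_le:
  fixes c :: "nat \<Rightarrow> complex" and T T' \<gamma> C :: real
  assumes "T \<le> T'" "1 / 2 < \<gamma>" "\<gamma> < 1" "Q \<ge> 1" "C \<ge> 0"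
    and c: "\<And>k. k \<in> {1..Q} \<Longrightarrow> norm (c k) \<le> C * real k powr (-\<gamma>)"
  shows "\<bar>integral {T..T'} (\<lambda>t. (norm (\<Sum>k=1..Q. c k * cis (- t * ln (real k))))\<^sup>2) - (T' - T) * (\<Sum>k=1..Q. (norm (c k))\<^sup>2)\<bar>
     \<le> 2 * C\<^sup>2 * ((1 / (1 - \<gamma>)\<^sup>2 + 1 / (1 - \<gamma>)) * real Q powr (2 - 2 * \<gamma>) * (1 + ln (real Q)))"
proof -
  have "(\<Sum>j=1..Q. \<Sum>k\<in>{1..Q} - {j}. norm (c j) * norm (c k) * (2 / \<bar>ln (real k) - ln (real j)\<bar>))
    \<le> (\<Sum>j=1..Q. \<Sum>k\<in>{1..Q} - {j}. (C * real j powr (-\<gamma>)) * (C * real k powr (-\<gamma>)) * (2 / \<bar>ln (real k) - ln (real j)\<bar>))"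
    using c assms(5) by (intro sum_mono mult_right_mono mult_mono) auto
  also have "\<dots> = 2 * C\<^sup>2 * (\<Sum>j=1..Q. \<Sum>k\<in>{1..Q} - {j}. real j powr (-\<gamma>) * real k powr (-\<gamma>) / \<bar>ln (real k) - ln (real j)\<bar>)"
    by (simp add: sum_distrib_left power2_eq_square mult_ac)
  also have "\<dots> \<le> 2 * C\<^sup>2 * ((1 / (1 - \<gamma>)\<^sup>2 + 1 / (1 - \<gamma>)) * real Q powr (2 - 2 * \<gamma>) * (1 + ln (real Q)))"
    using assms by (intro mult_left_mono offdiag_sum_le) auto
  finally show ?thesis using dirichlet_poly_mean_square[OF assms(1), of c Q] by linarith
qed

section \<open>Coefficients of the double series as a Dirichlet series in s3\<close>

definition AV2_coeff :: "complex \<Rightarrow> complex \<Rightarrow> nat \<Rightarrow> complex" where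
  "AV2_coeff s1 s2 k = (\<Sum>m\<in>{m. real k / 2 < real m \<and> m \<le> k - 1}. of_nat m powr (-s1) * of_nat (k - m) powr (-s2))"

text \<open>The coefficient of k^(-s3) in \<open>AV2_main\<close>. Truncating m at X can make it
  differ from \<open>AV2_coeff\<close> only for k > X + 1.\<close>

definition AV2_tcoeff :: "complex \<Rightarrow> complex \<Rightarrow> nat \<Rightarrow> nat \<Rightarrow> complex" where
  "AV2_tcoeff s1 s2 X k = (\<Sum>m\<in>{m. real k / 2 < real m \<and> m \<le> min X (k - 1)}. of_nat m powr (-s1) * of_nat (k - m) powr (-s2))"

lemma AV2_tcoeff_eq: "k \<le> Suc X \<Longrightarrow> AV2_tcoeff s1 s2 X k = AV2_coeff s1 s2 k"
  unfolding AV2_tcoeff_def AV2_coeff_def by (rule sum.cong) auto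

text \<open>Since m > k/2 and Re s1 \<ge> 0, the factor m^(-s1) is at most (k/2)^(-Re s1) and leaves
  the sum; the rest is a sum of powers of n = k - m, to which \<open>sum_weight_le\<close> applies.
  Truncation only drops terms, so the bound is uniform in X.\<close>

lemma norm_AV2_tcoeff_le:
  assumes "Re s1 \<ge> 0" "p > 1" "p \<ge> Re s2" "k \<ge> 1"
  shows "norm (AV2_tcoeff s1 s2 X k) \<le> 2 powr Re s1 * (p / (p - 1)) * real k powr (p - Re s2 - Re s1)"
proof -
  define S where "S = {m. real k / 2 < real m \<and> m \<le> min X (k - 1)}"
  have S: "finite S" "\<And>m. m \<in> S \<Longrightarrow> m < k \<and> real k / 2 < real m \<and> m > 0"
    using assms by (auto simp: S_def intro: finite_subset[of _ "{..k}"])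
  have "norm (AV2_tcoeff s1 s2 X k) \<le> (\<Sum>m\<in>S. (real k / 2) powr (- Re s1) * real (k - m) powr (- Re s2))"
    unfolding AV2_tcoeff_def S_def[symmetric]
  proof (intro sum_norm_le)
    fix m assume "m \<in> S"
    from S(2)[OF this] show "norm (of_nat m powr (-s1) * of_nat (k - m) powr (-s2))
        \<le> (real k / 2) powr (- Re s1) * real (k - m) powr (- Re s2)"
      using assms by (auto simp: norm_mult norm_powr_real_powr intro!: mult_right_mono powr_mono2')
  qed
  also have "\<dots> = (real k / 2) powr (- Re s1) * (\<Sum>m\<in>S. real (k - m) powr (- Re s2))"
    by (simp add: sum_distrib_left)
  also have "(\<Sum>m\<in>S. real (k - m) powr (- Re s2)) = (\<Sum>j\<in>(\<lambda>m. k - m - 1) ` S. real (Suc j) powr (- Re s2))"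
  proof -
    have inj: "inj_on (\<lambda>m. k - m - 1) S"
    proof (rule inj_onI)
      fix m m' assume "m \<in> S" "m' \<in> S" "k - m - 1 = k - m' - 1"
      with S(2)[of m] S(2)[of m'] show "m = m'" by linarith
    qed
    have "real (k - m) = real (Suc (k - m - 1))" if "m \<in> S" for m using S(2)[OF that] by simp
    then show ?thesis unfolding sum.reindex[OF inj] o_def by (intro sum.cong refl) simp
  qed
  also have "\<dots> \<le> (\<Sum>j<k. real (Suc j) powr (- Re s2))"
    using S assms by (intro sum_mono2) auto
  also have "\<dots> \<le> p / (p - 1) * real k powr (p - Re s2)" using assms by (intro sum_weight_le) auto
  also have "(real k / 2) powr (- Re s1) * (p / (p - 1) * real k powr (p - Re s2))
     = 2 powr Re s1 * (p / (p - 1)) * (real k powr (- Re s1) * real k powr (p - Re s2))"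
    using assms by (simp add: powr_divide powr_minus field_simps)
  also have "real k powr (- Re s1) * real k powr (p - Re s2) = real k powr (p - Re s2 - Re s1)"
    unfolding powr_add[symmetric] by (simp add: algebra_simps)
  finally show ?thesis by (simp add: mult_left_mono)
qed

lemma AV2_main_eq_dirichlet_poly:
  "AV2_main s1 s2 X (Complex \<sigma>3 t) =
     (\<Sum>k=1..2*X. (AV2_tcoeff s1 s2 X k * of_real (real k powr (-\<sigma>3))) * cis (- t * ln (real k)))"
proof -
  define s where "s = Complex \<sigma>3 t"
  define P where "P = (SIGMA j:{..<X}. {Suc j<..X})"
  define h where "h = (\<lambda>(j, m). of_nat m powr (-s1) * of_nat (Suc j) powr (-s2) * of_nat (m + Suc j) powr (-s))"
  have "AV2_main s1 s2 X s = (\<Sum>j<X. \<Sum>m\<in>{Suc j<..X}. h (j, m))"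
    unfolding AV2_main_def by (simp add: sum_distrib_left phi_def h_def mult_ac add_ac)
  also have "\<dots> = sum h P" unfolding P_def by (subst sum.Sigma) auto
  also have "\<dots> = (\<Sum>k\<in>{1..2*X}. sum h {x \<in> P. snd x + Suc (fst x) = k})"
    by (rule sum.group[symmetric]) (auto simp: P_def)
  also have "\<dots> = (\<Sum>k=1..2*X. (AV2_tcoeff s1 s2 X k * of_real (real k powr (-\<sigma>3))) * cis (- t * ln (real k)))"
  proof (intro sum.cong refl)
    fix k assume k: "k \<in> {1..2*X}"
    have "sum h {x \<in> P. snd x + Suc (fst x) = k}
      = (\<Sum>m\<in>{m. real k / 2 < real m \<and> m \<le> min X (k - 1)}. of_nat m powr (-s1) * of_nat (k - m) powr (-s2) * of_nat k powr (-s))"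
      by (rule sum.reindex_bij_witness[of _ "\<lambda>m. (k - m - 1, m)" snd]) (auto simp: P_def h_def)
    also have "\<dots> = AV2_tcoeff s1 s2 X k * of_nat k powr (-s)" by (simp add: AV2_tcoeff_def sum_distrib_right)
    also have "of_nat k powr (-s) = of_real (real k powr (-\<sigma>3)) * cis (- t * ln (real k))"
    proof -
      have "complex_of_nat k powr (-s) = exp (-s * of_real (ln (real k)))"
        using k by (simp add: powr_def Ln_of_nat)
      also have "\<dots> = of_real (exp (Re (-s * of_real (ln (real k))))) * cis (Im (-s * of_real (ln (real k))))"
        by (rule exp_eq_polar)
      also have "\<dots> = of_real (real k powr (-\<sigma>3)) * cis (- t * ln (real k))"
        using k by (simp add: s_def powr_def)
      finally show ?thesis .
    qed
    finally show "sum h {x \<in> P. snd x + Suc (fst x) = k} = (AV2_tcoeff s1 s2 X k * of_real (real k powr (-\<sigma>3))) * cis (- t * ln (real k))"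
      by (simp add: mult_ac)
  qed
  finally show ?thesis unfolding s_def .
qed

section \<open>The mean square\<close>

text \<open>Truncated and full coefficients coincide for k \<le> X, so only k > X contributes. There
  both squares lie between 0 and the same majorant, and so does the modulus of their
  difference.\<close>

lemma AV2_diag_sum:
  fixes \<sigma>3 \<gamma> C :: real
  assumes \<gamma>: "1 / 2 < \<gamma>" and X: "X \<ge> 1"
    and c: "\<And>X k. k \<ge> 1 \<Longrightarrow> norm (AV2_tcoeff s1 s2 X k * of_real (real k powr (-\<sigma>3))) \<le> C * real k powr (-\<gamma>)"
  shows "\<bar>(\<Sum>k=1..2*X. (norm (AV2_tcoeff s1 s2 X k * of_real (real k powr (-\<sigma>3))))\<^sup>2) - zeta_AV2_sq s1 s2 (2 * \<sigma>3)\<bar>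
     \<le> C\<^sup>2 * (2 * \<gamma> / (2 * \<gamma> - 1)) * real X powr (1 - 2 * \<gamma>)"
proof -
  define v where "v Y k = (norm (AV2_tcoeff s1 s2 Y k * of_real (real k powr (-\<sigma>3))))\<^sup>2" for Y k
  define u where "u j = (if j < 2 * X - 1 then v X (j + 2) else 0)" for j
  \<comment> \<open>Truncation at k itself removes nothing, so the full coefficients inherit the
    bound \<open>c\<close>, which holds for every truncation.\<close>
  define b where "b j = v (j + 2) (j + 2)" for j
  have v: "0 \<le> v Y k" "v Y k \<le> C\<^sup>2 * real k powr (- (2 * \<gamma>))" if "k \<ge> 1" for Y k
  proof -
    have "v Y k \<le> (C * real k powr (-\<gamma>))\<^sup>2" unfolding v_def using c[OF that] by (intro power_mono) auto
    also have "\<dots> = C\<^sup>2 * (real k powr (-\<gamma>) * real k powr (-\<gamma>))" by (simp add: power2_eq_square mult_ac)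
    also have "real k powr (-\<gamma>) * real k powr (-\<gamma>) = real k powr (- (2 * \<gamma>))" unfolding powr_add[symmetric] by simp
    finally show "v Y k \<le> C\<^sup>2 * real k powr (- (2 * \<gamma>))" .
  qed (simp add: v_def)
  have b_eq: "zeta_AV2_sq s1 s2 (2 * \<sigma>3) = (\<Sum>j. b j)"
    unfolding zeta_AV2_sq_def b_def v_def Let_def
  proof (intro suminf_cong)
    fix j :: nat
    define k where "k = j + 2"
    have "(norm (AV2_tcoeff s1 s2 k k * of_real (real k powr (-\<sigma>3))))\<^sup>2 = (norm (AV2_coeff s1 s2 k))\<^sup>2 * (real k powr (-\<sigma>3) * real k powr (-\<sigma>3))"
      by (subst AV2_tcoeff_eq) (simp_all add: norm_mult power_mult_distrib power2_eq_square)
    also have "real k powr (-\<sigma>3) * real k powr (-\<sigma>3) = real k powr (- (2 * \<sigma>3))" unfolding powr_add[symmetric] by simp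
    finally show "(cmod (\<Sum>m\<in>{m. real (j + 2) / 2 < real m \<and> m \<le> j + 2 - 1}. of_nat m powr - s1 * of_nat (j + 2 - m) powr - s2))\<^sup>2 * real (j + 2) powr - (2 * \<sigma>3) =
         (cmod (AV2_tcoeff s1 s2 (j + 2) (j + 2) * complex_of_real (real (j + 2) powr - \<sigma>3)))\<^sup>2"
      unfolding k_def AV2_coeff_def by simp
  qed
  have bs: "b sums (\<Sum>j. b j)"
  proof (rule summable_sums, rule summable_comparison_test')
    show "summable (\<lambda>j. C\<^sup>2 * real (2 + j) powr (- (2 * \<gamma>)))" using \<gamma> by (intro summable_mult summable_powr_shift) simp
    show "norm (b j) \<le> C\<^sup>2 * real (2 + j) powr (- (2 * \<gamma>))" for j
      using v[of "j + 2" "j + 2"] by (simp add: b_def add_ac)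
  qed
  \<comment> \<open>The coefficient for k = 1 is an empty sum. This reconciles the summation from 1
    with \<open>zeta_AV2_sq\<close>, which starts at k = 2.\<close>
  have v1: "v X 1 = 0"
  proof -
    have "{m. real 1 / 2 < real m \<and> m \<le> min X (1 - 1)} = {}" by auto
    then show ?thesis unfolding v_def AV2_tcoeff_def by (simp only: sum.empty) simp
  qed
  have us: "u sums (\<Sum>k=1..2*X. v X k)"
  proof -
    have "u sums (\<Sum>j<2*X-1. u j)" by (rule sums_finite) (auto simp: u_def)
    also have "(\<Sum>j<2*X-1. u j) = (\<Sum>k=2..2*X. v X k)"
      by (rule sum.reindex_bij_witness[of _ "\<lambda>k. k - 2" "\<lambda>j. j + 2"]) (auto simp: u_def)
    also have "\<dots> = (\<Sum>k=1..2*X. v X k)"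
      using X v1 sum.atLeast_Suc_atMost[of 1 "2*X" "v X"] by (simp add: numeral_2_eq_2)
    finally show ?thesis .
  qed
  have d: "(\<lambda>j. u j - b j) sums ((\<Sum>k=1..2*X. v X k) - zeta_AV2_sq s1 s2 (2 * \<sigma>3))"
    unfolding b_eq by (intro sums_diff us bs)
  have zero: "u j - b j = 0" if "j < X - 1" for j
    using that by (simp add: u_def b_def v_def AV2_tcoeff_eq)
  have le: "norm (u j - b j) \<le> C\<^sup>2 * real (j + 2) powr (- (2 * \<gamma>))" for j
    using v[of "j + 2" X] v[of "j + 2" "j + 2"] by (auto simp: u_def b_def)
  have d2: "(\<lambda>i. u (i + (X - 1)) - b (i + (X - 1))) sums ((\<Sum>k=1..2*X. v X k) - zeta_AV2_sq s1 s2 (2 * \<sigma>3))"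
    using sums_split_initial_segment[OF d, of "X - 1"] zero by simp
  have sm: "summable (\<lambda>i. C\<^sup>2 * real (Suc X + i) powr (- (2 * \<gamma>)))" using \<gamma> by (intro summable_mult summable_powr_shift) simp
  have le2: "norm (u (i + (X - 1)) - b (i + (X - 1))) \<le> C\<^sup>2 * real (Suc X + i) powr (- (2 * \<gamma>))" for i
    using le[of "i + (X - 1)"] X by (simp add: add_ac)
  have sm2: "summable (\<lambda>i. norm (u (i + (X - 1)) - b (i + (X - 1))))"
    by (rule summable_comparison_test'[OF sm]) (use le2 in auto)
  have "\<bar>(\<Sum>k=1..2*X. v X k) - zeta_AV2_sq s1 s2 (2 * \<sigma>3)\<bar> = norm (\<Sum>i. u (i + (X - 1)) - b (i + (X - 1)))"
    using d2 by (simp add: sums_iff)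
  also have "\<dots> \<le> (\<Sum>i. C\<^sup>2 * real (Suc X + i) powr (- (2 * \<gamma>)))"
    by (rule order_trans[OF summable_norm[OF sm2] suminf_le[OF le2 sm2 sm]])
  also have "\<dots> = C\<^sup>2 * (\<Sum>i. real (Suc X + i) powr (- (2 * \<gamma>)))" using \<gamma> by (intro suminf_mult summable_powr_shift) simp
  also have "\<dots> \<le> C\<^sup>2 * (2 * \<gamma> / (2 * \<gamma> - 1) * real (Suc X) powr (1 - 2 * \<gamma>))"
    using \<gamma> by (intro mult_left_mono suminf_powr_le) auto
  also have "\<dots> \<le> C\<^sup>2 * (2 * \<gamma> / (2 * \<gamma> - 1) * real X powr (1 - 2 * \<gamma>))"
    using \<gamma> X by (intro mult_left_mono powr_mono2') auto
  finally show ?thesis by (simp add: v_def mult_ac)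
qed

text \<open>On this line the hyperplanes with l \<ge> 1 are out of reach, because the real parts
  exceed 0 and 1 respectively. The assumed inequalities for l = 0 therefore exclude the whole
  singular set.\<close>

lemma zeta_AV2_continuous:
  assumes "Re s1 + \<sigma>3 > 1/2" "3/2 < Re s1 + Re s2 + \<sigma>3"
    and "\<forall>t\<ge>2. s1 + Complex \<sigma>3 t \<noteq> 1 \<and> s1 + s2 + Complex \<sigma>3 t \<noteq> 2" "S \<subseteq> {2..}"
  shows "continuous_on S (\<lambda>t. zeta_AV2 s1 s2 (Complex \<sigma>3 t))"
proof (rule continuous_on_compose2[OF holomorphic_on_imp_continuous_on[OF zeta_AV2_holomorphic]])
  show "continuous_on S (\<lambda>t. Complex \<sigma>3 t)" unfolding Complex_eq by (intro continuous_intros)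
  show "(\<lambda>t. Complex \<sigma>3 t) ` S \<subseteq> - AV2_sing s1 s2"
  proof safe
    fix t assume t: "t \<in> S" and "Complex \<sigma>3 t \<in> AV2_sing s1 s2"
    then obtain l :: nat where l: "s1 + Complex \<sigma>3 t = 1 - of_nat l \<or> s1 + s2 + Complex \<sigma>3 t = 2 - of_nat l"
      by (auto simp: AV2_sing_def)
    have "Re s1 + \<sigma>3 = 1 - real l \<or> Re s1 + Re s2 + \<sigma>3 = 2 - real l"
      using l by (auto simp: complex_eq_iff)
    then have "l = 0" using assms(1,2) by (cases l) auto
    then show False using l assms(3,4) t by auto
  qed
qed

text \<open>The cross term is split pointwise by 2 |g| d \<le> c |g|^2 + d^2 / c, with d = |f - g|.
  The free parameter \<open>c\<close> is later chosen of the same order in T as \<open>r\<close>,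
  which balances the two contributions.\<close>

lemma mean_square_perturb:
  fixes f g :: "real \<Rightarrow> complex" and c r :: real
  assumes "a \<le> b" "continuous_on {a..b} f" "continuous_on {a..b} g" "c > 0"
    and r: "\<And>t. t \<in> {a..b} \<Longrightarrow> norm (f t - g t) \<le> r"
  shows "\<bar>integral {a..b} (\<lambda>t. (norm (f t))\<^sup>2) - integral {a..b} (\<lambda>t. (norm (g t))\<^sup>2)\<bar>
     \<le> c * integral {a..b} (\<lambda>t. (norm (g t))\<^sup>2) + (b - a) * ((1 + 1 / c) * r\<^sup>2)"
proof -
  have int: "(\<lambda>t. (norm (f t))\<^sup>2) integrable_on {a..b}" "(\<lambda>t. (norm (g t))\<^sup>2) integrable_on {a..b}"
    "(\<lambda>t. c * (norm (g t))\<^sup>2) integrable_on {a..b}"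
    using assms by (auto intro!: integrable_continuous_real continuous_intros)
  have le: "norm ((norm (f t))\<^sup>2 - (norm (g t))\<^sup>2) \<le> c * (norm (g t))\<^sup>2 + (1 + 1 / c) * r\<^sup>2" if "t \<in> {a..b}" for t
  proof -
    define x y d where "x = norm (f t)" and "y = norm (g t)" and "d = norm (f t - g t)"
    have xy: "\<bar>x - y\<bar> \<le> d" "0 \<le> x" "0 \<le> y" "0 \<le> d" unfolding x_def y_def d_def
      by (rule norm_triangle_ineq3) (rule norm_ge_zero)+
    have "x\<^sup>2 - y\<^sup>2 = (x - y) * (x + y)" by (simp add: power2_eq_square algebra_simps)
    then have "\<bar>x\<^sup>2 - y\<^sup>2\<bar> = \<bar>x - y\<bar> * (x + y)" using xy by (simp add: abs_mult)
    also have "\<dots> \<le> d * (2 * y + d)" using xy by (intro mult_mono) auto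
    also have "\<dots> = 2 * (y * d) + d\<^sup>2" by (simp add: power2_eq_square algebra_simps)
    also have "2 * (y * d) \<le> c * y\<^sup>2 + d\<^sup>2 / c"
    proof -
      have "0 \<le> (c * y - d)\<^sup>2 / c" using assms by simp
      also have "\<dots> = c * y\<^sup>2 + d\<^sup>2 / c - 2 * (y * d)" using assms by (simp add: power2_eq_square field_simps)
      finally show ?thesis by simp
    qed
    finally have "\<bar>x\<^sup>2 - y\<^sup>2\<bar> \<le> c * y\<^sup>2 + (1 + 1 / c) * d\<^sup>2" by (simp add: algebra_simps)
    also have "(1 + 1 / c) * d\<^sup>2 \<le> (1 + 1 / c) * r\<^sup>2"
      using r[OF that] xy assms by (intro mult_left_mono power_mono) (auto simp: d_def)
    finally show ?thesis by (simp add: x_def y_def)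
  qed
  have "\<bar>integral {a..b} (\<lambda>t. (norm (f t))\<^sup>2) - integral {a..b} (\<lambda>t. (norm (g t))\<^sup>2)\<bar>
     = norm (integral {a..b} (\<lambda>t. (norm (f t))\<^sup>2 - (norm (g t))\<^sup>2))"
    using int by (simp add: integral_diff)
  also have "\<dots> \<le> integral {a..b} (\<lambda>t. c * (norm (g t))\<^sup>2 + (1 + 1 / c) * r\<^sup>2)"
    using le int by (intro integral_norm_bound_integral integrable_diff integrable_add int integrable_const_ivl) auto
  also have "\<dots> = c * integral {a..b} (\<lambda>t. (norm (g t))\<^sup>2) + (b - a) * ((1 + 1 / c) * r\<^sup>2)"
    using int assms by (subst integral_add) auto
  finally show ?thesis .
qed

text \<open>On a dyadic interval one \<open>X\<close> serves all t, so the approximant is a single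
  Dirichlet polynomial and the mean value estimate applies to it.\<close>

lemma AV2_mean_square_dyadic:
  fixes s1 s2 :: complex and \<sigma>3 p \<gamma> :: real
  assumes "Re s1 \<ge> 0" "Im s1 \<ge> 0" "\<sigma>3 > 0" and p: "p > 1" "p \<ge> Re s2"
    and \<gamma>: "\<gamma> = Re s1 + Re s2 + \<sigma>3 - p" "1/2 < \<gamma>" "\<gamma> < 1"
    and cont: "\<And>S. S \<subseteq> {2..} \<Longrightarrow> continuous_on S (\<lambda>t. zeta_AV2 s1 s2 (Complex \<sigma>3 t))"
  shows "\<exists>K T0. K \<ge> 0 \<and> T0 \<ge> 3 \<and> (\<forall>T\<ge>T0. \<bar>integral {T..2*T} (\<lambda>t. (norm (zeta_AV2 s1 s2 (Complex \<sigma>3 t)))\<^sup>2) - zeta_AV2_sq s1 s2 (2 * \<sigma>3) * T\<bar>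
     \<le> K * (T powr (2 - 2 * \<gamma>) * ln T))"
proof -
  define A where "A = zeta_AV2_sq s1 s2 (2 * \<sigma>3)"
  have "\<gamma> > 0" using \<gamma> by simp
  from AV2_rest_bound[OF assms(1-3) p \<gamma>(1) this] obtain R T1 where R: "R > 0" "T1 \<ge> 1"
    "\<And>T t X. T \<ge> T1 \<Longrightarrow> t \<in> {T..2*T} \<Longrightarrow> 3 * T \<le> real X \<Longrightarrow> real X \<le> 4 * T \<Longrightarrow>
       norm (AV2_rest s1 s2 X (Complex \<sigma>3 t)) \<le> R * T powr (-\<gamma>)" by blast
  define C where "C = 2 powr Re s1 * (p / (p - 1))"
  have C: "C \<ge> 0" using p by (simp add: C_def)
  have c: "norm (AV2_tcoeff s1 s2 X k * of_real (real k powr (-\<sigma>3))) \<le> C * real k powr (-\<gamma>)" if "k \<ge> 1" for X k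
  proof -
    have "norm (AV2_tcoeff s1 s2 X k * of_real (real k powr (-\<sigma>3))) = norm (AV2_tcoeff s1 s2 X k) * real k powr (-\<sigma>3)"
      by (simp add: norm_mult)
    also have "\<dots> \<le> (C * real k powr (p - Re s2 - Re s1)) * real k powr (-\<sigma>3)"
      unfolding C_def using assms p that by (intro mult_right_mono norm_AV2_tcoeff_le) auto
    also have "\<dots> = C * (real k powr (p - Re s2 - Re s1) * real k powr (-\<sigma>3))" by simp
    also have "real k powr (p - Re s2 - Re s1) * real k powr (-\<sigma>3) = real k powr (-\<gamma>)"
      unfolding powr_add[symmetric] \<gamma>(1) by (simp add: algebra_simps)
    finally show ?thesis .
  qed
  define G where "G = 1 / (1 - \<gamma>)\<^sup>2 + 1 / (1 - \<gamma>)"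
  have G: "G \<ge> 0" using \<gamma> by (simp add: G_def)
  define D where "D = C\<^sup>2 * (2 * \<gamma> / (2 * \<gamma> - 1))"
  have D: "D \<ge> 0" using \<gamma> by (simp add: D_def)
  \<comment> \<open>64 and 3 come from 2 X \<le> 8 T: (8 T)^(2 - 2 \<gamma>) \<le> 64 T^(2 - 2
    \<gamma>) and 1 + ln (8 T) \<le> 3 ln T.\<close>
  define E where "E = D + 2 * C\<^sup>2 * (G * 64 * 3)"
  have E: "E \<ge> 0" using D G by (simp add: E_def)
  define K where "K = E + (\<bar>A\<bar> + E) + 2 * R\<^sup>2"
  \<comment> \<open>The 8 provides ln T \<ge> 1, ln (8 T) \<le> 2 ln T and room for an integer
    between 3 T and 4 T; the last entry keeps the segment off \<open>AV2_sing\<close>.\<close>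
  define T0 where "T0 = max T1 (max 8 (\<bar>Im s1\<bar> + \<bar>Im s2\<bar> + 1))"
  show ?thesis
  proof (rule exI[of _ K], rule exI[of _ T0], intro conjI allI impI)
    show "K \<ge> 0" using E by (simp add: K_def)
    show "T0 \<ge> 3" by (simp add: T0_def)
    fix T assume "T \<ge> T0"
    then have T: "T \<ge> T1" "T \<ge> 8" "T \<ge> \<bar>Im s1\<bar> + \<bar>Im s2\<bar> + 1" by (auto simp: T0_def)
    have "exp 1 \<le> T" using T(2) exp_le by linarith
    then have lnT: "ln T \<ge> 1" using T(2) by (simp add: ln_ge_iff)
    define X where "X = nat \<lceil>3 * T\<rceil>"
    have X: "3 * T \<le> real X" "real X \<le> 4 * T" using T by (auto simp: X_def) linarith+
    have X1: "X \<ge> 1" using X T by linarith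
    define Z where "Z = (\<lambda>t. zeta_AV2 s1 s2 (Complex \<sigma>3 t))"
    define M where "M = (\<lambda>t. AV2_main s1 s2 X (Complex \<sigma>3 t))"
    define h where "h = T powr (2 - 2 * \<gamma>) * ln T"
    have M_eq: "M t = (\<Sum>k=1..2*X. (AV2_tcoeff s1 s2 X k * of_real (real k powr (-\<sigma>3))) * cis (- t * ln (real k)))" for t
      unfolding M_def by (rule AV2_main_eq_dirichlet_poly)
    have Mcont: "continuous_on {T..2*T} M"
      unfolding M_eq cis_conv_exp by (intro continuous_intros)
    have Zcont: "continuous_on {T..2*T} Z"
      unfolding Z_def using T by (intro cont) auto
    have ZM: "norm (Z t - M t) \<le> R * T powr (-\<gamma>)" if t: "t \<in> {T..2*T}" for t
    proof -
      have "t \<ge> T" using t by simp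
      then have "Im s1 + t > 0" "Im s1 + Im s2 + t > 0" using T(3) by linarith+
      then have ns: "Complex \<sigma>3 t \<notin> AV2_sing s1 s2"
        by (auto simp: AV2_sing_def complex_eq_iff)
      have "Z t = M t + AV2_rest s1 s2 X (Complex \<sigma>3 t)"
        unfolding Z_def M_def using assms p \<gamma> X1 by (intro zeta_AV2_eq_main_rest ns) auto
      then show ?thesis using R(3)[OF T(1) t X] by simp
    qed
    have h2: "T powr (2 - 2 * \<gamma>) \<le> h"
      unfolding h_def using lnT mult_left_mono[of 1 "ln T" "T powr (2 - 2 * \<gamma>)"] by simp
    \<comment> \<open>Replacing the polynomial by \<open>zeta_AV2\<close> costs T^(1 - \<gamma>). As
      \<gamma> < 1, this is dominated by the off-diagonal error T^(2 - 2 \<gamma>).\<close>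
    have h1: "T powr (1 - \<gamma>) \<le> h"
    proof -
      have "T powr (1 - \<gamma>) \<le> T powr (2 - 2 * \<gamma>)" using T \<gamma> by (intro powr_mono) auto
      also note h2
      finally show ?thesis .
    qed
    have h0: "h \<ge> 0" using lnT by (simp add: h_def)
    have Tg: "T powr (-\<gamma>) \<le> 1" "T powr (-\<gamma>) > 0" using T \<gamma> powr_mono[of "-\<gamma>" 0 T] by auto
    have TT: "T * T powr (-\<gamma>) = T powr (1 - \<gamma>)" using T powr_add[of T 1 "-\<gamma>"] by simp
    define S where "S = (\<Sum>k=1..2*X. (norm (AV2_tcoeff s1 s2 X k * of_real (real k powr (-\<sigma>3))))\<^sup>2)"
    have 1: "\<bar>T * S - T * A\<bar> \<le> D * h"
    proof -
      have "\<bar>S - A\<bar> \<le> D * real X powr (1 - 2 * \<gamma>)"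
        unfolding S_def A_def D_def by (rule AV2_diag_sum[OF \<gamma>(2) X1 c])
      also have "\<dots> \<le> D * T powr (1 - 2 * \<gamma>)"
        using D X T \<gamma> by (intro mult_left_mono powr_mono2') auto
      finally have "T * \<bar>S - A\<bar> \<le> T * (D * T powr (1 - 2 * \<gamma>))" using T by (intro mult_left_mono) auto
      also have "\<dots> = D * (T powr 1 * T powr (1 - 2 * \<gamma>))" using T by simp
      also have "T powr 1 * T powr (1 - 2 * \<gamma>) = T powr (2 - 2 * \<gamma>)" unfolding powr_add[symmetric] by simp
      also note h2
      finally show ?thesis using T D by (simp add: abs_mult mult_left_mono flip: right_diff_distrib)
    qed
    have 2: "\<bar>integral {T..2*T} (\<lambda>t. (norm (M t))\<^sup>2) - T * S\<bar> \<le> 2 * C\<^sup>2 * (G * 64 * 3) * h"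
    proof -
      have "\<bar>integral {T..2*T} (\<lambda>t. (norm (M t))\<^sup>2) - (2*T - T) * S\<bar>
        \<le> 2 * C\<^sup>2 * (G * real (2*X) powr (2 - 2 * \<gamma>) * (1 + ln (real (2*X))))"
        unfolding M_eq S_def G_def using T \<gamma> X1 C c by (intro dirichlet_poly_mean_square_le) auto
      also have "\<dots> \<le> 2 * C\<^sup>2 * (G * (64 * T powr (2 - 2 * \<gamma>)) * (3 * ln T))"
      proof (intro mult_left_mono mult_mono)
        have "real (2*X) powr (2 - 2 * \<gamma>) \<le> (8 * T) powr (2 - 2 * \<gamma>)" using X \<gamma> by (intro powr_mono2) auto
        also have "\<dots> = 8 powr (2 - 2 * \<gamma>) * T powr (2 - 2 * \<gamma>)" using T by (simp add: powr_mult)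
        also have "8 powr (2 - 2 * \<gamma>) \<le> (8::real) powr 2" using \<gamma> by (intro powr_mono) auto
        finally show "real (2*X) powr (2 - 2 * \<gamma>) \<le> 64 * T powr (2 - 2 * \<gamma>)" by (simp add: mult_right_mono)
        have "ln (real (2*X)) \<le> ln (8 * T)" using X X1 T by simp
        also have "\<dots> = ln 8 + ln T" using T by (simp add: ln_mult)
        also have "ln 8 \<le> ln T" using T by simp
        finally show "1 + ln (real (2*X)) \<le> 3 * ln T" using lnT by simp
        show "0 \<le> 1 + ln (real (2*X))" using X1 by simp
      qed (use G in auto)
      also have "\<dots> = 2 * C\<^sup>2 * (G * 64 * 3) * h" by (simp add: h_def mult_ac)
      finally show ?thesis by simp
    qed
    have 3: "\<bar>integral {T..2*T} (\<lambda>t. (norm (M t))\<^sup>2) - A * T\<bar> \<le> E * h"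
      using 1 2 by (simp add: E_def algebra_simps)
    have 4: "\<bar>integral {T..2*T} (\<lambda>t. (norm (Z t))\<^sup>2) - integral {T..2*T} (\<lambda>t. (norm (M t))\<^sup>2)\<bar> \<le> (\<bar>A\<bar> + E) * h + 2 * R\<^sup>2 * h"
    proof -
      define c where "c = T powr (-\<gamma>)"
      have "\<bar>integral {T..2*T} (\<lambda>t. (norm (Z t))\<^sup>2) - integral {T..2*T} (\<lambda>t. (norm (M t))\<^sup>2)\<bar>
        \<le> c * integral {T..2*T} (\<lambda>t. (norm (M t))\<^sup>2) + (2*T - T) * ((1 + 1 / c) * (R * c)\<^sup>2)"
        unfolding c_def using T Tg Zcont Mcont ZM by (intro mean_square_perturb) auto
      also have "c * integral {T..2*T} (\<lambda>t. (norm (M t))\<^sup>2) \<le> c * (\<bar>A\<bar> * T + E * h)"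
      proof (rule mult_left_mono)
        have "A * T \<le> \<bar>A\<bar> * T" using T by (intro mult_right_mono) auto
        then show "integral {T..2*T} (\<lambda>t. (norm (M t))\<^sup>2) \<le> \<bar>A\<bar> * T + E * h" using 3 by linarith
      qed (simp add: c_def)
      also have "c * (\<bar>A\<bar> * T + E * h) = \<bar>A\<bar> * T powr (1 - \<gamma>) + c * (E * h)"
        unfolding TT[symmetric] c_def by (simp add: algebra_simps)
      also have "\<bar>A\<bar> * T powr (1 - \<gamma>) \<le> \<bar>A\<bar> * h" using h1 by (intro mult_left_mono) auto
      also have "c * (E * h) \<le> 1 * (E * h)" using Tg E h0 unfolding c_def by (intro mult_right_mono) auto
      also have "(2*T - T) * ((1 + 1 / c) * (R * c)\<^sup>2) = R\<^sup>2 * (T * c) * (c + 1)"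
        using Tg by (simp add: c_def power2_eq_square field_simps)
      also have "\<dots> \<le> R\<^sup>2 * (T * c) * 2" using Tg T by (intro mult_left_mono) (auto simp: c_def)
      also have "T * c = T powr (1 - \<gamma>)" unfolding c_def TT ..
      also have "R\<^sup>2 * T powr (1 - \<gamma>) * 2 \<le> R\<^sup>2 * h * 2" using h1 by (intro mult_right_mono mult_left_mono) auto
      finally show ?thesis by (simp add: algebra_simps)
    qed
    show "\<bar>integral {T..2*T} (\<lambda>t. (norm (zeta_AV2 s1 s2 (Complex \<sigma>3 t)))\<^sup>2) - zeta_AV2_sq s1 s2 (2 * \<sigma>3) * T\<bar> \<le> K * (T powr (2 - 2 * \<gamma>) * ln T)"
      using 3 4[unfolded Z_def] unfolding A_def[symmetric] h_def[symmetric] K_def by (simp add: algebra_simps)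
  qed
qed

text \<open>Induction on the number of halvings. Since \<open>h\<close> grows at least by the factor
  1/q under doubling, the errors of the pieces form a geometric series, and their number costs no
  extra logarithm.\<close>

lemma dyadic_bigo:
  fixes F h :: "real \<Rightarrow> real" and q K T0 :: real
  assumes "T0 > 0" "K \<ge> 0" "0 < q" "q < 1"
    and step: "\<And>T. T \<ge> T0 \<Longrightarrow> \<bar>F (2 * T) - F T\<bar> \<le> K * h T"
    and h: "\<And>T. T \<ge> T0 \<Longrightarrow> h T \<le> q * h (2 * T)" "\<And>T. T \<ge> T0 \<Longrightarrow> h T0 \<le> h T" "h T0 > 0"
    and B: "\<And>T. T \<in> {T0..2*T0} \<Longrightarrow> \<bar>F T\<bar> \<le> B"
  shows "F \<in> O[at_top](h)"
proof -
  \<comment> \<open>The first entry covers the initial interval; the second is the solution of (L +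
    K) q = L, so that the bound reproduces itself under doubling.\<close>
  define L where "L = max (B / h T0) (K * q / (1 - q))"
  have LK: "(L + K) * q \<le> L"
  proof -
    have "K * q / (1 - q) \<le> L" by (simp add: L_def)
    then have "K * q \<le> L * (1 - q)" using assms(4) by (simp add: pos_divide_le_eq)
    then show ?thesis by (simp add: algebra_simps)
  qed
  have L0: "L \<ge> 0" unfolding L_def using assms by (simp add: le_max_iff_disj)
  have base: "\<bar>F T\<bar> \<le> L * h T" if T: "T \<ge> T0" "T \<le> 2 * T0" for T
  proof -
    have "B = B / h T0 * h T0" using h(3) by simp
    also have "\<dots> \<le> L * h T0" using h(3) by (intro mult_right_mono) (auto simp: L_def)
    also have "\<dots> \<le> L * h T" using h(2) T L0 by (intro mult_left_mono) auto
    finally show ?thesis using B[of T] T by simp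
  qed
  have main: "\<bar>F T\<bar> \<le> L * h T" if "T \<ge> T0" "T \<le> 2 ^ Suc n * T0" for n T
    using that
  proof (induction n arbitrary: T)
    case 0
    then show ?case using base by simp
  next
    case (Suc n)
    show ?case
    proof (cases "T \<le> 2 * T0")
      case True
      then show ?thesis using base Suc.prems by simp
    next
      case False
      define U where "U = T / 2"
      have U: "U \<ge> T0" "U \<le> 2 ^ Suc n * T0" "T = 2 * U" using False Suc.prems by (auto simp: U_def)
      have "\<bar>F T\<bar> \<le> \<bar>F U\<bar> + K * h U" using step[OF U(1)] U(3) by simp
      also have "\<dots> \<le> L * h U + K * h U" using Suc.IH[OF U(1,2)] by simp
      also have "\<dots> = (L + K) * h U" by (simp add: algebra_simps)
      also have "\<dots> \<le> (L + K) * (q * h T)" using h(1)[OF U(1)] U(3) L0 assms by (intro mult_left_mono) auto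
      also have "\<dots> = ((L + K) * q) * h T" by simp
      also have "\<dots> \<le> L * h T" using LK h(2)[OF Suc.prems(1)] h(3) by (intro mult_right_mono) auto
      finally show ?thesis .
    qed
  qed
  show ?thesis
  proof (rule bigoI[of _ L], rule eventually_at_top_linorderI[of T0])
    fix T assume T: "T \<ge> T0"
    obtain n where "T / T0 < 2 ^ n" using real_arch_pow[of 2 "T / T0"] by auto
    then have "T < 2 ^ n * T0" using assms(1) by (simp add: pos_divide_less_eq)
    also have "\<dots> \<le> 2 ^ Suc n * T0" using assms(1) by simp
    finally have "\<bar>F T\<bar> \<le> L * h T" using T main[of T n] by simp
    moreover have "h T \<ge> 0" using h(2)[OF T] h(3) by simp
    ultimately show "norm (F T) \<le> L * norm (h T)" by simp
  qed
qed

lemma AV2_mean_square: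
  fixes s1 s2 :: complex and \<sigma>3 p \<gamma> :: real
  assumes "Re s1 \<ge> 0" "Im s1 \<ge> 0" "\<sigma>3 > 0" and p: "p > 1" "p \<ge> Re s2"
    and \<gamma>: "\<gamma> = Re s1 + Re s2 + \<sigma>3 - p" "1/2 < \<gamma>" "\<gamma> < 1"
    and cont: "\<And>S. S \<subseteq> {2..} \<Longrightarrow> continuous_on S (\<lambda>t. zeta_AV2 s1 s2 (Complex \<sigma>3 t))"
  shows "(\<lambda>T. integral {2..T} (\<lambda>t. (cmod (zeta_AV2 s1 s2 (Complex \<sigma>3 t)))^2) - zeta_AV2_sq s1 s2 (2 * \<sigma>3) * T)
     \<in> O[at_top](\<lambda>T. T powr (2 - 2 * \<gamma>) * ln T)"
proof -
  define A where "A = zeta_AV2_sq s1 s2 (2 * \<sigma>3)"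
  define f where "f = (\<lambda>t. (cmod (zeta_AV2 s1 s2 (Complex \<sigma>3 t)))^2)"
  define F where "F = (\<lambda>T. integral {2..T} f - A * T)"
  define e where "e = 2 - 2 * \<gamma>"
  have e: "e > 0" using \<gamma> by (simp add: e_def)
  from AV2_mean_square_dyadic[OF assms] obtain K T0 where K: "K \<ge> 0" "T0 \<ge> 3"
    "\<And>T. T \<ge> T0 \<Longrightarrow> \<bar>integral {T..2*T} f - A * T\<bar> \<le> K * (T powr e * ln T)"
    unfolding f_def A_def e_def by blast
  have fint: "f integrable_on {a..b}" if "a \<ge> 2" for a b
    unfolding f_def using that by (intro integrable_continuous_real continuous_intros cont) auto
  have "continuous_on {T0..2*T0} F"
  proof -
    have "continuous_on {2..2*T0} (\<lambda>T. integral {2..T} f)" using fint by (intro indefinite_integral_continuous_1) auto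
    then have "continuous_on {T0..2*T0} (\<lambda>T. integral {2..T} f)" by (rule continuous_on_subset) (use K in auto)
    then show ?thesis unfolding F_def by (intro continuous_intros)
  qed
  then have "compact (F ` {T0..2*T0})" by (intro compact_continuous_image) auto
  then obtain B where B: "\<forall>y\<in>F ` {T0..2*T0}. norm y \<le> B" by (meson bounded_iff compact_imp_bounded)
  have "F \<in> O[at_top](\<lambda>T. T powr e * ln T)"
  \<comment> \<open>Doubling T multiplies T^e ln T by at least 2^e, and e > 0 because \<gamma> <
    1.\<close>
  proof (rule dyadic_bigo[where ?T0.0 = T0 and K = K and q = "2 powr (-e)" and B = B])
    show "2 powr (-e) < 1" using e powr_less_mono[of "-e" 0 2] by simp
    show "\<bar>F T\<bar> \<le> B" if "T \<in> {T0..2*T0}" for T using B that by auto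
    show "\<bar>F (2 * T) - F T\<bar> \<le> K * (T powr e * ln T)" if T: "T \<ge> T0" for T
    proof -
      have "integral {2..T} f + integral {T..2*T} f = integral {2..2*T} f"
        using T K by (intro Henstock_Kurzweil_Integration.integral_combine fint) auto
      then have "F (2 * T) - F T = integral {T..2*T} f - A * T" by (simp add: F_def algebra_simps)
      then show ?thesis using K(3)[OF T] by simp
    qed
    show "T powr e * ln T \<le> 2 powr (-e) * ((2 * T) powr e * ln (2 * T))" if T: "T \<ge> T0" for T
    proof -
      have "T powr e * ln T \<le> T powr e * ln (2 * T)" using T K by (intro mult_left_mono) auto
      also have "\<dots> = 2 powr (-e) * ((2 * T) powr e * ln (2 * T))"
        using T K by (simp add: powr_mult powr_minus)
      finally show ?thesis .
    qed
    show "T0 powr e * ln T0 \<le> T powr e * ln T" if T: "T \<ge> T0" for T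
      using T K e by (intro mult_mono powr_mono2) auto
    show "T0 powr e * ln T0 > 0" using K by simp
  qed (use K in auto)
  then show ?thesis unfolding F_def f_def A_def e_def .
qed

text \<open>Here \<alpha> = Re s1 + sigma3 and \<sigma> = Re s2. If \<sigma> > 1, the least
  admissible p = \<sigma> gives gamma = \<alpha>, and the inequality between exponents becomes
  \<sigma> < 1/2 + \<alpha>. If \<sigma> \<le> 1, then 1/2 + \<alpha> \<le> \<sigma> is impossible,
  and p only has to be close enough to 1.\<close>

lemma AV2_mean_square_exponent:
  fixes \<alpha> \<sigma> :: real
  assumes "\<alpha> > 1/2" "3/2 < \<alpha> + \<sigma>" "\<alpha> + \<sigma> \<le> 2"
  obtains p where "p > 1" "p \<ge> \<sigma>" "1/2 < \<alpha> + \<sigma> - p" "\<alpha> + \<sigma> - p < 1"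
    "1/2 + \<alpha> \<le> \<sigma> \<Longrightarrow> p = \<sigma>"
    "\<sigma> < 1/2 + \<alpha> \<Longrightarrow> 2 - 2 * (\<alpha> + \<sigma> - p) < 5/2 - \<alpha> - \<sigma>"
proof (cases "\<sigma> > 1")
  case True
  then show ?thesis using assms by (intro that[of \<sigma>]) auto
next
  case False
  \<comment> \<open>With the excess d = \<alpha> + \<sigma> - 3/2, which lies in (0, 1/2], the
    choice p = 1 + d/4 gives gamma = 1/2 + 3d/4, and the exponent 1 - 3d/2 is below 1 - d.\<close>
  then show ?thesis using assms by (intro that[of "1 + (\<alpha> + \<sigma> - 3/2) / 4"]) (auto simp: field_simps)
qed

theorem theorem1p3:
  fixes s1 s2 :: complex and \<sigma>3 :: real
  assumes "Re s1 \<ge> 0" "Im s1 \<ge> 0" "\<sigma>3 > 0"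
    and "Re s1 + \<sigma>3 > 1/2"
    and "3/2 < Re s1 + Re s2 + \<sigma>3" "Re s1 + Re s2 + \<sigma>3 \<le> 2"
    and "\<forall>t\<ge>2. s1 + Complex \<sigma>3 t \<noteq> 1 \<and> s1 + s2 + Complex \<sigma>3 t \<noteq> 2"
  shows
    "(Re s2 \<ge> 1/2 + Re s1 + \<sigma>3 \<longrightarrow>
       (\<lambda>T. integral {2..T} (\<lambda>t. (cmod (zeta_AV2 s1 s2 (Complex \<sigma>3 t)))^2)
             - zeta_AV2_sq s1 s2 (2 * \<sigma>3) * T)
       \<in> O[at_top](\<lambda>T. T powr (2 - 2 * Re s1 - 2 * \<sigma>3) * ln T)) \<and>
     (Re s2 < 1/2 + Re s1 + \<sigma>3 \<and> Re s1 + Re s2 + \<sigma>3 < 2 \<longrightarrow>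
       (\<lambda>T. integral {2..T} (\<lambda>t. (cmod (zeta_AV2 s1 s2 (Complex \<sigma>3 t)))^2)
             - zeta_AV2_sq s1 s2 (2 * \<sigma>3) * T)
       \<in> O[at_top](\<lambda>T. T powr (5/2 - Re s1 - Re s2 - \<sigma>3))) \<and>
     (Re s2 < 1/2 + Re s1 + \<sigma>3 \<and> Re s1 + Re s2 + \<sigma>3 = 2 \<longrightarrow>
       (\<lambda>T. integral {2..T} (\<lambda>t. (cmod (zeta_AV2 s1 s2 (Complex \<sigma>3 t)))^2)
             - zeta_AV2_sq s1 s2 (2 * \<sigma>3) * T)
       \<in> O[at_top](\<lambda>T. (T * ln T) powr (1/2)))"
    (is "(_ \<longrightarrow> ?F \<in> _) \<and> _ \<and> _")
proof -
  obtain p where p: "p > 1" "p \<ge> Re s2" "1/2 < Re s1 + \<sigma>3 + Re s2 - p" "Re s1 + \<sigma>3 + Re s2 - p < 1"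
    "1/2 + (Re s1 + \<sigma>3) \<le> Re s2 \<Longrightarrow> p = Re s2"
    "Re s2 < 1/2 + (Re s1 + \<sigma>3) \<Longrightarrow> 2 - 2 * (Re s1 + \<sigma>3 + Re s2 - p) < 5/2 - (Re s1 + \<sigma>3) - Re s2"
    using AV2_mean_square_exponent[of "Re s1 + \<sigma>3" "Re s2"] assms(4-6) by (auto simp: algebra_simps)
  define \<gamma> where "\<gamma> = Re s1 + Re s2 + \<sigma>3 - p"
  have \<gamma>: "1/2 < \<gamma>" "\<gamma> < 1" using p by (auto simp: \<gamma>_def)
  have main: "?F \<in> O[at_top](\<lambda>T. T powr (2 - 2 * \<gamma>) * ln T)"
    using assms p \<gamma> by (intro AV2_mean_square[OF _ _ _ p(1,2) \<gamma>_def \<gamma>] zeta_AV2_continuous) auto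
  \<comment> \<open>In the last two cases 2 - 2 \<gamma> is strictly below the exponent of T to be
    reached, and this absorbs the logarithm of \<open>main\<close>.\<close>
  have less: "(\<lambda>T. T powr a * ln T) \<in> O[at_top](\<lambda>T. T powr b)" if "a < b" for a b :: real
    using that by real_asymp
  have half: "(\<lambda>T. T powr (1/2)) \<in> O[at_top](\<lambda>T. (T * ln T) powr (1/2 :: real))"
    by real_asymp
  show ?thesis
  proof (intro conjI impI)
    assume "Re s2 \<ge> 1/2 + Re s1 + \<sigma>3"
    then have "2 - 2 * \<gamma> = 2 - 2 * Re s1 - 2 * \<sigma>3" using p(5) by (simp add: \<gamma>_def)
    then show "?F \<in> O[at_top](\<lambda>T. T powr (2 - 2 * Re s1 - 2 * \<sigma>3) * ln T)" using main by (simp only:)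
  next
    assume "Re s2 < 1/2 + Re s1 + \<sigma>3 \<and> Re s1 + Re s2 + \<sigma>3 < 2"
    then have "2 - 2 * \<gamma> < 5/2 - Re s1 - Re s2 - \<sigma>3" using p(6) by (simp add: \<gamma>_def algebra_simps)
    then show "?F \<in> O[at_top](\<lambda>T. T powr (5/2 - Re s1 - Re s2 - \<sigma>3))"
      by (rule landau_o.big_trans[OF main less])
  next
    assume "Re s2 < 1/2 + Re s1 + \<sigma>3 \<and> Re s1 + Re s2 + \<sigma>3 = 2"
    then have "2 - 2 * \<gamma> < 1/2" using p(6) by (simp add: \<gamma>_def algebra_simps)
    then show "?F \<in> O[at_top](\<lambda>T. (T * ln T) powr (1/2))"
      by (intro landau_o.big_trans[OF landau_o.big_trans[OF main less] half])
  qed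
qed

end
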